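(* In each of the following groups of knots, all the knots have type I colouring matrices (i.e. a colouring matrix equivalent to a type I matrix) and the same, indicated, Alexander polynomial, and consequently they cannot be distinguished by linear Alexander quandles: for any two knots $K,K'$ in the same group and every linear finite Alexander quandle $Q=\mathbb{Z}_n[t,t^{-1}]/(t-m)$ with $\gcd(m,n)=1$, one has $C_Q(K)=C_Q(K')$. - $5_{1},10_{132}$: $1-m+m^2-m^3+m^4$ - $7_{4},9_{2}$: $4-7m+4m^2$ - $7_{5},10_{130}$: $2-4m+5m^2-4m^3+2m^4$ - $7_{6},10_{133}$: $1-5m+7m^2-5m^3+m^4$ - $8_{3},10_{1}$: $4-9m+4m^2$ - $8_{5},10_{141}$: $1-3m+4m^2-5m^3+4m^4-3m^5+m^6$ - $8_{8},10_{129}$: $2-6m+9m^2-6m^3+2m^4$ - $8_{10},10_{143}$: $1-3m+6m^2-7m^3+6m^4-3m^5+m^6$ - $8_{16},10_{156}$: $1-4m+8m^2-9m^3+8m^4-4m^5+m^6$ - $8_{21},10_{136}$: $1-4m+5m^2-4m^3+m^4$ - $9_{15},10_{166}$: $2-10m+15m^2-10m^3+2m^4$ - $9_{20},10_{149}$: $1-5m+9m^2-11m^3+9m^4-5m^5+m^6$ - $9_{28},9_{29}$: $1-5m+12m^2-15m^3+12m^4-5m^5+m^6$ - $10_{10},10_{165}$: $3-11m+17m^2-11m^3+3m^4$ - $10_{12},10_{54}$: $2-6m+10m^2-11m^3+10m^4-6m^5+2m^6$ - $10_{18},10_{24}$: $4-14m+19m^2-14m^3+4m^4$ - $10_{20},10_{163}$: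 $3-9m+11m^2-9m^3+3m^4$ - $10_{23},10_{52}$: $2-7m+13m^2-15m^3+13m^4-7m^5+2m^6$ - $10_{25},10_{56}$: $2-8m+14m^2-17m^3+14m^4-8m^5+2m^6$ - $10_{28},10_{37}$: $4-13m+19m^2-13m^3+4m^4$ - $10_{31},10_{68}$: $4-14m+21m^2-14m^3+4m^4$ - $10_{34},10_{135}$: $3-9m+13m^2-9m^3+3m^4$ - $10_{127},10_{150}$: $1-4m+6m^2-7m^3+6m^4-4m^5+m^6$ - $8_{14},9_{8},10_{131}$: $2-8m+11m^2-8m^3+2m^4$
   Context: **Knot names.** Knots are named as in Rolfsen's table of prime knots up to ten crossings, in the original numbering running up to $10_{166}$ (in which $10_{161}$ and $10_{162}$ are the same knot, the Perko pair); thus $10_{163},10_{165},10_{166}$ here are called $10_{162},10_{164},10_{165}$ in tables that renumber after removing the duplicate. **Linear finite Alexander quandle.** For coprime integers $n\ge 1$ and $m$, the quandle $Q=\mathbb{Z}_n[t,t^{-1}]/(t-m)$ is identified with $\mathbb{Z}_n$, with operations $a\ast b=ma+(1-m)b$ and $a\ast' b=m^{-1}a+(1-m^{-1})b$ modulo $n$. **Colourings.** Let $D$ be an oriented diagram of a knot $K$ with $N\ge1$ crossings, hence $N$ arcs. A colouring of $D$ by $Q$ assigns $X_k\in Q$ to each arc $k$ so that at each crossing with incoming under-arc $i$, outgoing under-arc $i'$ and over-arc $j$: $X_{i'}=X_i\ast X_j$ if the crossing is positive (right-handed), $X_{i'}=X_i\ast' X_j$ if it is negative (left-handed). $C_Q(K)$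 is the number of colourings; it does not depend on the diagram of $K$. **Colouring matrix.** The $N\times N$ matrix over $\mathbb{Z}[m,m^{-1}]$ ($m$ regarded as an indeterminate), one row per crossing, encoding $mX_i+(1-m)X_j-X_{i'}=0$ (positive crossing) or $m^{-1}X_i+(1-m^{-1})X_j-X_{i'}=0$ (negative crossing); if some of $i,i',j$ coincide the corresponding entries are added. **Equivalent matrices.** $B$ is equivalent to a colouring matrix $A$ if it is obtained from $A$ by finitely many operations of the following kinds: (a) multiplying a row by $m$, $m^{-1}$ or $-1$; (b) replacing a row by its sum with another row; (c) swapping two rows; (d) swapping two columns. **Type I.** An $N\times N$ matrix is of type I if it is upper triangular with diagonal $(1,\dots,1,\alpha(m),0)$, its row $N-1$ is $(0,\dots,0,\alpha(m),-\alpha(m))$, and its last row is zero (other above-diagonal entries arbitrary). **Alexander polynomial.** The determinant of the matrix obtained from a colouring matrix by deleting the last row and column, defined up to multiplication by $\pm m^k$, and normalized to have no negative powers of $m$ and a positive constant term. *)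

theory Defs
  imports
    "Jordan_Normal_Form.Determinant"
    "Jordan_Normal_Form.Column_Operations"
    "HOL-Library.Poly_Mapping"
    "HOL-Library.FuncSet"
    "HOL-Combinatorics.Permutations"
    "HOL-Combinatorics.Orbits"
    "HOL-Number_Theory.Modular_Inverse"
begin

section \<open>Oriented knot diagrams as signed Gauss words\<close>

text \<open>
  An oriented knot diagram with $N \ge 1$ crossings, numbered $0, \dots, N-1$, is given by the
  cyclic word of the crossing passages met when travelling once along the knot. Each passage
  records the crossing, its sign (\<open>True\<close> for positive, i.e. right-handed) and whether the knot
  passes over or under.
\<close>

datatype passage =
    is_over: Over (crossing: nat) (positive: bool)
  | is_under: Under (crossing: nat) (positive: bool)

type_synonym gauss_word = "passage list"

definition crossings :: "gauss_word \<Rightarrow> nat" where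
  "crossings w = length w div 2"

definition valid_word :: "gauss_word \<Rightarrow> bool" where
  "valid_word w \<longleftrightarrow> crossings w \<ge> 1 \<and> distinct w \<and>
     (\<exists>\<epsilon>. set w = (\<Union>k<crossings w. {Over k (\<epsilon> k), Under k (\<epsilon> k)}))"

definition read_from :: "gauss_word \<Rightarrow> passage \<Rightarrow> gauss_word" where
  "read_from w x = dropWhile ((\<noteq>) x) w @ takeWhile ((\<noteq>) x) w"

text \<open>
  A pair \<open>(x, e)\<close> denotes one of the four edge ends at a crossing: the outgoing (\<open>e = True\<close>) or the
  incoming (\<open>e = False\<close>) end of the strand of passage \<open>x\<close>. In counterclockwise order they are
  over-out, under-out, over-in, under-in at a positive crossing, and over-out, under-in, over-in,
  under-out at a negative one. Gluing a disc to every boundary walk that always turns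
  left gives a closed oriented surface carrying the diagram. It has $N$ vertices and $2N$ edges
  and is connected, so it is a sphere if and only if there are $N+2$ faces.
\<close>

fun across_edge :: "gauss_word \<Rightarrow> passage \<times> bool \<Rightarrow> passage \<times> bool" where
  "across_edge w (x, True) = (read_from w x ! 1, False)"
| "across_edge w (x, False) = (last (read_from w x), True)"

fun clockwise :: "passage \<times> bool \<Rightarrow> passage \<times> bool" where
  "clockwise (Over k s, e) = (Under k s, e \<noteq> s)"
| "clockwise (Under k s, e) = (Over k s, e = s)"

definition faces :: "gauss_word \<Rightarrow> (passage \<times> bool) set set" where
  "faces w = orbit (clockwise \<circ> across_edge w) ` (set w \<times> UNIV)"

definition knot_diagram :: "gauss_word \<Rightarrow> bool" where
  "knot_diagram w \<longleftrightarrow> valid_word w \<and> card (faces w) = crossings w + 2"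


section \<open>Knots as diagrams up to Reidemeister moves\<close>

primrec relabel :: "(nat \<Rightarrow> nat) \<Rightarrow> passage \<Rightarrow> passage" where
  "relabel f (Over k s) = Over (f k) s"
| "relabel f (Under k s) = Under (f k) s"

definition strand :: "bool \<Rightarrow> passage \<Rightarrow> passage \<Rightarrow> gauss_word" where
  "strand d x y = (if d then [x, y] else [y, x])"

text \<open>
  In the third move, \<open>a\<close>, \<open>b\<close>, \<open>c\<close> are the crossings of the top with the middle, the top with the
  bottom and the middle with the bottom strand, and \<open>dT\<close>, \<open>dM\<close>, \<open>dB\<close> tell whether these strands
  run along the triangle as \<open>a \<rightarrow> b\<close>, \<open>a \<rightarrow> c\<close> and \<open>b \<rightarrow> c\<close>. Reading Booleans as signs and equality
  as their product, three directed lines have crossing signs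
  \<open>sa = (\<Delta> = (dT = dM))\<close>, \<open>sb = (\<Delta> = (dT = dB))\<close>, \<open>sc = (\<Delta> = (dM = dB))\<close>,
  where \<open>\<Delta>\<close> is the orientation of the triangle \<open>abc\<close>. A planar word satisfying this
  has the triangle as a face. Similarly, in the second move the opposite signs make the bigon
  a face. All oriented versions of the moves are covered. New crossings are fresh because
  isotopies only pass through knot diagrams.
\<close>

inductive reidemeister :: "gauss_word \<Rightarrow> gauss_word \<Rightarrow> bool" where
  rotate: "reidemeister (u @ v) (v @ u)"
| relabel: "inj f \<Longrightarrow> reidemeister w (map (relabel f) w)"
| move1_over: "reidemeister w (w @ [Over k s, Under k s])"
| move1_under: "reidemeister w (w @ [Under k s, Over k s])"
| move2_parallel:
    "reidemeister (u @ v)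
       (u @ [Over j s, Over k (\<not> s)] @ v @ [Under j s, Under k (\<not> s)])"
| move2_antiparallel:
    "reidemeister (u @ v)
       (u @ [Over j s, Over k (\<not> s)] @ v @ [Under k (\<not> s), Under j s])"
| move3:
    "T = strand dT (Over a sa) (Over b sb) \<Longrightarrow>
     M = strand dM (Under a sa) (Over c sc) \<Longrightarrow>
     B = strand dB (Under b sb) (Under c sc) \<Longrightarrow>
     sa = (\<Delta> = (dT = dM)) \<Longrightarrow> sb = (\<Delta> = (dT = dB)) \<Longrightarrow> sc = (\<Delta> = (dM = dB)) \<Longrightarrow>
     {P, Q, R} = {T, M, B} \<Longrightarrow>
     reidemeister (P @ u @ Q @ v @ R @ w) (rev P @ u @ rev Q @ v @ rev R @ w)"

definition isotopic :: "gauss_word \<Rightarrow> gauss_word \<Rightarrow> bool" where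
  "isotopic =
     equivclp (\<lambda>w w'. knot_diagram w \<and> knot_diagram w' \<and> reidemeister w w')"

type_synonym knot = "gauss_word set"

definition knot_of :: "gauss_word \<Rightarrow> knot" where
  "knot_of w = {w'. isotopic w w'}"


section \<open>Arcs and colourings by linear Alexander quandles\<close>

text \<open>Arc \<open>k\<close> is the arc that leaves crossing \<open>k\<close> as its under-strand.\<close>

definition arc_into :: "gauss_word \<Rightarrow> passage \<Rightarrow> nat" where
  "arc_into w x = crossing (last (filter is_under (read_from w x)))"

definition is_positive :: "gauss_word \<Rightarrow> nat \<Rightarrow> bool" where
  "is_positive w k \<longleftrightarrow> Over k True \<in> set w"

definition under_arc :: "gauss_word \<Rightarrow> nat \<Rightarrow> nat" where
  "under_arc w k = arc_into w (Under k (is_positive w k))"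

definition over_arc :: "gauss_word \<Rightarrow> nat \<Rightarrow> nat" where
  "over_arc w k = arc_into w (Over k (is_positive w k))"

definition quandle_op :: "int \<Rightarrow> int \<Rightarrow> int \<Rightarrow> int \<Rightarrow> int" where
  "quandle_op n m a b = (m * a + (1 - m) * b) mod n"

definition quandle_op' :: "int \<Rightarrow> int \<Rightarrow> int \<Rightarrow> int \<Rightarrow> int" where
  "quandle_op' n m a b =
     (modular_inverse n m * a + (1 - modular_inverse n m) * b) mod n"

definition colourings :: "int \<Rightarrow> int \<Rightarrow> gauss_word \<Rightarrow> (nat \<Rightarrow> int) set" where
  "colourings n m w = {X \<in> {..<crossings w} \<rightarrow>\<^sub>E {0..<n}. \<forall>k<crossings w.
     X k = (if is_positive w k then quandle_op n m (X (under_arc w k)) (X (over_arc w k))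
            else quandle_op' n m (X (under_arc w k)) (X (over_arc w k)))}"

definition colouring_number :: "int \<Rightarrow> int \<Rightarrow> gauss_word \<Rightarrow> nat" where
  "colouring_number n m w = card (colourings n m w)"


section \<open>Colouring matrices and the Alexander polynomial\<close>

text \<open>Laurent polynomials over the integers, as the group ring of the infinite cyclic group.\<close>

type_synonym laurent = "int \<Rightarrow>\<^sub>0 int"

definition mpow :: "int \<Rightarrow> laurent" where
  "mpow k = Poly_Mapping.single k 1"

definition laurent_of_poly :: "int poly \<Rightarrow> laurent" where
  "laurent_of_poly p = (\<Sum>i\<le>degree p. Poly_Mapping.single (int i) (coeff p i))"

definition colouring_matrix :: "gauss_word \<Rightarrow> laurent mat" where
  "colouring_matrix w = mat (crossings w) (crossings w) (\<lambda>(k, j).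
     let \<mu> = mpow (if is_positive w k then 1 else - 1) in
       (if j = under_arc w k then \<mu> else 0) + (if j = over_arc w k then 1 - \<mu> else 0)
         - (if j = k then 1 else 0))"

text \<open>All numberings of the crossings (rows) and of the arcs (columns) are admitted.\<close>

definition colouring_matrices :: "gauss_word \<Rightarrow> laurent mat set" where
  "colouring_matrices w =
     {mat (crossings w) (crossings w) (\<lambda>(i, j). colouring_matrix w $$ (\<rho> i, \<sigma> j)) | \<rho> \<sigma>.
        \<rho> permutes {..<crossings w} \<and> \<sigma> permutes {..<crossings w}}"

inductive equivalent_matrix :: "laurent mat \<Rightarrow> laurent mat \<Rightarrow> bool" for A where
  refl: "equivalent_matrix A A"
| mult: "equivalent_matrix A B \<Longrightarrow> i < dim_row B \<Longrightarrow> c \<in> {mpow 1, mpow (- 1), - 1} \<Longrightarrow>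
    equivalent_matrix A (multrow i c B)"
| add: "equivalent_matrix A B \<Longrightarrow> i < dim_row B \<Longrightarrow> j < dim_row B \<Longrightarrow> i \<noteq> j \<Longrightarrow>
    equivalent_matrix A (addrow 1 i j B)"
| swap_rows: "equivalent_matrix A B \<Longrightarrow> i < dim_row B \<Longrightarrow> j < dim_row B \<Longrightarrow>
    equivalent_matrix A (swaprows i j B)"
| swap_cols: "equivalent_matrix A B \<Longrightarrow> i < dim_col B \<Longrightarrow> j < dim_col B \<Longrightarrow>
    equivalent_matrix A (swapcols i j B)"

definition type_I :: "laurent mat \<Rightarrow> bool" where
  "type_I A \<longleftrightarrow> (\<exists>N \<alpha>. 2 \<le> N \<and> A \<in> carrier_mat N N \<and> upper_triangular A \<and>
     (\<forall>i<N - 2. A $$ (i, i) = 1) \<and>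
     A $$ (N - 2, N - 2) = \<alpha> \<and> A $$ (N - 2, N - 1) = - \<alpha> \<and>
     A $$ (N - 1, N - 1) = 0)"

definition has_type_I_matrix :: "knot \<Rightarrow> bool" where
  "has_type_I_matrix K \<longleftrightarrow>
     (\<exists>w\<in>K. \<exists>A\<in>colouring_matrices w. \<exists>B. equivalent_matrix A B \<and> type_I B)"

definition has_alexander_polynomial :: "knot \<Rightarrow> int poly \<Rightarrow> bool" where
  "has_alexander_polynomial K p \<longleftrightarrow> coeff p 0 > 0 \<and>
     (\<forall>w\<in>K. \<forall>A\<in>colouring_matrices w. \<exists>\<epsilon>\<in>{1, - 1}. \<exists>k.
        det (mat_delete A (crossings w - 1) (crossings w - 1)) =
          \<epsilon> * mpow k * laurent_of_poly p)"


section \<open>Knots of Rolfsen's table\<close>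

text \<open>
  In the first list, \<open>k\<close> and \<open>- k\<close> stand for passing over and under crossing \<open>k - 1\<close>. The second
  list gives the crossing signs.
\<close>

definition signed_gauss_code :: "int list \<Rightarrow> int list \<Rightarrow> gauss_word" where
  "signed_gauss_code xs \<epsilon>s =
     map (\<lambda>x. let k = nat \<bar>x\<bar> - 1 in
       if x > 0 then Over k (\<epsilon>s ! k = 1) else Under k (\<epsilon>s ! k = 1)) xs"

text \<open>
  The original numbering of the table up to $10_{166}$ is used. Each diagram
  realises the Conway notation given next to it, where a minus sign after a tangle stands for
  an additional tangle $-1$.
\<close>

definition rolfsen_table :: "((nat \<times> nat) \<times> gauss_word) list" where
  "rolfsen_table = [
  ((5, 1), signed_gauss_code \<comment> \<open>$5$\<close>
     [-1, 2, -3, 4, -5, 1, -2, 3, -4, 5]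
     [-1, -1, -1, -1, -1]),
  ((7, 4), signed_gauss_code \<comment> \<open>$313$\<close>
     [-1, 2, -3, 4, -5, 6, -7, 3, -2, 1, -4, 7, -6, 5]
     [1, 1, 1, 1, 1, 1, 1]),
  ((7, 5), signed_gauss_code \<comment> \<open>$322$\<close>
     [-1, 2, -3, 4, -5, 6, -7, 5, -4, 1, -2, 3, -6, 7]
     [-1, -1, -1, -1, -1, -1, -1]),
  ((7, 6), signed_gauss_code \<comment> \<open>$2212$\<close>
     [-1, 2, -3, 4, -5, 3, -6, 7, -2, 1, -7, 6, -4, 5]
     [-1, -1, -1, -1, -1, 1, 1]),
  ((8, 3), signed_gauss_code \<comment> \<open>$44$\<close>
     [-1, 2, -3, 4, -5, 6, -7, 8, -4, 3, -2, 1, -8, 7, -6, 5]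
     [-1, -1, -1, -1, 1, 1, 1, 1]),
  ((8, 5), signed_gauss_code \<comment> \<open>$3,3,2$\<close>
     [-1, 2, -3, 4, -5, 6, -7, 8, -4, 5, -6, 1, -2, 3, -8, 7]
     [1, 1, 1, 1, 1, 1, -1, -1]),
  ((8, 8), signed_gauss_code \<comment> \<open>$2312$\<close>
     [-1, 2, -3, 4, -5, 3, -6, 7, -8, 1, -2, 8, -7, 6, -4, 5]
     [1, 1, -1, -1, -1, 1, 1, 1]),
  ((8, 10), signed_gauss_code \<comment> \<open>$3,21,2$\<close>
     [-1, 2, -3, 4, -5, 6, -4, 7, -8, 5, -6, 1, -2, 3, -7, 8]
     [1, 1, 1, -1, -1, -1, 1, 1]),
  ((8, 14), signed_gauss_code \<comment> \<open>$22112$\<close>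
     [-1, 2, -3, 4, -5, 6, -4, 7, -8, 1, -2, 8, -7, 3, -6, 5]
     [-1, -1, -1, -1, 1, 1, -1, -1]),
  ((8, 16), signed_gauss_code \<comment> \<open>$.2.20$\<close>
     [-1, 2, -3, 4, -5, 6, -7, 3, -4, 8, -6, 1, -2, 7, -8, 5]
     [-1, -1, -1, -1, -1, 1, 1, 1]),
  ((8, 21), signed_gauss_code \<comment> \<open>$21,21,2-$\<close>
     [-1, 2, -3, 4, 5, -6, -7, 3, -4, 7, -8, 1, -2, 8, 6, -5]
     [-1, -1, -1, -1, 1, 1, -1, -1]),
  ((9, 2), signed_gauss_code \<comment> \<open>$72$\<close>
     [-1, 2, -3, 4, -5, 6, -7, 8, -9, 7, -6, 5, -4, 3, -2, 1, -8, 9]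
     [-1, -1, -1, -1, -1, -1, -1, -1, -1]),
  ((9, 8), signed_gauss_code \<comment> \<open>$2412$\<close>
     [-1, 2, -3, 4, -5, 3, -6, 7, -8, 9, -2, 1, -9, 8, -7, 6, -4, 5]
     [-1, -1, -1, -1, -1, 1, 1, 1, 1]),
  ((9, 15), signed_gauss_code \<comment> \<open>$2322$\<close>
     [-1, 2, -3, 4, -5, 6, -4, 3, -7, 8, -9, 1, -2, 9, -8, 7, -6, 5]
     [1, 1, -1, -1, 1, 1, 1, 1, 1]),
  ((9, 20), signed_gauss_code \<comment> \<open>$31212$\<close>
     [-1, 2, -3, 4, -5, 6, -7, 5, -8, 9, -4, 1, -2, 3, -9, 8, -6, 7]
     [-1, -1, -1, -1, -1, -1, -1, 1, 1]),
  ((9, 28), signed_gauss_code \<comment> \<open>$21,21,2+$\<close>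
     [-1, 2, -3, 4, -5, 6, -7, 3, -4, 7, -8, 1, -2, 8, -9, 5, -6, 9]
     [-1, -1, -1, -1, 1, 1, -1, -1, 1]),
  ((9, 29), signed_gauss_code \<comment> \<open>$.2.20.2$\<close>
     [-1, 2, -3, 4, -5, 6, -7, 8, -4, 3, -9, 7, -6, 1, -2, 9, -8, 5]
     [-1, -1, 1, 1, -1, 1, 1, -1, -1]),
  ((10, 1), signed_gauss_code \<comment> \<open>$82$\<close>
     [-1, 2, -3, 4, -5, 6, -7, 8, -9, 10, -8, 7, -6, 5, -4, 3, -2, 1, -10, 9]
     [-1, -1, -1, -1, -1, -1, -1, -1, 1, 1]),
  ((10, 10), signed_gauss_code \<comment> \<open>$51112$\<close>
     [-1, 2, -3, 4, -5, 6, -7, 8, -9, 7, -10, 5, -4, 3, -2, 1, -6, 10, -8, 9]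
     [1, 1, 1, 1, 1, 1, -1, -1, -1, 1]),
  ((10, 12), signed_gauss_code \<comment> \<open>$4312$\<close>
     [-1, 2, -3, 4, -5, 6, -7, 5, -8, 9, -10, 1, -2, 3, -4, 10, -9, 8, -6, 7]
     [1, 1, 1, 1, -1, -1, -1, 1, 1, 1]),
  ((10, 18), signed_gauss_code \<comment> \<open>$41122$\<close>
     [-1, 2, -3, 4, -5, 6, -7, 8, -9, 7, -6, 10, -4, 3, -2, 1, -10, 5, -8, 9]
     [1, 1, 1, 1, -1, -1, -1, -1, -1, -1]),
  ((10, 20), signed_gauss_code \<comment> \<open>$352$\<close>
     [-1, 2, -3, 4, -5, 6, -7, 8, -9, 10, -8, 7, -6, 5, -4, 1, -2, 3, -10, 9]
     [-1, -1, -1, -1, -1, -1, -1, -1, 1, 1]),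
  ((10, 23), signed_gauss_code \<comment> \<open>$33112$\<close>
     [-1, 2, -3, 4, -5, 6, -7, 8, -9, 7, -10, 3, -2, 1, -4, 5, -6, 10, -8, 9]
     [1, 1, 1, 1, 1, 1, -1, -1, -1, 1]),
  ((10, 24), signed_gauss_code \<comment> \<open>$3232$\<close>
     [-1, 2, -3, 4, -5, 6, -7, 8, -9, 10, -8, 7, -6, 3, -2, 1, -4, 5, -10, 9]
     [-1, -1, -1, -1, -1, -1, -1, -1, 1, 1]),
  ((10, 25), signed_gauss_code \<comment> \<open>$32212$\<close>
     [-1, 2, -3, 4, -5, 6, -7, 8, -9, 10, -8, 5, -4, 1, -2, 3, -6, 7, -10, 9]
     [-1, -1, -1, -1, -1, -1, -1, -1, 1, 1]),
  ((10, 28), signed_gauss_code \<comment> \<open>$31312$\<close>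
     [-1, 2, -3, 4, -5, 6, -7, 5, -8, 9, -10, 3, -2, 1, -4, 10, -9, 8, -6, 7]
     [1, 1, 1, 1, -1, -1, -1, 1, 1, 1]),
  ((10, 31), signed_gauss_code \<comment> \<open>$31132$\<close>
     [-1, 2, -3, 4, -5, 6, -7, 8, -9, 7, -6, 5, -10, 3, -2, 1, -4, 10, -8, 9]
     [1, 1, 1, 1, -1, -1, -1, -1, -1, 1]),
  ((10, 34), signed_gauss_code \<comment> \<open>$2512$\<close>
     [-1, 2, -3, 4, -5, 3, -6, 7, -8, 9, -10, 1, -2, 10, -9, 8, -7, 6, -4, 5]
     [1, 1, -1, -1, -1, 1, 1, 1, 1, 1]),
  ((10, 37), signed_gauss_code \<comment> \<open>$2332$\<close>
     [-1, 2, -3, 4, -5, 6, -7, 5, -4, 3, -8, 9, -10, 1, -2, 10, -9, 8, -6, 7]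
     [1, 1, -1, -1, -1, -1, -1, 1, 1, 1]),
  ((10, 52), signed_gauss_code \<comment> \<open>$311,3,2$\<close>
     [-1, 2, -3, 4, -5, 6, -7, 8, -9, 5, -6, 7, -10, 3, -2, 1, -4, 10, -8, 9]
     [-1, -1, -1, -1, 1, 1, 1, 1, 1, -1]),
  ((10, 54), signed_gauss_code \<comment> \<open>$23,3,2$\<close>
     [-1, 2, -3, 4, -5, 6, -7, 3, -4, 5, -8, 9, -10, 1, -2, 10, -9, 8, -6, 7]
     [-1, -1, 1, 1, 1, 1, 1, -1, -1, -1]),
  ((10, 56), signed_gauss_code \<comment> \<open>$221,3,2$\<close>
     [-1, 2, -3, 4, -5, 6, -7, 8, -4, 5, -6, 9, -10, 1, -2, 10, -9, 3, -8, 7]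
     [1, 1, 1, 1, 1, 1, -1, -1, 1, 1]),
  ((10, 68), signed_gauss_code \<comment> \<open>$211,3,3$\<close>
     [-1, 2, -3, 4, -5, 6, -7, 8, -9, 3, -10, 1, -2, 10, -6, 5, -4, 9, -8, 7]
     [1, 1, -1, -1, -1, -1, -1, -1, -1, 1]),
  ((10, 127), signed_gauss_code \<comment> \<open>$41,21,2-$\<close>
     [-1, 2, -3, 4, -5, 6, 7, -8, -9, 5, -6, 9, -10, 1, -2, 3, -4, 10, 8, -7]
     [-1, -1, -1, -1, -1, -1, 1, 1, -1, -1]),
  ((10, 129), signed_gauss_code \<comment> \<open>$32,21,2-$\<close>
     [-1, 2, -3, 4, -5, 6, -7, 8, -6, -9, 10, 7, -8, 3, -2, 1, -4, 5, 9, -10]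
     [1, 1, 1, 1, 1, -1, -1, -1, -1, -1]),
  ((10, 130), signed_gauss_code \<comment> \<open>$311,3,2-$\<close>
     [-1, 2, -3, 4, -5, 6, -7, -8, 9, 5, -6, 7, -10, 3, -2, 1, -4, 10, 8, -9]
     [-1, -1, -1, -1, 1, 1, 1, -1, -1, -1]),
  ((10, 131), signed_gauss_code \<comment> \<open>$311,21,2-$\<close>
     [-1, 2, -3, 4, -5, 6, 7, -8, -9, 5, -6, 9, -10, 3, -2, 1, -4, 10, 8, -7]
     [-1, -1, -1, -1, -1, -1, 1, 1, -1, -1]),
  ((10, 132), signed_gauss_code \<comment> \<open>$23,3,2-$\<close>
     [-1, 2, -3, 4, -5, -6, 7, 3, -4, 5, -8, 9, -10, 1, -2, 10, -9, 8, 6, -7]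
     [-1, -1, 1, 1, 1, -1, -1, -1, -1, -1]),
  ((10, 133), signed_gauss_code \<comment> \<open>$23,21,2-$\<close>
     [-1, 2, -3, 4, 5, -6, -7, 3, -4, 7, -8, 9, -10, 1, -2, 10, -9, 8, 6, -5]
     [-1, -1, -1, -1, 1, 1, -1, -1, -1, -1]),
  ((10, 135), signed_gauss_code \<comment> \<open>$221,21,2-$\<close>
     [-1, 2, -3, 4, -5, 6, -4, -7, 8, 5, -6, 9, -10, 1, -2, 10, -9, 3, 7, -8]
     [1, 1, 1, -1, -1, -1, -1, -1, 1, 1]),
  ((10, 136), signed_gauss_code \<comment> \<open>$22,22,2-$\<close>
     [-1, 2, -3, 4, 5, -6, -7, 8, -4, 3, -8, 7, -9, 10, -2, 1, -10, 9, 6, -5]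
     [1, 1, 1, 1, 1, 1, -1, -1, -1, -1]),
  ((10, 141), signed_gauss_code \<comment> \<open>$4,21,21-$\<close>
     [-1, 2, -3, 4, 5, -6, 7, 8, -9, 1, -2, 3, -4, 10, -8, 9, -10, -5, 6, -7]
     [1, 1, 1, 1, -1, -1, -1, -1, -1, -1]),
  ((10, 143), signed_gauss_code \<comment> \<open>$31,3,21-$\<close>
     [-1, 2, -3, 4, 5, -6, 7, 8, -9, 10, -4, 1, -2, 3, -8, 9, -10, -5, 6, -7]
     [-1, -1, -1, -1, -1, -1, -1, 1, 1, 1]),
  ((10, 149), signed_gauss_code \<comment> \<open>$(3,2)(21,2-)$\<close>
     [-1, 2, -3, 4, -5, 1, -2, 3, -6, 7, 8, -9, -10, 6, -7, 10, -4, 5, 9, -8]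
     [-1, -1, -1, -1, -1, -1, -1, 1, 1, -1]),
  ((10, 150), signed_gauss_code \<comment> \<open>$(21,2)(3,2-)$\<close>
     [-1, 2, -3, 4, -5, 1, -2, 5, -6, 7, -8, -9, 10, 6, -7, 8, -4, 3, 9, -10]
     [1, 1, 1, 1, 1, 1, 1, 1, -1, -1]),
  ((10, 156), signed_gauss_code \<comment> \<open>$-3:2:20$\<close>
     [1, -2, 3, 4, -5, 6, -7, 8, -9, -3, 2, -1, -10, 5, -8, 9, -4, 10, -6, 7]
     [-1, -1, -1, -1, -1, 1, 1, -1, -1, 1]),
  ((10, 163), signed_gauss_code \<comment> \<open>$-30:-20:-20$\<close>
     [1, -2, 3, 4, -5, -6, 7, -8, 9, 5, -10, -3, 2, -1, 8, -9, -4, 10, 6, -7]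
     [1, 1, 1, -1, 1, -1, -1, -1, -1, -1]),
  ((10, 165), signed_gauss_code \<comment> \<open>$8*2:-20$\<close>
     [-1, 2, 3, -4, -5, 6, -7, 8, -9, 5, -2, 1, -6, 10, -8, -3, 4, 9, -10, 7]
     [1, 1, -1, -1, 1, 1, 1, -1, -1, -1]),
  ((10, 166), signed_gauss_code \<comment> \<open>$8*2:.-20$\<close>
     [-1, 2, -3, -4, 5, 6, -2, 1, -7, 8, -9, 3, -6, 7, -10, 9, 4, -5, -8, 10]
     [1, 1, 1, 1, 1, 1, 1, -1, -1, 1])]"

definition rolfsen_diagram :: "nat \<times> nat \<Rightarrow> gauss_word" where
  "rolfsen_diagram k = the (map_of rolfsen_table k)"

primrec reflect :: "passage \<Rightarrow> passage" where
  "reflect (Over k s) = Over k (\<not> s)"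
| "reflect (Under k s) = Under k (\<not> s)"

text \<open>
  The table lists unoriented knots up to mirror image, so all knots obtained by reflecting the
  plane of the diagram and by reversing the orientation bear the same name.
\<close>

definition rolfsen_knots :: "nat \<times> nat \<Rightarrow> knot set" where
  "rolfsen_knots k = (let w = rolfsen_diagram k in
     {knot_of w, knot_of (map reflect w), knot_of (rev w), knot_of (rev (map reflect w))})"

end

theory Submission
  imports Defs
begin

text \<open>
  A colouring can be transported along the Gauss word, so Reidemeister moves induce bijections of
  colourings. For a type I matrix equivalent to a colouring matrix, back substitution gives
  $n \cdot \gcd(\alpha(m), n)$ colourings. Conversely, if the number of colourings is $n \cdot \gcd(p(m), n)$ for
  all $n$ and $m$, then $p$ is the Alexander polynomial: planarity makes one row redundant, so the colourings
  modulo $n$ are counted by the reduced matrix with determinant $\Delta$, and taking $m$ to be a large prime $q$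
  and $n$ a suitable multiple of $\Delta(q)$ yields $|\Delta(q)| = |p(q)|$ up to a power of $q$. Thus the
  invariance of the Alexander polynomial follows from that of the colouring numbers, and
  it suffices to reduce one matrix per knot. Reversal and reflection replace $m$ by $m^{-1}$, and $p$ is
  palindromic.
\<close>

section \<open>Positions of a Gauss word\<close>

text \<open>Modulo \<open>n\<close> a determinant does not fix the number of solutions: for a prime
  n = p, the matrices diag(p, p) and diag(p^2, 1) have p^2 and p of them. This is why the modulus
  must be a multiple of \<Delta>(q), up to a factor coprime to the modulus; then the unknowns can be
  peeled off one at a time and the gcds multiply. The prime q is coprime to that modulus, and
  infinitely many such values identify a polynomial up to sign. Planarity is given as a face count.
  It enters through an Alexander numbering of the regions, whose existence follows from comparing
  two finite cardinalities, hence first modulo each n. Its trace on the word,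
  \<open>balanced\<close>, can be checked by reading the word once, so the faces of the tabulated
  diagrams are never computed. Elimination over Laurent polynomials is not executed for the
  certificates. Null vectors of the pivot rows determine the entries that elimination would leave,
  so checking them is polynomial arithmetic on lists, valid for t = m and for t = m^-1
  alike.\<close>

lemma Suc_mod_less: "i < n \<Longrightarrow> Suc i mod n < n"
  by (rule mod_less_divisor) simp

text \<open>On a closed word a property can be carried round from any position where it is known.
  The start is kept free because the arc at a position is known only just behind an under-passage,
  which need not be position 0.\<close>

lemma cyclic_induct:
  fixes L :: nat
  assumes "i0 < L" "P i0" "\<And>i. i < L \<Longrightarrow> P i \<Longrightarrow> P (Suc i mod L)" "i < L"
  shows "P i"
proof -
  have *: "P ((i0 + d) mod L)" for d
  proof (induction d)
    case 0
    then show ?case using assms(1,2) by simp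
  next
    case (Suc d)
    have "P (Suc ((i0 + d) mod L) mod L)"
      using Suc assms(1,3) by simp
    then show ?case by (simp add: mod_Suc_eq)
  qed
  show ?thesis
  proof (cases "i0 \<le> i")
    case True
    then show ?thesis using *[of "i - i0"] assms(4) by simp
  next
    case False
    then show ?thesis using *[of "i + L - i0"] assms(1,4) by simp
  qed
qed

lemma read_from_nth:
  assumes "distinct w" "i < length w"
  shows "read_from w (w ! i) = rotate i w"
proof -
  have w: "w = take i w @ w ! i # drop (Suc i) w"
    using assms(2) by (simp add: id_take_nth_drop)
  have n: "w ! i \<notin> set (take i w)"
    using assms by (auto simp: in_set_conv_nth nth_eq_iff_index_eq)
  have t: "takeWhile ((\<noteq>) (w ! i)) w = take i w"
    by (subst w, subst takeWhile_append2) (use n in auto)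
  have d: "dropWhile ((\<noteq>) (w ! i)) w = w ! i # drop (Suc i) w"
    by (subst w, subst dropWhile_append2) (use n in auto)
  show ?thesis
    unfolding read_from_def t d using assms(2)
    by (simp add: rotate_drop_take Cons_nth_drop_Suc)
qed

text \<open>Rotating by one step moves the passage just left to the end of the word. An
  under-passage thereby becomes the last one; otherwise the filtered word stays the same. This
  replaces the global search in \<open>arc_into\<close> by a local rule.\<close>

lemma arc_into_Suc:
  assumes "distinct w" "i < length w"
  shows "arc_into w (w ! (Suc i mod length w)) =
    (if is_under (w ! i) then crossing (w ! i) else arc_into w (w ! i))"
proof -
  have "Suc i mod length w < length w" using assms(2) by (rule Suc_mod_less)
  have 1: "read_from w (w ! (Suc i mod length w)) = rotate1 (rotate i w)"
    using read_from_nth[OF assms(1) \<open>Suc i mod length w < length w\<close>]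
    by (metis rotate_Suc rotate_conv_mod)
  have "rotate i w \<noteq> []" using assms(2) by auto
  then obtain r where r: "rotate i w = w ! i # r"
    using assms(2) by (metis hd_rotate_conv_nth list.collapse length_greater_0_conv mod_less
        not_less_zero rotate_is_Nil_conv)
  show ?thesis
    unfolding arc_into_def 1 read_from_nth[OF assms] r by simp
qed

lemma across_edge_nth:
  assumes "distinct w" "i < length w" "length w \<ge> 2"
  shows "across_edge w (w ! i, True) = (w ! (Suc i mod length w), False)"
    and "across_edge w (w ! (Suc i mod length w), False) = (w ! i, True)"
proof -
  show "across_edge w (w ! i, True) = (w ! (Suc i mod length w), False)"
    using assms by (simp add: read_from_nth nth_rotate)
  have l: "Suc i mod length w < length w" using assms(2) by (rule Suc_mod_less)
  have "w \<noteq> []" using assms by auto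
  have "last (rotate (Suc i mod length w) w) = w ! i"
  proof -
    have "rotate (Suc i mod length w) w = rotate1 (rotate i w)"
      by (metis rotate_Suc rotate_conv_mod)
    moreover have "rotate i w \<noteq> []" using \<open>w \<noteq> []\<close> by simp
    ultimately have "last (rotate (Suc i mod length w) w) = hd (rotate i w)"
      by (cases "rotate i w") auto
    then show ?thesis using assms(2) \<open>w \<noteq> []\<close> by (simp add: hd_rotate_conv_nth)
  qed
  then show "across_edge w (w ! (Suc i mod length w), False) = (w ! i, True)"
    using read_from_nth[OF assms(1) l] by simp
qed

lemma valid_word_length: "valid_word w \<Longrightarrow> length w = 2 * crossings w"
proof -
  assume v: "valid_word w"
  then obtain \<epsilon> where e: "set w = (\<Union>k<crossings w. {Over k (\<epsilon> k), Under k (\<epsilon> k)})"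
    unfolding valid_word_def by blast
  have "card (\<Union>k<crossings w. {Over k (\<epsilon> k), Under k (\<epsilon> k)}) =
      (\<Sum>k<crossings w. card {Over k (\<epsilon> k), Under k (\<epsilon> k)})"
    by (rule card_UN_disjoint) auto
  also have "\<dots> = (\<Sum>k<crossings w. 2)"
    by (rule sum.cong) auto
  finally show ?thesis
    using v e distinct_card[of w] unfolding valid_word_def by simp
qed

text \<open>Makes the sign function of \<open>valid_word\<close> explicit, so that it need not be
  chosen anew in each proof.\<close>

lemma valid_word_set:
  assumes "valid_word w"
  shows "set w = (\<Union>k<crossings w. {Over k (is_positive w k), Under k (is_positive w k)})"
proof -
  obtain \<epsilon> where e: "set w = (\<Union>k<crossings w. {Over k (\<epsilon> k), Under k (\<epsilon> k)})"
    using assms unfolding valid_word_def by blast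
  have "is_positive w k = \<epsilon> k" if "k < crossings w" for k
    using that unfolding is_positive_def e by auto
  then show ?thesis unfolding e by auto
qed

lemma valid_word_distinct: "valid_word w \<Longrightarrow> distinct w"
  and valid_word_crossings: "valid_word w \<Longrightarrow> crossings w \<ge> 1"
  by (auto simp: valid_word_def)

lemma valid_word_crossing_less: "valid_word w \<Longrightarrow> x \<in> set w \<Longrightarrow> crossing x < crossings w"
  using valid_word_set by fastforce

lemma valid_word_positive:
  assumes "valid_word w" "x \<in> set w"
  shows "positive x = is_positive w (crossing x)"
proof -
  have "x \<in> (\<Union>k<crossings w. {Over k (is_positive w k), Under k (is_positive w k)})"
    using assms(2) valid_word_set[OF assms(1)] by simp
  then show ?thesis by auto
qed

lemma valid_word_mem:
  assumes "valid_word w" "k < crossings w"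
  shows "Over k (is_positive w k) \<in> set w" "Under k (is_positive w k) \<in> set w"
  using valid_word_set[OF assms(1)] assms(2) by auto

lemma valid_word_positions:
  assumes "valid_word w" "k < crossings w"
  obtains i j where "i < length w" "w ! i = Over k (is_positive w k)"
    "j < length w" "w ! j = Under k (is_positive w k)"
  using valid_word_mem[OF assms] by (metis in_set_conv_nth)

text \<open>Each crossing is met once over and once under. A sum over positions telescopes, while a
  sum over crossings is a combination of matrix rows; this identity passes from one to the
  other.\<close>

lemma sum_over_word:
  fixes F :: "passage \<Rightarrow> 'b::comm_monoid_add"
  assumes "valid_word w"
  shows "(\<Sum>i<length w. F (w ! i)) =
    (\<Sum>k<crossings w. F (Over k (is_positive w k)) + F (Under k (is_positive w k)))"
proof -
  have "(\<Sum>i<length w. F (w ! i)) = (\<Sum>x\<in>set w. F x)"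
    by (rule sum.reindex_bij_betw[OF bij_betw_nth])
       (use valid_word_distinct[OF assms] in auto)
  also have "\<dots> = (\<Sum>x\<in>(\<Union>k<crossings w. {Over k (is_positive w k), Under k (is_positive w k)}). F x)"
    using valid_word_set[OF assms] by simp
  also have "\<dots> = (\<Sum>k<crossings w. \<Sum>x\<in>{Over k (is_positive w k), Under k (is_positive w k)}. F x)"
    by (rule sum.UNION_disjoint) auto
  also have "\<dots> = (\<Sum>k<crossings w. F (Over k (is_positive w k)) + F (Under k (is_positive w k)))"
    by (rule sum.cong) auto
  finally show ?thesis .
qed

lemma ex_under_position:
  assumes "valid_word w"
  obtains i where "i < length w" "is_under (w ! i)"
  using valid_word_positions[OF assms, of 0] valid_word_crossings[OF assms]
  by (metis passage.disc(4) less_eq_Suc_le One_nat_def)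

lemma arc_into_less:
  assumes v: "valid_word w" and x: "x \<in> set w"
  shows "arc_into w x < crossings w"
proof -
  obtain i where i: "i < length w" "is_under (w ! i)" using ex_under_position[OF v] .
  let ?L = "length w"
  have d: "distinct w" using v by (rule valid_word_distinct)
  have "arc_into w (w ! j) < crossings w" if "j < ?L" for j
  \<comment> \<open>Behind an under-passage the arc is named after a crossing of the word, which
    makes this position a safe start.\<close>
  proof (rule cyclic_induct[where ?i0.0 = "Suc i mod ?L" and L = ?L, OF _ _ _ that])
    show "arc_into w (w ! (Suc i mod ?L)) < crossings w"
      using arc_into_Suc[OF d i(1)] i valid_word_crossing_less[OF v] by simp
    show "arc_into w (w ! (Suc j mod ?L)) < crossings w"
      if "j < ?L" "arc_into w (w ! j) < crossings w" for j
      using arc_into_Suc[OF d that(1)] that valid_word_crossing_less[OF v] by simp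
  qed (rule Suc_mod_less[OF i(1)])
  then show ?thesis using x by (metis in_set_conv_nth)
qed

lemma under_arc_less: "valid_word w \<Longrightarrow> k < crossings w \<Longrightarrow> under_arc w k < crossings w"
  and over_arc_less: "valid_word w \<Longrightarrow> k < crossings w \<Longrightarrow> over_arc w k < crossings w"
  unfolding under_arc_def over_arc_def using arc_into_less valid_word_mem by blast+

section \<open>Colourings along the word\<close>

text \<open>
  A colouring is read off while travelling along the knot: \<open>Y k\<close> is the colour of the
  strand over crossing \<open>k\<close>, and the colour of the current strand changes at under-passages only.
\<close>

fun passes :: "(bool \<Rightarrow> 'c \<Rightarrow> 'c \<Rightarrow> 'c) \<Rightarrow> (nat \<Rightarrow> 'c) \<Rightarrow> gauss_word \<Rightarrow> 'c \<Rightarrow> 'c \<Rightarrow> bool" where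
  "passes f Y [] a b \<longleftrightarrow> a = b"
| "passes f Y (Over k s # w) a b \<longleftrightarrow> Y k = a \<and> passes f Y w a b"
| "passes f Y (Under k s # w) a b \<longleftrightarrow> passes f Y w (f s a (Y k)) b"

text \<open>\<open>passes\<close> also tests the colours at over-passages, \<open>transport\<close>
  only follows the strand. Being total, it names the intermediate colours whose existence
  \<open>passes_append\<close> asserts.\<close>

fun transport :: "(bool \<Rightarrow> 'c \<Rightarrow> 'c \<Rightarrow> 'c) \<Rightarrow> (nat \<Rightarrow> 'c) \<Rightarrow> gauss_word \<Rightarrow> 'c \<Rightarrow> 'c" where
  "transport f Y [] a = a"
| "transport f Y (Over k s # w) a = transport f Y w a"
| "transport f Y (Under k s # w) a = transport f Y w (f s a (Y k))"

definition crossing_set :: "gauss_word \<Rightarrow> nat set" where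
  "crossing_set w = crossing ` set w"

text \<open>The data are indexed by crossings instead of arcs, plus the colour at the base point. A
  move rearranges the arcs in a way that depends on the rest of the diagram, whereas the colours
  \<open>Y\<close> at the untouched crossings stay as they are.\<close>

definition loops :: "'c set \<Rightarrow> (bool \<Rightarrow> 'c \<Rightarrow> 'c \<Rightarrow> 'c) \<Rightarrow> gauss_word \<Rightarrow> ('c \<times> (nat \<Rightarrow> 'c)) set" where
  "loops Q f w = {(a, Y). a \<in> Q \<and> Y \<in> crossing_set w \<rightarrow>\<^sub>E Q \<and> passes f Y w a a}"

lemma word_induct [case_names Nil Over Under]:
  assumes "P []" "\<And>k s w. P w \<Longrightarrow> P (Over k s # w)" "\<And>k s w. P w \<Longrightarrow> P (Under k s # w)"
  shows "P w"
proof (induction w)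
  case (Cons x w)
  then show ?case using assms(2,3) by (cases x) auto
qed (rule assms(1))

lemma passes_transport: "passes f Y w a b \<Longrightarrow> transport f Y w a = b"
  by (induction w arbitrary: a rule: word_induct) auto

lemma passes_append: "passes f Y (u @ v) a b \<longleftrightarrow> (\<exists>c. passes f Y u a c \<and> passes f Y v c b)"
  by (induction u arbitrary: a rule: word_induct) auto

lemma passes_append_transport:
  "passes f Y (u @ v) a b \<longleftrightarrow>
    passes f Y u a (transport f Y u a) \<and> passes f Y v (transport f Y u a) b"
  unfolding passes_append by (auto dest: passes_transport)

lemma passes_cong: "(\<And>k. k \<in> crossing_set w \<Longrightarrow> Y k = Z k) \<Longrightarrow> passes f Y w a b = passes f Z w a b"
  by (induction w arbitrary: a rule: word_induct) (auto simp: crossing_set_def)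

lemma transport_cong: "(\<And>k. k \<in> crossing_set w \<Longrightarrow> Y k = Z k) \<Longrightarrow> transport f Y w a = transport f Z w a"
  by (induction w arbitrary: a rule: word_induct) (auto simp: crossing_set_def)

lemma crossing_set_simps [simp]:
  "crossing_set [] = {}"
  "crossing_set (x # w) = insert (crossing x) (crossing_set w)"
  "crossing_set (u @ v) = crossing_set u \<union> crossing_set v"
  by (auto simp: crossing_set_def)

lemma crossing_set_rev [simp]: "crossing_set (rev w) = crossing_set w"
  by (simp add: crossing_set_def)

lemma crossing_set_valid: "valid_word w \<Longrightarrow> crossing_set w = {..<crossings w}"
  unfolding crossing_set_def by (subst valid_word_set) (auto simp: image_UN)

text \<open>\<open>f True\<close> and \<open>f False\<close> are the operation of a quandle and its
  inverse. The laws \<open>idem\<close>, \<open>cancel\<close> and \<open>distrib\<close> are what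
  the first, second and third Reidemeister move require. Stated for all signs, they are symmetric in
  the two operations, which is what orientation reversal exchanges.\<close>

locale quandle_pair =
  fixes Q :: "'c set" and f :: "bool \<Rightarrow> 'c \<Rightarrow> 'c \<Rightarrow> 'c"
  assumes closed: "f s a b \<in> Q"
    and idem: "a \<in> Q \<Longrightarrow> f s a a = a"
    and cancel: "a \<in> Q \<Longrightarrow> b \<in> Q \<Longrightarrow> f (\<not> s) (f s a b) b = a"
    and distrib: "a \<in> Q \<Longrightarrow> b \<in> Q \<Longrightarrow> c \<in> Q \<Longrightarrow>
      f s (f r a b) c = f r (f s a c) (f s b c)"
begin

lemma cancel': "a \<in> Q \<Longrightarrow> b \<in> Q \<Longrightarrow> f s (f (\<not> s) a b) b = a"
  using cancel[of a b "\<not> s"] by simp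

lemma transport_closed: "a \<in> Q \<Longrightarrow> transport f Y w a \<in> Q"
  by (induction w arbitrary: a rule: word_induct) (auto simp: closed)

lemma passes_closed: "a \<in> Q \<Longrightarrow> passes f Y w a b \<Longrightarrow> b \<in> Q"
  using transport_closed passes_transport by metis

lemma quandle_pair_inverse: "quandle_pair Q (\<lambda>s. f (\<not> s))"
  by unfold_locales (rule closed | erule idem | erule (1) cancel | erule (2) distrib)+

text \<open>Walking backwards undoes the step at each under-passage. Crossing signs do not change
  under reversal, so the reversed word is traversed with the inverse operations and the same
  \<open>Y\<close>.\<close>

lemma passes_rev:
  assumes "\<And>k. k \<in> crossing_set w \<Longrightarrow> Y k \<in> Q" "a \<in> Q" "b \<in> Q"
  shows "passes (\<lambda>s. f (\<not> s)) Y (rev w) b a \<longleftrightarrow> passes f Y w a b"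
  using assms
proof (induction w arbitrary: a rule: word_induct)
  case Nil
  then show ?case by auto
next
  case (Over k s w)
  have "passes (\<lambda>s. f (\<not> s)) Y (rev w) b a \<longleftrightarrow> passes f Y w a b"
    by (rule Over.IH) (use Over.prems in auto)
  then show ?case by (simp add: passes_append) blast
next
  case (Under k s w)
  interpret n: quandle_pair Q "\<lambda>s. f (\<not> s)"
    by (rule quandle_pair_inverse)
  have Q: "Y k \<in> Q" using Under.prems by simp
  have IH: "passes (\<lambda>s. f (\<not> s)) Y (rev w) b c \<longleftrightarrow> passes f Y w c b" if "c \<in> Q" for c
    by (rule Under.IH) (use Under.prems that in auto)
  have "passes (\<lambda>s. f (\<not> s)) Y (rev (Under k s # w)) b a \<longleftrightarrow>
      (\<exists>c. passes (\<lambda>s. f (\<not> s)) Y (rev w) b c \<and> f (\<not> s) c (Y k) = a)"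
    by (simp add: passes_append)
  also have "\<dots> \<longleftrightarrow> (\<exists>c\<in>Q. passes f Y w c b \<and> f (\<not> s) c (Y k) = a)"
    using n.passes_closed[OF \<open>b \<in> Q\<close>] IH by metis
  also have "\<dots> \<longleftrightarrow> passes f Y w (f s a (Y k)) b"
  proof -
    have "f (\<not> s) c (Y k) = a \<longleftrightarrow> c = f s a (Y k)" if "c \<in> Q" for c
      using cancel cancel' Under.prems(2) that Q by metis
    then show ?thesis using closed[of s a "Y k"] by metis
  qed
  finally show ?case by simp
qed

lemma loops_rev: "loops Q (\<lambda>s. f (\<not> s)) (rev w) = loops Q f w"
  unfolding loops_def using passes_rev[of w] by (auto simp: PiE_iff)

section \<open>Effect of rotation, relabelling and the three moves on loops\<close>

lemma loops_rotate: "card (loops Q f (u @ v)) = card (loops Q f (v @ u))"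
proof -
  have "bij_betw (\<lambda>(a, Y). (transport f Y u a, Y)) (loops Q f (u @ v)) (loops Q f (v @ u))"
    by (rule bij_betw_byWitness[where f' = "\<lambda>(a, Y). (transport f Y v a, Y)"])
       (auto simp: loops_def passes_append transport_closed Un_commute dest: passes_transport)
  then show ?thesis by (rule bij_betw_same_card)
qed

lemma loops_relabel:
  assumes "inj g"
  shows "card (loops Q f (map (relabel g) w)) = card (loops Q f w)"
proof -
  have C: "crossing_set (map (relabel g) w) = g ` crossing_set w"
    unfolding crossing_set_def image_image set_map
    by (rule image_cong[OF HOL.refl]) (metis passage.exhaust passage.sel(1,2) relabel.simps)
  have p: "passes f Y (map (relabel g) w) a b = passes f (Y \<circ> g) w a b" for Y a b
    by (induction w arbitrary: a rule: word_induct) auto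
  let ?C = "crossing_set w"
  have "bij_betw (\<lambda>(a, Y). (a, restrict (Y \<circ> g) ?C)) (loops Q f (map (relabel g) w)) (loops Q f w)"
  proof (rule bij_betw_byWitness[where f' = "\<lambda>(a, Y). (a, restrict (Y \<circ> inv_into UNIV g) (g ` ?C))"])
    show "\<forall>x\<in>loops Q f (map (relabel g) w).
       (case case x of (a, Y) \<Rightarrow> (a, restrict (Y \<circ> g) ?C) of
          (a, Y) \<Rightarrow> (a, restrict (Y \<circ> inv_into UNIV g) (g ` ?C))) = x"
      using assms by (auto simp: loops_def C PiE_iff extensional_def fun_eq_iff restrict_def)
    show "\<forall>x\<in>loops Q f w.
       (case case x of (a, Y) \<Rightarrow> (a, restrict (Y \<circ> inv_into UNIV g) (g ` ?C)) of
          (a, Y) \<Rightarrow> (a, restrict (Y \<circ> g) ?C)) = x"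
      using assms by (auto simp: loops_def C PiE_iff extensional_def fun_eq_iff restrict_def)
    have "passes f (restrict (Y \<circ> g) ?C) w a b = passes f (Y \<circ> g) w a b" for Y a b
      by (rule passes_cong) auto
    then show "(\<lambda>(a, Y). (a, restrict (Y \<circ> g) ?C)) ` loops Q f (map (relabel g) w) \<subseteq> loops Q f w"
      by (auto simp: loops_def C p)
    have "passes f (restrict (Y \<circ> inv_into UNIV g) (g ` ?C) \<circ> g) w a b = passes f Y w a b" for Y a b
      by (rule passes_cong) (use assms in auto)
    then show "(\<lambda>(a, Y). (a, restrict (Y \<circ> inv_into UNIV g) (g ` ?C))) ` loops Q f w
        \<subseteq> loops Q f (map (relabel g) w)"
      using assms by (auto simp: loops_def C p PiE_iff)
  qed
  then show ?thesis by (rule bij_betw_same_card)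
qed

text \<open>A move that adds crossings whose over-colours are forced by the remaining colouring.\<close>

lemma loops_extend:
  assumes C: "crossing_set w' = crossing_set w \<union> K" and K: "crossing_set w \<inter> K = {}"
    and c: "\<And>a Y k. a \<in> Q \<Longrightarrow> c a Y k \<in> Q"
    and c_cong: "\<And>a Y Z. (\<And>k. k \<in> crossing_set w \<Longrightarrow> Y k = Z k) \<Longrightarrow> c a Y = c a Z"
    and fwd: "\<And>a Y. a \<in> Q \<Longrightarrow> (\<And>k. k \<in> crossing_set w' \<Longrightarrow> Y k \<in> Q) \<Longrightarrow> passes f Y w' a a \<longleftrightarrow>
      passes f Y w a a \<and> (\<forall>k\<in>K. Y k = c a Y k)"
  shows "card (loops Q f w') = card (loops Q f w)"
proof -
  let ?C = "crossing_set w"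
  let ?r = "\<lambda>(a, Y). (a, restrict Y ?C)"
  let ?e = "\<lambda>(a, Y) . (a, \<lambda>k. if k \<in> K then c a Y k else Y k)"
  have r: "passes f (restrict Y ?C) w a b = passes f Y w a b" for Y a b
    by (rule passes_cong) auto
  have e: "passes f (\<lambda>k. if k \<in> K then c a Y k else Y k) w a b = passes f Y w a b" for Y a b
    by (rule passes_cong) (use K in auto)
  have cr: "c a (restrict Y ?C) = c a Y" "c a (\<lambda>k. if k \<in> K then c a Y k else Y k) = c a Y" for a Y
    by (rule c_cong; use K in auto)+
  have "bij_betw ?r (loops Q f w') (loops Q f w)"
  proof (rule bij_betw_byWitness[where f' = ?e])
    show "\<forall>x\<in>loops Q f w'. ?e (?r x) = x"
      using fwd by (auto simp: loops_def C PiE_iff cr extensional_def fun_eq_iff)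
    show "\<forall>x\<in>loops Q f w. ?r (?e x) = x"
      using K by (auto simp: loops_def PiE_iff extensional_def fun_eq_iff restrict_def)
    show "?r ` loops Q f w' \<subseteq> loops Q f w"
      using fwd by (auto simp: loops_def C r PiE_iff)
    show "?e ` loops Q f w \<subseteq> loops Q f w'"
    proof (clarify)
      fix a Y assume l: "(a, Y) \<in> loops Q f w"
      let ?Y = "\<lambda>k. if k \<in> K then c a Y k else Y k"
      have "?Y \<in> crossing_set w' \<rightarrow>\<^sub>E Q"
        using l c by (auto simp: loops_def C PiE_iff extensional_def)
      moreover have "passes f ?Y w' a a"
        using l calculation by (subst fwd) (auto simp: e cr loops_def PiE_iff)
      ultimately show "(a, ?Y) \<in> loops Q f w'" using l by (auto simp: loops_def)
    qed
  qed
  then show ?thesis by (rule bij_betw_same_card)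
qed

text \<open>In the order under, over the condition is \<open>f s a (Y k) = Y k\<close>. Undoing the
  operation, which fixes \<open>Y k\<close> by \<open>idem\<close>, turns it into
  \<open>a = Y k\<close>; so both orders force the same colour.\<close>

lemma passes_kink:
  assumes "a \<in> Q" "Y k \<in> Q" "t \<in> {[Over k s, Under k s], [Under k s, Over k s]}"
  shows "passes f Y t a b \<longleftrightarrow> Y k = a \<and> a = b"
proof -
  have "f s a (Y k) = Y k \<longleftrightarrow> a = Y k"
    using cancel[of a "Y k" s] idem[of "Y k"] assms(1,2) by metis
  then show ?thesis using assms(3) idem[OF assms(2), of s] by auto
qed

lemma loops_kink:
  assumes "k \<notin> crossing_set w" "t \<in> {[Over k s, Under k s], [Under k s, Over k s]}"
  shows "card (loops Q f (w @ t)) = card (loops Q f w)"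
proof (rule loops_extend[where K = "{k}" and c = "\<lambda>a Y k. a"])
  fix a Y assume "a \<in> Q" "\<And>i. i \<in> crossing_set (w @ t) \<Longrightarrow> Y i \<in> Q"
  then have k: "Y k \<in> Q" using assms(2) by auto
  have "passes f Y t b c \<longleftrightarrow> Y k = b \<and> b = c" if "b \<in> Q" for b c
    using passes_kink[where k = k and Y = Y, OF that k assms(2)] .
  then show "passes f Y (w @ t) a a \<longleftrightarrow> passes f Y w a a \<and> (\<forall>k\<in>{k}. Y k = a)"
    using passes_closed[OF \<open>a \<in> Q\<close>, of Y w] by (auto simp: passes_append)
qed (use assms in auto)

text \<open>The two inserted over-passages lie on one strand and get its colour, the one reached
  after \<open>u\<close>. The two under-passages then act with the same colour and opposite signs,
  and cancel in either order.\<close>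

lemma loops_poke:
  assumes "j \<notin> crossing_set (u @ v)" "k \<notin> crossing_set (u @ v)" "j \<noteq> k"
    "t \<in> {[Under j s, Under k (\<not> s)], [Under k (\<not> s), Under j s]}"
  shows "card (loops Q f (u @ [Over j s, Over k (\<not> s)] @ v @ t)) = card (loops Q f (u @ v))"
proof (rule loops_extend[where K = "{j, k}" and c = "\<lambda>a Y i. transport f Y u a"])
  fix a Y
  let ?w = "u @ [Over j s, Over k (\<not> s)] @ v @ t"
  assume a: "a \<in> Q" and Y: "\<And>i. i \<in> crossing_set ?w \<Longrightarrow> Y i \<in> Q"
  let ?b = "transport f Y u a"
  have Q: "Y j \<in> Q" "Y k \<in> Q" using Y by auto
  have t: "passes f Y t c a \<longleftrightarrow> c = a" if "c \<in> Q" "Y j = Y k" for c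
    using assms(4) cancel[OF that(1) Q(2)] cancel'[OF that(1) Q(2)] that by auto
  have "passes f Y ?w a a \<longleftrightarrow> passes f Y u a ?b \<and> Y j = ?b \<and> Y k = ?b \<and>
      (\<exists>c. passes f Y v ?b c \<and> passes f Y t c a)"
    using passes_append_transport[of f Y u "[Over j s, Over k (\<not> s)] @ v @ t"]
    by (auto simp: passes_append)
  also have "\<dots> \<longleftrightarrow> passes f Y u a ?b \<and> Y j = ?b \<and> Y k = ?b \<and> passes f Y v ?b a"
    using t passes_closed[OF transport_closed[OF a]] by metis
  also have "\<dots> \<longleftrightarrow> passes f Y (u @ v) a a \<and> (\<forall>i\<in>{j, k}. Y i = ?b)"
    using passes_append_transport[of f Y u v] by auto
  finally show "passes f Y ?w a a \<longleftrightarrow> passes f Y (u @ v) a a \<and> (\<forall>i\<in>{j, k}. Y i = ?b)" .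
next
  fix a and Y Z :: "nat \<Rightarrow> 'c" assume "\<And>k. k \<in> crossing_set (u @ v) \<Longrightarrow> Y k = Z k"
  then show "(\<lambda>i. transport f Y u a) = (\<lambda>i. transport f Z u a)"
    by (intro ext transport_cong) auto
qed (use assms in \<open>auto intro: transport_closed\<close>)

lemma passes_append_cong:
  assumes "x \<in> Q"
    and u: "\<And>x z. x \<in> Q \<Longrightarrow> passes f Z u' x z = passes f Y u x z"
    and v: "\<And>x z. x \<in> Q \<Longrightarrow> passes f Z v' x z = passes f Y v x z"
  shows "passes f Z (u' @ v') x z = passes f Y (u @ v) x z"
  unfolding passes_append u[OF \<open>x \<in> Q\<close>] using v passes_closed[OF \<open>x \<in> Q\<close>] by metis

text \<open>The third move changes only the colour of the middle strand over crossing \<open>c\<close>.\<close>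

lemma loops_triangle:
  assumes T: "T = strand dT (Over a sa) (Over b sb)"
    and M: "M = strand dM (Under a sa) (Over c sc)"
    and B: "B = strand dB (Under b sb) (Under c sc)"
    and s: "sa = (\<Delta> = (dT = dM))" "sb = (\<Delta> = (dT = dB))"
    and PQR: "{P, R, S} = {T, M, B}"
    and d: "distinct (P @ u @ R @ v @ S @ w)"
    and n: "distinct [a, b, c]"
    and fresh: "{a, b, c} \<inter> crossing_set (u @ v @ w) = {}"
  shows "card (loops Q f (P @ u @ R @ v @ S @ w)) =
    card (loops Q f (rev P @ u @ rev R @ v @ rev S @ w))"
proof -
  let ?w = "P @ u @ R @ v @ S @ w" and ?w' = "rev P @ u @ rev R @ v @ rev S @ w"
  have abc: "a \<noteq> b" "a \<noteq> c" "b \<noteq> c" using n by auto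
  \<comment> \<open>If \<open>dM\<close> holds, the middle strand reaches \<open>c\<close> behind
    the under-passage of \<open>a\<close>, and in front of it after the move; its colour over
    \<open>c\<close> is then obtained by undoing the step at \<open>a\<close>, with sign
    \<open>\<not> sa\<close>. Otherwise the step has to be performed.\<close>
  let ?F = "\<lambda>Y. Y(c := f (if dM then \<not> sa else sa) (Y c) (Y a))"
  let ?G = "\<lambda>Y. Y(c := f (if dM then sa else \<not> sa) (Y c) (Y a))"
  have PRS: "P \<in> {T, M, B}" "R \<in> {T, M, B}" "S \<in> {T, M, B}" "T \<in> {P, R, S}" "M \<in> {P, R, S}"
    using PQR by auto
  have C: "crossing_set ?w' = crossing_set ?w" by simp
  have abcC: "a \<in> crossing_set ?w" "b \<in> crossing_set ?w" "c \<in> crossing_set ?w"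
  proof -
    have *: "crossing_set X \<subseteq> crossing_set ?w" if "X \<in> {P, R, S}" for X
      using that by auto
    show "a \<in> crossing_set ?w" "b \<in> crossing_set ?w" "c \<in> crossing_set ?w"
      by (rule subsetD[OF *[OF PRS(4)]], simp add: T strand_def,
          rule subsetD[OF *[OF PRS(4)]], simp add: T strand_def,
          rule subsetD[OF *[OF PRS(5)]], simp add: M strand_def)
  qed
  have FG: "?F (?G Y) = Y" "?G (?F Y) = Y" if "Y a \<in> Q" "Y c \<in> Q" for Y
    using cancel[OF that(2,1)] cancel'[OF that(2,1)] abc by (auto simp: fun_eq_iff)
  \<comment> \<open>The two words are compared strand by strand: each piece leads from the same
    \<open>x\<close> to the same \<open>z\<close>, so nothing changes along \<open>u\<close>,
    \<open>v\<close> and \<open>w\<close>.\<close>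
  have TMB: "passes f (?F Y) (rev X) x z = passes f Y X x z"
    if X: "X \<in> {T, M, B}" and Y: "Y a \<in> Q" "Y b \<in> Q" "Y c \<in> Q" "Y a = Y b" and x: "x \<in> Q" for X Y x z
  proof -
    have "T \<noteq> B" "T \<noteq> M" "M \<noteq> B" using T M B by (auto simp: strand_def split: if_splits)
    consider "X = T" | "X = M" | "X = B" using X by auto
    then show ?thesis
    proof cases
      case 1
      then show ?thesis using T abc by (auto simp: strand_def)
    next
      case 2
      have "f (\<not> sa) (Y c) (Y a) = x \<longleftrightarrow> Y c = f sa x (Y a)"
        using cancel[OF x Y(1), of sa] cancel'[OF Y(3) Y(1), of sa] by metis
      moreover have "f sa (f (\<not> sa) (Y c) (Y a)) (Y a) = Y c"
        using cancel'[OF Y(3) Y(1)] .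
      moreover have "f sa (Y c) (Y a) = f sa x (Y a) \<longleftrightarrow> Y c = x"
        using cancel[OF x Y(1), of sa] cancel[OF Y(3) Y(1), of sa] by metis
      ultimately show ?thesis using 2 M abc by (cases dM) (auto simp: strand_def)
    next
      \<comment> \<open>The sign conditions give \<open>sb = sa\<close> exactly if
        \<open>dM = dB\<close>. Hence, as \<open>Y a = Y b\<close>, the step at \<open>b\<close>
        carries the colour over \<open>c\<close> on one side of the move to that on the other side,
        and the rest is self-distributivity.\<close>
      case 3
      show ?thesis
      proof (cases dB)
        case True
        have "f sb (f sc x (f (if dM then \<not> sa else sa) (Y c) (Y a))) (Y b) =
            f sc (f sb x (Y b)) (f sb (f (if dM then \<not> sa else sa) (Y c) (Y a)) (Y b))"
          by (rule distrib) (use x Y closed in auto)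
        also have "f sb (f (if dM then \<not> sa else sa) (Y c) (Y a)) (Y b) = Y c"
        proof (cases dM)
          case dM: True
          then have "sb = sa" using s True by simp
          then show ?thesis using dM Y cancel'[OF Y(3) Y(1), of sa] by simp
        next
          case dM: False
          then have "sb = (\<not> sa)" using s True by auto
          then show ?thesis using dM Y cancel[OF Y(3) Y(1), of sa] by simp
        qed
        finally show ?thesis using 3 B True abc by (auto simp: strand_def)
      next
        case False
        have "f sb (f sc x (Y c)) (Y b) = f sc (f sb x (Y b)) (f sb (Y c) (Y b))"
          by (rule distrib) (use x Y closed in auto)
        moreover have "f sb (Y c) (Y b) = f (if dM then \<not> sa else sa) (Y c) (Y a)"
          using s False Y by auto
        ultimately show ?thesis using 3 B False abc by (auto simp: strand_def)
      qed
    qed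
  qed
  have cF: "passes f (?F Y) z = passes f Y z" if "z \<in> {u, v, w}" for Y z
    using fresh that by (intro ext passes_cong) auto
  \<comment> \<open>The top strand meets \<open>a\<close> and \<open>b\<close> in succession without
    changing colour. If \<open>Y a\<close> and \<open>Y b\<close> differ, neither word can be
    traversed and \<open>main\<close> is an equation between falsehoods.\<close>
  have TY: "Y a = Y b" if "passes f Y ?w x z \<or> passes f Y ?w' x z" for Y x z
  proof -
    have "\<exists>y z. passes f Y T y z \<or> passes f Y (rev T) y z"
      using that PRS(4) by (auto simp: passes_append)
    then show ?thesis using T by (auto simp: strand_def split: if_splits)
  qed
  have main: "passes f (?F Y) ?w' x z = passes f Y ?w x z"
    if Y: "Y a \<in> Q" "Y b \<in> Q" "Y c \<in> Q" and x: "x \<in> Q" for Y x z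
  proof (cases "Y a = Y b")
    case True
    note t = TMB[OF _ Y True]
    show ?thesis
      by (intro passes_append_cong x) (use t PRS(1-3) cF in simp_all)
  next
    case False
    moreover have "(?F Y) a = Y a" "(?F Y) b = Y b" using abc by auto
    ultimately show ?thesis using TY[of Y] TY[of "?F Y"] by metis
  qed
  have "bij_betw (\<lambda>(x, Y). (x, ?F Y)) (loops Q f ?w) (loops Q f ?w')"
  proof (rule bij_betw_byWitness[where f' = "\<lambda>(x, Y). (x, ?G Y)"])
    show "\<forall>p\<in>loops Q f ?w. (case case p of (x, Y) \<Rightarrow> (x, ?F Y) of (x, Y) \<Rightarrow> (x, ?G Y)) = p"
      using FG abcC by (auto simp: loops_def PiE_iff)
    show "\<forall>p\<in>loops Q f ?w'. (case case p of (x, Y) \<Rightarrow> (x, ?G Y) of (x, Y) \<Rightarrow> (x, ?F Y)) = p"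
      using FG abcC unfolding C[symmetric] by (auto simp: loops_def PiE_iff)
    have ext: "Y(c := y) \<in> crossing_set ?w \<rightarrow>\<^sub>E Q" if "Y \<in> crossing_set ?w \<rightarrow>\<^sub>E Q" "y \<in> Q" for Y y
      using that abcC(3) unfolding PiE_iff extensional_def by auto
    show "(\<lambda>(x, Y). (x, ?F Y)) ` loops Q f ?w \<subseteq> loops Q f ?w'"
    proof clarify
      fix x Y assume l: "(x, Y) \<in> loops Q f ?w"
      then have Y: "Y \<in> crossing_set ?w \<rightarrow>\<^sub>E Q" and x: "x \<in> Q" by (auto simp: loops_def)
      have "Y a \<in> Q" "Y b \<in> Q" "Y c \<in> Q" using Y abcC by (auto simp: PiE_iff)
      from main[OF this x, of x] l ext[OF Y closed] show "(x, ?F Y) \<in> loops Q f ?w'"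
        unfolding loops_def C by simp
    qed
    show "(\<lambda>(x, Y). (x, ?G Y)) ` loops Q f ?w' \<subseteq> loops Q f ?w"
    proof clarify
      fix x Y assume l: "(x, Y) \<in> loops Q f ?w'"
      then have Y: "Y \<in> crossing_set ?w \<rightarrow>\<^sub>E Q" and x: "x \<in> Q" unfolding loops_def C by auto
      have Q: "Y a \<in> Q" "Y b \<in> Q" "Y c \<in> Q" using Y abcC by (auto simp: PiE_iff)
      have "(?G Y) a \<in> Q" "(?G Y) b \<in> Q" "(?G Y) c \<in> Q" using Q closed abc by auto
      note eq = main[OF this x, of x, unfolded FG(1)[OF Q(1,3)]]
      have "passes f Y ?w' x x" using l by (simp add: loops_def)
      then have "passes f (?G Y) ?w x x" by (simp only: eq)
      then show "(x, ?G Y) \<in> loops Q f ?w"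
        unfolding loops_def mem_Collect_eq prod.case by (intro conjI x ext[OF Y closed])
    qed
  qed
  then show ?thesis by (rule bij_betw_same_card)
qed

end

section \<open>Invariance of the number of loops under moves between valid words\<close>

lemma valid_word_same_crossing:
  assumes "valid_word w" "x \<in> set w" "y \<in> set w" "crossing x = crossing y" "is_over x = is_over y"
  shows "x = y"
  using valid_word_positive[OF assms(1,2)] valid_word_positive[OF assms(1,3)] assms(4,5)
  by (cases x; cases y) auto

text \<open>A crossing has just one over- and one under-passage; if \<open>t\<close> contains both,
  none is left for \<open>r\<close>.\<close>

lemma fresh_crossing:
  assumes v: "valid_word w" and d: "distinct (t @ r)" and s: "set w = set t \<union> set r"
    and k: "Over k s \<in> set t" "Under k s' \<in> set t"
  shows "k \<notin> crossing_set r"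
proof
  assume "k \<in> crossing_set r"
  then obtain x where x: "x \<in> set r" "crossing x = k" by (auto simp: crossing_set_def)
  then have "x = Over k s \<or> x = Under k s'"
    using valid_word_same_crossing[OF v, of x "Over k s"] valid_word_same_crossing[OF v, of x "Under k s'"]
      s k by (cases x) auto
  then show False using x k d by auto
qed

context quandle_pair
begin

text \<open>The rules of \<open>reidemeister\<close> do not themselves say that added crossings are
  new or that the crossings of a triangle are distinct. Both are recovered from validity, for the
  first two moves from validity of the longer word.\<close>

lemma loops_reidemeister:
  assumes "reidemeister w w'" "valid_word w" "valid_word w'"
  shows "card (loops Q f w') = card (loops Q f w)"
  using assms
proof (induction rule: reidemeister.induct)
  case (rotate u v)
  show ?case by (rule loops_rotate)
next
  case (relabel g w)
  then show ?case by (intro loops_relabel)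
next
  case (move1_over w k s)
  then have "k \<notin> crossing_set w"
    by (intro fresh_crossing[OF move1_over(2), where t = "[Over k s, Under k s]"])
       (auto dest: valid_word_distinct)
  then show ?case by (intro loops_kink) auto
next
  case (move1_under w k s)
  then have "k \<notin> crossing_set w"
    by (intro fresh_crossing[OF move1_under(2), where t = "[Under k s, Over k s]"])
       (auto dest: valid_word_distinct)
  then show ?case by (intro loops_kink) auto
next
  case (move2_parallel u v j s k)
  have d: "distinct ([Over j s, Over k (\<not> s), Under j s, Under k (\<not> s)] @ u @ v)"
    using valid_word_distinct[OF move2_parallel(2)] by auto
  have jk: "j \<notin> crossing_set (u @ v)" "k \<notin> crossing_set (u @ v)"
    using fresh_crossing[OF move2_parallel(2) d, of j s s] fresh_crossing[OF move2_parallel(2) d, of k "\<not> s" "\<not> s"]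
    by auto
  have "j \<noteq> k"
  proof
    assume "j = k"
    then show False
      using valid_word_same_crossing[OF move2_parallel(2), of "Over j s" "Over k (\<not> s)"] by simp
  qed
  with jk show ?case by (intro loops_poke) auto
next
  case (move2_antiparallel u v j s k)
  have d: "distinct ([Over j s, Over k (\<not> s), Under k (\<not> s), Under j s] @ u @ v)"
    using valid_word_distinct[OF move2_antiparallel(2)] by auto
  have jk: "j \<notin> crossing_set (u @ v)" "k \<notin> crossing_set (u @ v)"
    using fresh_crossing[OF move2_antiparallel(2) d, of j s s] fresh_crossing[OF move2_antiparallel(2) d, of k "\<not> s" "\<not> s"]
    by auto
  have "j \<noteq> k"
  proof
    assume "j = k"
    then show False
      using valid_word_same_crossing[OF move2_antiparallel(2), of "Over j s" "Over k (\<not> s)"] by simp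
  qed
  with jk show ?case by (intro loops_poke) auto
next
  case (move3 T dT a sa b sb M dM c sc B dB \<Delta> P R S u v w)
  let ?w = "P @ u @ R @ v @ S @ w"
  have d: "distinct ?w" using move3.prems(1) by (rule valid_word_distinct)
  have TMB: "set T = {Over a sa, Over b sb}" "set M = {Under a sa, Over c sc}"
    "set B = {Under b sb, Under c sc}"
    using move3.hyps(1-3) by (auto simp: strand_def)
  have sub: "set X \<subseteq> set ?w" "distinct X" if "X \<in> {T, M, B}" for X
    using that d unfolding move3.hyps(7)[symmetric] by auto
  have dis: "set X \<inter> set Y = {}" if "X \<in> {T, M, B}" "Y \<in> {T, M, B}" "X \<noteq> Y" for X Y
    using that d unfolding move3.hyps(7)[symmetric] by auto
  have "a \<noteq> b"
    using valid_word_same_crossing[OF move3.prems(1), of "Over a sa" "Over b sb"] sub[of T] TMB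
      move3.hyps(1) by (auto simp: strand_def split: if_splits)
  moreover have "b \<noteq> c"
    using valid_word_same_crossing[OF move3.prems(1), of "Under b sb" "Under c sc"] sub[of B] TMB
      move3.hyps(3) by (auto simp: strand_def split: if_splits)
  moreover have "a \<noteq> c"
  proof
    assume "a = c"
    then have "Under a sa = Under c sc"
      using valid_word_same_crossing[OF move3.prems(1), of "Under a sa" "Under c sc"]
        sub(1)[of M] sub(1)[of B] TMB by auto
    moreover have "M \<noteq> B" using TMB by auto
    ultimately show False using dis[of M B] TMB by auto
  qed
  moreover have "{a, b, c} \<inter> crossing_set (u @ v @ w) = {}"
  proof -
    have PRS: "set (P @ R @ S) = set T \<union> set M \<union> set B"
    proof -
      have "set (P @ R @ S) = \<Union> (set ` {P, R, S})" by auto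
      also have "\<dots> = \<Union> (set ` {T, M, B})" by (simp only: move3.hyps(7))
      finally show ?thesis by auto
    qed
    have d': "distinct ((P @ R @ S) @ u @ v @ w)" using d by auto
    have s': "set ?w = set (P @ R @ S) \<union> set (u @ v @ w)" by auto
    have "a \<notin> crossing_set (u @ v @ w)" "b \<notin> crossing_set (u @ v @ w)"
      "c \<notin> crossing_set (u @ v @ w)"
      by (rule fresh_crossing[OF move3.prems(1) d' s']; unfold PRS TMB; blast)+
    then show ?thesis by simp
  qed
  ultimately have "card (loops Q f ?w) =
      card (loops Q f (rev P @ u @ rev R @ v @ rev S @ w))"
    by (intro loops_triangle[OF move3.hyps(1-5,7) d]) auto
  then show ?case by (rule HOL.sym)
qed

end

section \<open>Linear Alexander quandles, and arc colourings as loops\<close>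

definition linear_op :: "int \<Rightarrow> int \<Rightarrow> bool \<Rightarrow> int \<Rightarrow> int \<Rightarrow> int" where
  "linear_op n m s = (if s then quandle_op n m else quandle_op' n m)"

lemma linear_op_eq:
  "linear_op n m s a b = (let c = if s then m else modular_inverse n m in (c * a + (1 - c) * b) mod n)"
  by (simp add: linear_op_def quandle_op_def quandle_op'_def Let_def)

lemma quandle_pair_linear:
  assumes "n \<ge> 1" "coprime m n"
  shows "quandle_pair {0..<n} (linear_op n m)"
proof
  fix s r a b c
  show "linear_op n m s a b \<in> {0..<n}"
    using assms(1) by (simp add: linear_op_eq Let_def)
  show "linear_op n m s a a = a" if "a \<in> {0..<n}"
    using that by (simp add: linear_op_eq Let_def algebra_simps)
  define e d where "e = (if s then m else modular_inverse n m)"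
    and "d = (if r then m else modular_inverse n m)"
  define e' where "e' = (if \<not> s then m else modular_inverse n m)"
  have "[e' * e = 1] (mod n)"
    using cong_modular_inverse1[OF assms(2)] cong_modular_inverse2[OF assms(2)]
    by (auto simp: e_def e'_def)
  \<comment> \<open>With the congruence as an equation, the composite of the two operations is
    \<open>a\<close> plus a visible multiple of \<open>n\<close>.\<close>
  then obtain q where q: "e' * e = 1 + n * q" by (metis cong_iff_lin cong_sym)
  show "linear_op n m (\<not> s) (linear_op n m s a b) b = a" if "a \<in> {0..<n}" "b \<in> {0..<n}"
  proof -
    have "linear_op n m (\<not> s) (linear_op n m s a b) b =
        (e' * ((e * a + (1 - e) * b) mod n) + (1 - e') * b) mod n"
      by (simp only: linear_op_eq Let_def e_def e'_def)
    also have "\<dots> = (e' * (e * a + (1 - e) * b) + (1 - e') * b) mod n"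
      by (metis mod_add_left_eq mod_mult_right_eq)
    also have "e' * (e * a + (1 - e) * b) + (1 - e') * b = (e' * e) * a + (1 - e' * e) * b"
      by (simp add: algebra_simps)
    also have "\<dots> = a + n * (q * (a - b))"
      unfolding q by (simp add: algebra_simps)
    finally show ?thesis using that by simp
  qed
  show "linear_op n m s (linear_op n m r a b) c =
      linear_op n m r (linear_op n m s a c) (linear_op n m s b c)"
  proof -
    have "linear_op n m s (linear_op n m r a b) c =
        (e * ((d * a + (1 - d) * b) mod n) + (1 - e) * c) mod n"
      by (simp only: linear_op_eq Let_def e_def d_def)
    also have "\<dots> = (e * (d * a + (1 - d) * b) + (1 - e) * c) mod n"
      by (metis mod_add_left_eq mod_mult_right_eq)
    also have "e * (d * a + (1 - d) * b) + (1 - e) * c =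
        d * (e * a + (1 - e) * c) + (1 - d) * (e * b + (1 - e) * c)"
      by (simp add: algebra_simps)
    also have "\<dots> mod n =
        (d * ((e * a + (1 - e) * c) mod n) + (1 - d) * ((e * b + (1 - e) * c) mod n)) mod n"
      unfolding cong_def[symmetric]
      by (intro cong_add cong_mult cong_refl) (simp_all add: cong_def)
    finally show ?thesis by (simp only: linear_op_eq Let_def e_def d_def)
  qed
qed

lemma transport_append: "transport f Y (u @ v) a = transport f Y v (transport f Y u a)"
  by (induction u arbitrary: a rule: word_induct) auto

lemma passes_iff_transport:
  "passes f Y w a b \<longleftrightarrow> transport f Y w a = b \<and>
    (\<forall>i<length w. is_over (w ! i) \<longrightarrow> Y (crossing (w ! i)) = transport f Y (take i w) a)"
  by (induction w arbitrary: a rule: word_induct) (auto simp: All_less_Suc2)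

lemma transport_take_Suc:
  assumes "i < length w"
  shows "transport f Y (take (Suc i) w) a = (case w ! i of Over k s \<Rightarrow> transport f Y (take i w) a
    | Under k s \<Rightarrow> f s (transport f Y (take i w) a) (Y k))"
  unfolding take_Suc_conv_app_nth[OF assms] transport_append by (cases "w ! i") auto

lemma colourings_iff:
  "X \<in> colourings n m w \<longleftrightarrow> X \<in> {..<crossings w} \<rightarrow>\<^sub>E {0..<n} \<and>
    (\<forall>k<crossings w. X k = linear_op n m (is_positive w k) (X (under_arc w k)) (X (over_arc w k)))"
  by (auto simp: colourings_def linear_op_def)

lemma colouring_transport:
  assumes v: "valid_word w" and X: "X \<in> colourings n m w"
    and Y: "\<And>k. k < crossings w \<Longrightarrow> Y k = X (over_arc w k)"
  shows "i < length w \<Longrightarrow>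
    transport (linear_op n m) Y (take i w) (X (arc_into w (w ! 0))) = X (arc_into w (w ! i))"
    (is "_ \<Longrightarrow> ?g i = _")
    and "transport (linear_op n m) Y w (X (arc_into w (w ! 0))) = X (arc_into w (w ! 0))"
proof -
  have d: "distinct w" using v by (rule valid_word_distinct)
  have step: "?g (Suc i) = X (arc_into w (w ! (Suc i mod length w)))"
    if i: "i < length w" and g: "?g i = X (arc_into w (w ! i))" for i
  proof -
    have x: "w ! i \<in> set w" using i by simp
    show ?thesis
    proof (cases "w ! i")
      case (Over k s)
      then show ?thesis using g arc_into_Suc[OF d i] by (simp add: transport_take_Suc[OF i])
    next
      case (Under k s)
      have k: "k < crossings w" "s = is_positive w k"
        using valid_word_crossing_less[OF v x] valid_word_positive[OF v x] Under by auto
      then have "under_arc w k = arc_into w (w ! i)" using Under by (simp add: under_arc_def)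
      then show ?thesis
        using g arc_into_Suc[OF d i] Under k X Y
        unfolding colourings_iff by (simp add: transport_take_Suc[OF i])
    qed
  qed
  show g: "?g i = X (arc_into w (w ! i))" if "i < length w" for i
    using that
  proof (induction i)
    case (Suc i)
    then show ?case using step[of i] by simp
  qed simp
  show "transport (linear_op n m) Y w (X (arc_into w (w ! 0))) = X (arc_into w (w ! 0))"
  proof -
    have "length w \<noteq> 0" using valid_word_length[OF v] valid_word_crossings[OF v] by simp
    then obtain l where "length w = Suc l" by (metis not0_implies_Suc)
    then show ?thesis using step[of l] g[of l] by simp
  qed
qed

text \<open>Passes from unknowns on arcs, as in the matrix, to the local description that the moves
  respect. The base point colour and the colours of the over-strands determine all arcs by
  transport.\<close>

lemma colouring_number_loops:
  assumes v: "valid_word w" and n: "n \<ge> 1"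
  shows "colouring_number n m w = card (loops {0..<n} (linear_op n m) w)"
proof -
  let ?N = "crossings w" and ?L = "length w" and ?f = "linear_op n m"
  have d: "distinct w" using v by (rule valid_word_distinct)
  have L: "?L > 0" using valid_word_length[OF v] valid_word_crossings[OF v] by simp
  have C: "crossing_set w = {..<?N}" by (rule crossing_set_valid[OF v])
  have cl: "?f s a b \<in> {0..<n}" for s a b
    using n by (simp add: linear_op_eq Let_def)
  have tcl: "transport ?f Y u a \<in> {0..<n}" if "a \<in> {0..<n}" for Y u a
    using that by (induction u arbitrary: a rule: word_induct) (auto intro: cl simp del: atLeastLessThan_iff)
  have "\<forall>k\<in>{..<?N}. \<exists>i<?L. w ! i = Under k (is_positive w k)"
    using valid_word_positions[OF v] by (metis lessThan_iff)
  then obtain pos where pos: "\<And>k. k < ?N \<Longrightarrow> pos k < ?L \<and> w ! pos k = Under k (is_positive w k)"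
    by (metis lessThan_iff)
  have posE: "pos k = i" if "i < ?L" "w ! i = Under k s" for i k s
  proof -
    have k: "k < ?N" "s = is_positive w k"
      using valid_word_crossing_less[OF v nth_mem] valid_word_positive[OF v nth_mem] that by fastforce+
    then show ?thesis using pos[OF k(1)] that nth_eq_iff_index_eq[OF d, of "pos k" i] by simp
  qed
  let ?F = "\<lambda>X. (X (arc_into w (w ! 0)), restrict (\<lambda>k. X (over_arc w k)) {..<?N})"
  \<comment> \<open>Arc \<open>k\<close> starts behind the under-passage of \<open>k\<close>, so the
    prefix has to include position \<open>pos k\<close>; hence the \<open>Suc\<close>.\<close>
  let ?G = "\<lambda>(a, Y). restrict (\<lambda>k. transport ?f Y (take (Suc (pos k)) w) a) {..<?N}"
  have F: "?F X \<in> loops {0..<n} ?f w" if X: "X \<in> colourings n m w" for X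
  proof -
    have r: "X j \<in> {0..<n}" if "j < ?N" for j
      using X that unfolding colourings_iff by (auto simp: PiE_iff simp del: atLeastLessThan_iff)
    let ?Y = "restrict (\<lambda>k. X (over_arc w k)) {..<?N}"
    have t: "i < ?L \<Longrightarrow> transport ?f ?Y (take i w) (X (arc_into w (w ! 0))) = X (arc_into w (w ! i))"
      "transport ?f ?Y w (X (arc_into w (w ! 0))) = X (arc_into w (w ! 0))" for i
      using colouring_transport[OF v X, of ?Y] by auto
    have "passes ?f ?Y w (X (arc_into w (w ! 0))) (X (arc_into w (w ! 0)))"
      unfolding passes_iff_transport
    proof (intro conjI allI impI t(2))
      fix i assume i: "i < ?L" "is_over (w ! i)"
      let ?k = "crossing (w ! i)"
      have k: "?k < ?N" "w ! i = Over ?k (is_positive w ?k)"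
        using valid_word_crossing_less[OF v] valid_word_positive[OF v] i by (auto intro: passage.expand)
      then have "over_arc w ?k = arc_into w (w ! i)" unfolding over_arc_def by simp
      then show "?Y ?k = transport ?f ?Y (take i w) (X (arc_into w (w ! 0)))"
        using t(1)[OF i(1)] k(1) by simp
    qed
    then show ?thesis
      using r arc_into_less[OF v] over_arc_less[OF v] L unfolding loops_def C by auto
  qed
  have G: "?G (a, Y) \<in> colourings n m w \<and> ?F (?G (a, Y)) = (a, Y)"
    if l: "(a, Y) \<in> loops {0..<n} ?f w" for a Y
  proof -
    let ?g = "\<lambda>i. transport ?f Y (take i w) a" and ?X = "?G (a, Y)"
    have a: "a \<in> {0..<n}" and Y: "Y \<in> {..<?N} \<rightarrow>\<^sub>E {0..<n}" and p: "passes ?f Y w a a"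
      using l unfolding loops_def C by auto
    \<comment> \<open>At the last position this is the closing condition: transport through all of
      \<open>w\<close> returns to \<open>a\<close>.\<close>
    have gL: "?g (Suc i mod ?L) = ?g (Suc i)" if "i < ?L" for i
      using p that unfolding passes_iff_transport by (cases "Suc i = ?L") auto
    have X: "?X (arc_into w (w ! i)) = ?g i" if "i < ?L" for i
    \<comment> \<open>Behind the under-passage of crossing 0 the strand runs on arc 0, to which
      \<open>?G\<close> assigns the transported colour by construction.\<close>
    proof (rule cyclic_induct[where ?i0.0 = "Suc (pos 0) mod ?L" and L = ?L, OF _ _ _ that])
      have N: "0 < ?N" using valid_word_crossings[OF v] by simp
      show "Suc (pos 0) mod ?L < ?L" using pos[OF N] by (simp add: Suc_mod_less)
      show "?X (arc_into w (w ! (Suc (pos 0) mod ?L))) = ?g (Suc (pos 0) mod ?L)"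
        using arc_into_Suc[OF d, of "pos 0"] pos[OF N] gL[of "pos 0"] N by simp
      show "?X (arc_into w (w ! (Suc i mod ?L))) = ?g (Suc i mod ?L)"
        if i: "i < ?L" "?X (arc_into w (w ! i)) = ?g i" for i
      proof (cases "w ! i")
        case (Over k s)
        then show ?thesis using i gL[OF i(1)] arc_into_Suc[OF d i(1)] by (simp add: transport_take_Suc[OF i(1)])
      next
        case (Under k s)
        moreover have "k < ?N" using valid_word_crossing_less[OF v nth_mem[OF i(1)]] by (simp add: Under)
        ultimately show ?thesis
          using i gL[OF i(1)] arc_into_Suc[OF d i(1)] posE[OF i(1) Under] by simp
      qed
    qed
    have over: "?X (over_arc w k) = Y k" if k: "k < ?N" for k
    proof -
      obtain i where i: "i < ?L" "w ! i = Over k (is_positive w k)"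
        using valid_word_positions[OF v k] by metis
      then have "?X (over_arc w k) = ?g i" using X[OF i(1)] by (simp add: over_arc_def)
      then show ?thesis using p i unfolding passes_iff_transport by auto
    qed
    have "?X \<in> {..<?N} \<rightarrow>\<^sub>E {0..<n}" using tcl[OF a] by auto
    moreover have "?X k = ?f (is_positive w k) (?X (under_arc w k)) (?X (over_arc w k))" if k: "k < ?N" for k
    proof -
      have "?X (under_arc w k) = ?g (pos k)" using X[of "pos k"] pos[OF k] by (simp add: under_arc_def)
      then show ?thesis using over[OF k] pos[OF k] transport_take_Suc[of "pos k" w ?f Y a] k by simp
    qed
    ultimately have "?X \<in> colourings n m w" unfolding colourings_iff by blast
    moreover have "?F ?X = (a, Y)"
      using X[OF L] over Y by (auto simp: PiE_iff extensional_def fun_eq_iff restrict_def)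
    ultimately show ?thesis by blast
  qed
  have FG: "?G (?F X) = X" if X: "X \<in> colourings n m w" for X
  proof
    fix k
    let ?Y = "restrict (\<lambda>k. X (over_arc w k)) {..<?N}"
    show "?G (?F X) k = X k"
    proof (cases "k < ?N")
      case True
      let ?a = "X (arc_into w (w ! 0))"
      have t: "transport ?f ?Y (take (pos k) w) ?a = X (arc_into w (w ! pos k))"
        using colouring_transport(1)[OF v X, of ?Y] pos[OF True] by auto
      have "transport ?f ?Y (take (Suc (pos k)) w) ?a = ?f (is_positive w k) (X (under_arc w k)) (X (over_arc w k))"
        using transport_take_Suc[of "pos k" w ?f ?Y ?a] pos[OF True] t True by (simp add: under_arc_def)
      then show ?thesis using X True unfolding colourings_iff by simp
    next
      case False
      then show ?thesis using X unfolding colourings_iff by (auto simp: PiE_iff extensional_def)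
    qed
  qed
  have "bij_betw ?F (colourings n m w) (loops {0..<n} ?f w)"
    by (rule bij_betw_byWitness[where f' = ?G]) (use F G FG in auto)
  then show ?thesis unfolding colouring_number_def by (rule bij_betw_same_card)
qed

theorem colouring_number_reidemeister:
  assumes "reidemeister w w'" "valid_word w" "valid_word w'" "n \<ge> 1" "coprime m n"
  shows "colouring_number n m w' = colouring_number n m w"
  using quandle_pair.loops_reidemeister[OF quandle_pair_linear[OF assms(4,5)] assms(1-3)]
    colouring_number_loops assms by simp

section \<open>Alexander numbering of planar words\<close>

text \<open>The sign with which the other strand crosses the current one: 1 if it comes from the
  right. The Alexander index of the region on the left, larger by 1 than that on the right, drops by
  this amount at the passage.\<close>

definition weight :: "passage \<Rightarrow> int" where
  "weight x = (if is_over x = positive x then 1 else - 1)"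

definition height :: "gauss_word \<Rightarrow> nat \<Rightarrow> int" where
  "height w i = sum_list (map weight (take i w))"

text \<open>The consequence of planarity that is used for matrices. The corners to the left before
  the over-passage and to the left behind the under-passage of a crossing have equal Alexander
  index; for a positive crossing they are even the same corner.\<close>

definition balanced :: "gauss_word \<Rightarrow> bool" where
  "balanced w \<longleftrightarrow> (\<forall>i<length w. \<forall>j<length w. is_over (w ! i) \<longrightarrow> is_under (w ! j) \<longrightarrow>
     crossing (w ! i) = crossing (w ! j) \<longrightarrow> height w i = height w (Suc j))"

lemma height_0: "height w 0 = 0"
  by (simp add: height_def)

lemma height_Suc: "i < length w \<Longrightarrow> height w (Suc i) = height w i + weight (w ! i)"
  by (simp add: height_def take_Suc_conv_app_nth)

lemma weight_simps [simp]:
  "weight (Over k s) = (if s then 1 else - 1)" "weight (Under k s) = (if s then - 1 else 1)"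
  by (auto simp: weight_def)

lemma height_length:
  assumes "valid_word w"
  shows "height w (length w) = 0"
proof -
  have "height w (length w) = (\<Sum>i<length w. weight (w ! i))"
    unfolding height_def by (simp add: sum_list_sum_nth lessThan_atLeast0)
  also have "\<dots> = 0"
    unfolding sum_over_word[OF assms] by (rule sum.neutral) auto
  finally show ?thesis .
qed

section \<open>Faces and the four corners of a crossing\<close>

definition face :: "gauss_word \<Rightarrow> passage \<times> bool \<Rightarrow> (passage \<times> bool) set" where
  "face w d = orbit (clockwise \<circ> across_edge w) d"

text \<open>An edge end stands for the face to the left of the walk that leaves the crossing along
  it. The end \<open>(x, False)\<close> leaves against the direction of the strand and so names the
  face on the right of the incoming edge; the remaining two corners are reached through the
  clockwise neighbour.\<close>

definition left_in :: "gauss_word \<Rightarrow> passage \<Rightarrow> (passage \<times> bool) set" where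
  "left_in w x = face w (clockwise (x, False))"

definition right_in :: "gauss_word \<Rightarrow> passage \<Rightarrow> (passage \<times> bool) set" where
  "right_in w x = face w (x, False)"

definition left_out :: "gauss_word \<Rightarrow> passage \<Rightarrow> (passage \<times> bool) set" where
  "left_out w x = face w (x, True)"

definition right_out :: "gauss_word \<Rightarrow> passage \<Rightarrow> (passage \<times> bool) set" where
  "right_out w x = face w (clockwise (x, True))"

lemmas side_defs = left_in_def right_in_def left_out_def right_out_def

lemma clockwise_inj: "clockwise d = clockwise d' \<Longrightarrow> d = d'"
proof -
  obtain x e x' e' where "d = (x, e)" "d' = (x', e')" by (metis surj_pair)
  then show "clockwise d = clockwise d' \<Longrightarrow> d = d'" by (cases x; cases x') auto
qed

lemma ex_pred_mod:
  assumes "(j::nat) < L"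
  obtains i where "i < L" "j = Suc i mod L"
proof (cases j)
  case 0
  then show ?thesis using that[of "L - 1"] assms by simp
next
  case (Suc i)
  then show ?thesis using that[of i] assms by simp
qed

context
  fixes w :: gauss_word
  assumes v: "valid_word w"
begin

lemma len2: "length w \<ge> 2"
  using valid_word_length[OF v] valid_word_crossings[OF v] by simp

lemma across_edge_across_edge:
  assumes "fst d \<in> set w"
  shows "across_edge w (across_edge w d) = d" "fst (across_edge w d) \<in> set w"
proof -
  obtain x e where d: "d = (x, e)" by (metis surj_pair)
  obtain j where j: "j < length w" "x = w ! j" using assms d by (auto simp: in_set_conv_nth)
  obtain i where i: "i < length w" "j = Suc i mod length w" using ex_pred_mod[OF j(1)] .
  note a = across_edge_nth[OF valid_word_distinct[OF v] _ len2]
  show "across_edge w (across_edge w d) = d" "fst (across_edge w d) \<in> set w"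
    using a[OF j(1)] a[OF i(1)] i j d Suc_mod_less[OF j(1)] by (cases e; simp)+
qed

lemma clockwise_closed: "fst d \<in> set w \<Longrightarrow> fst (clockwise d) \<in> set w"
proof -
  assume d: "fst d \<in> set w"
  obtain x e where x: "d = (x, e)" by (metis surj_pair)
  have "crossing x < crossings w" "positive x = is_positive w (crossing x)"
    using valid_word_crossing_less[OF v] valid_word_positive[OF v] d x by auto
  then show ?thesis using valid_word_mem[OF v] x by (cases x) auto
qed

text \<open>An \<open>orbit\<close> starts with the first image, so its invariance under a step
  requires the walk to be invertible. It is so on the finite set of edge ends of \<open>w\<close>,
  and \<open>perm_restrict\<close> extends it by the identity to a permutation of the whole
  type.\<close>

lemma face_step:
  assumes "fst d \<in> set w"
  shows "face w (clockwise (across_edge w d)) = face w d"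
proof -
  let ?f = "clockwise \<circ> across_edge w" and ?D = "set w \<times> (UNIV :: bool set)"
  let ?g = "perm_restrict ?f ?D"
  have D: "d \<in> ?D \<longleftrightarrow> fst d \<in> set w" for d by (cases d) auto
  have fD: "?f d \<in> ?D" if "d \<in> ?D" for d
    using that across_edge_across_edge(2) clockwise_closed unfolding D by simp
  have "inj_on ?f ?D"
  proof (rule inj_onI)
    fix x y assume "x \<in> ?D" "y \<in> ?D" "?f x = ?f y"
    then have "across_edge w x = across_edge w y" using clockwise_inj by simp
    then show "x = y" using across_edge_across_edge(1) \<open>x \<in> ?D\<close> \<open>y \<in> ?D\<close> unfolding D by metis
  qed
  then have "bij_betw ?f ?D ?D"
    using endo_inj_surj[of ?D ?f] fD by (auto simp: bij_betw_def)
  then have "bij_betw ?g ?D ?D"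
    by (subst bij_betw_cong[where g = ?f]) (auto simp: perm_restrict_def)
  then have "?g permutes ?D"
    by (rule bij_imp_permutes) (auto simp: perm_restrict_def)
  then have "permutation ?g"
    unfolding permutation_permutes by (intro exI[of _ ?D] conjI) auto
  then have "orbit ?g (?g d) = orbit ?g d"
    by (rule permutation_orbit_step)
  moreover have "orbit ?f d' = orbit ?g d'" if "d' \<in> ?D" for d'
    by (rule orbit_cong0[OF that]) (use fD in \<open>auto simp: perm_restrict_def\<close>)
  moreover have "?g d = ?f d" using assms by (simp add: perm_restrict_def D)
  ultimately show ?thesis unfolding face_def using assms fD[of d] D by simp
qed

lemma side_next:
  assumes "i < length w"
  shows "left_out w (w ! i) = left_in w (w ! (Suc i mod length w))"
    and "right_out w (w ! i) = right_in w (w ! (Suc i mod length w))"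
proof -
  note a = across_edge_nth[OF valid_word_distinct[OF v] assms len2]
  have "w ! i \<in> set w" "w ! (Suc i mod length w) \<in> set w"
    using assms by (auto intro: nth_mem Suc_mod_less)
  then show "left_out w (w ! i) = left_in w (w ! (Suc i mod length w))"
    and "right_out w (w ! i) = right_in w (w ! (Suc i mod length w))"
    using face_step[of "(w ! i, True)"] face_step[of "(w ! (Suc i mod length w), False)"] a
    unfolding side_defs by simp_all
qed

text \<open>Each of the four corners of a crossing is seen from both strands; these are the
  coincidences for the two signs.\<close>

lemma side_crossing:
  "left_in w (Over k True) = left_out w (Under k True)"
  "left_in w (Under k True) = right_in w (Over k True)"
  "right_out w (Over k True) = right_in w (Under k True)"
  "right_out w (Under k True) = left_out w (Over k True)"
  "left_in w (Over k False) = right_in w (Under k False)"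
  "left_in w (Under k False) = left_out w (Over k False)"
  "right_out w (Over k False) = left_out w (Under k False)"
  "right_out w (Under k False) = right_in w (Over k False)"
  by (simp_all add: side_defs)

lemma faces_eq: "faces w = left_out w ` set w \<union> right_in w ` set w"
proof -
  have "faces w = face w ` (set w \<times> UNIV)" unfolding faces_def face_def ..
  also have "set w \<times> (UNIV :: bool set) = (\<lambda>x. (x, True)) ` set w \<union> (\<lambda>x. (x, False)) ` set w"
    by (auto simp: UNIV_bool)
  finally show ?thesis by (simp add: side_defs image_Un image_image)
qed

text \<open>
  An integer function \<open>h\<close> on the faces induces the 1-cochain whose value on an edge is the
  difference of \<open>h\<close> to its left and to its right.
\<close>

context
  fixes h :: "(passage \<times> bool) set \<Rightarrow> int" and n a :: int
begin

text \<open>At a crossing the change of the cochain along either strand is, up to sign, the same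
  alternating sum of \<open>h\<close> over the four corners. Constancy at the over-passages
  therefore implies constancy at the under-passages, and the value spreads round the knot.\<close>

lemma cochain_constant:
  assumes start: "[h (left_in w (w ! 0)) - h (right_in w (w ! 0)) = a] (mod n)"
    and over: "\<And>k s. Over k s \<in> set w \<Longrightarrow>
      [h (left_out w (Over k s)) - h (right_out w (Over k s)) =
       h (left_in w (Over k s)) - h (right_in w (Over k s))] (mod n)"
    and x: "x \<in> set w"
  shows "[h (left_in w x) - h (right_in w x) = a] (mod n)"
    and "[h (left_out w x) - h (right_out w x) = a] (mod n)"
proof -
  have step: "[h (left_out w x) - h (right_out w x) = h (left_in w x) - h (right_in w x)] (mod n)"
    if "x \<in> set w" for x
  proof (cases x)
    case (Over k s)
    then show ?thesis using over that by simp
  next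
    case (Under k s)
    have "fst (clockwise (x, True)) \<in> set w" by (rule clockwise_closed) (simp add: that)
    then have "Over k s \<in> set w" using Under by simp
    note o = over[OF this]
    have "h (left_out w x) - h (right_out w x) - (h (left_in w x) - h (right_in w x)) =
        h (left_in w (Over k s)) - h (right_in w (Over k s)) -
        (h (left_out w (Over k s)) - h (right_out w (Over k s)))"
      unfolding Under by (cases s) (simp_all add: side_crossing)
    moreover have "n dvd h (left_in w (Over k s)) - h (right_in w (Over k s)) -
        (h (left_out w (Over k s)) - h (right_out w (Over k s)))"
      using cong_sym[OF o] by (simp only: cong_iff_dvd_diff)
    ultimately show ?thesis by (simp only: cong_iff_dvd_diff)
  qed
  have "[h (left_in w (w ! i)) - h (right_in w (w ! i)) = a] (mod n)" if "i < length w" for i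
  proof (rule cyclic_induct[where ?i0.0 = 0 and i = i])
    show "i < length w" by (rule that)
    show "0 < length w" using len2 by linarith
    show "[h (left_in w (w ! 0)) - h (right_in w (w ! 0)) = a] (mod n)" by (rule start)
    fix i assume i: "i < length w" "[h (left_in w (w ! i)) - h (right_in w (w ! i)) = a] (mod n)"
    show "[h (left_in w (w ! (Suc i mod length w))) - h (right_in w (w ! (Suc i mod length w))) = a] (mod n)"
      using cong_trans[OF step i(2)] i(1) by (simp add: side_next[symmetric])
  qed
  then show "[h (left_in w x) - h (right_in w x) = a] (mod n)"
    using x by (metis in_set_conv_nth)
  then show "[h (left_out w x) - h (right_out w x) = a] (mod n)"
    using cong_trans[OF step[OF x]] by blast
qed

text \<open>Between the two left corners lies only the other strand, across which \<open>h\<close>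
  jumps by \<open>a\<close>; \<open>weight\<close> records the direction in which that strand
  runs.\<close>

lemma cochain_height:
  assumes c: "\<And>x. x \<in> set w \<Longrightarrow> [h (left_in w x) - h (right_in w x) = a] (mod n)"
      "\<And>x. x \<in> set w \<Longrightarrow> [h (left_out w x) - h (right_out w x) = a] (mod n)"
    and x: "x \<in> set w"
  shows "[h (left_out w x) = h (left_in w x) - a * weight x] (mod n)"
proof -
  have y: "fst (clockwise (x, True)) \<in> set w" by (rule clockwise_closed) (simp add: x)
  have flip: "[q = p - a] (mod n)" and shift: "[p = q + a] (mod n)" if "[p - q = a] (mod n)" for p q
  proof -
    have "n dvd p - q - a" using that by (simp only: cong_iff_dvd_diff)
    then have "n dvd - (p - q - a)" "n dvd p - q - a" by (simp_all only: dvd_minus_iff)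
    moreover have "- (p - q - a) = q - (p - a)" "p - q - a = p - (q + a)" by simp_all
    ultimately show "[q = p - a] (mod n)" "[p = q + a] (mod n)" by (simp_all only: cong_iff_dvd_diff)
  qed
  show ?thesis
  proof (cases x)
    case (Over k s)
    then have u: "Under k s \<in> set w" using y by simp
    show ?thesis
      using flip[OF c(2)[OF u]] shift[OF c(1)[OF u]] Over by (cases s) (simp_all add: side_crossing)
  next
    case (Under k s)
    then have o: "Over k s \<in> set w" using y by simp
    show ?thesis
      using flip[OF c(2)[OF o]] shift[OF c(1)[OF o]] Under by (cases s) (simp_all add: side_crossing)
  qed
qed

text \<open>So \<open>height\<close> measures how far the index on the left has dropped since the
  base point, in units of \<open>a\<close>.\<close>

lemma cochain_height_position:
  assumes c: "\<And>x. x \<in> set w \<Longrightarrow> [h (left_in w x) - h (right_in w x) = a] (mod n)"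
      "\<And>x. x \<in> set w \<Longrightarrow> [h (left_out w x) - h (right_out w x) = a] (mod n)"
  shows "i < length w \<Longrightarrow> [h (left_in w (w ! i)) + a * height w i = h (left_in w (w ! 0))] (mod n)"
    and "i < length w \<Longrightarrow> [h (left_out w (w ! i)) + a * height w (Suc i) = h (left_in w (w ! 0))] (mod n)"
proof -
  have step: "[h (left_out w (w ! i)) + a * height w (Suc i) = h (left_in w (w ! i)) + a * height w i] (mod n)"
    if "i < length w" for i
  proof -
    have "[h (left_out w (w ! i)) + a * height w (Suc i) =
        h (left_in w (w ! i)) - a * weight (w ! i) + a * height w (Suc i)] (mod n)"
      by (intro cong_add cong_refl cochain_height c) (use that in auto)
    then show ?thesis using that by (simp add: height_Suc algebra_simps)
  qed
  show g: "i < length w \<Longrightarrow> [h (left_in w (w ! i)) + a * height w i = h (left_in w (w ! 0))] (mod n)" for i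
  proof (induction i)
    case 0
    then show ?case by (simp add: height_0)
  next
    case (Suc i)
    then have "left_in w (w ! Suc i) = left_out w (w ! i)"
      using side_next(1)[of i] by simp
    then show ?case using cong_trans[OF step[of i] Suc.IH] Suc.prems by simp
  qed
  show "i < length w \<Longrightarrow> [h (left_out w (w ! i)) + a * height w (Suc i) = h (left_in w (w ! 0))] (mod n)"
    using cong_trans[OF step g] by blast
qed

end

end

text \<open>
  The 1-cochains \<open>c\<close> on the edges whose values add up at each crossing (incoming = outgoing) are determined by
  \<open>N + 1\<close> free parameters, as are functions on \<open>N + 2\<close> faces up to a constant. Since taking
  differences is injective, modulo \<open>n\<close> a count shows that the constant cochain 1 comes from a function
  on the faces.
\<close>

lemma ex_face_numbering:
  fixes n :: int
  assumes k: "knot_diagram w" and n: "n \<ge> 2"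
  obtains h where "\<And>x. x \<in> set w \<Longrightarrow> [h (left_in w x) - h (right_in w x) = 1] (mod n)"
    "\<And>x. x \<in> set w \<Longrightarrow> [h (left_out w x) - h (right_out w x) = 1] (mod n)"
proof -
  have v: "valid_word w" and cF: "card (faces w) = crossings w + 2"
    using k by (auto simp: knot_diagram_def)
  let ?N = "crossings w"
  have L: "length w > 0" using len2[OF v] by linarith
  define F0 where "F0 = left_in w (w ! 0)"
  define P where "P k = Over k (is_positive w k)" for k
  have P: "P k \<in> set w" if "k < ?N" for k using valid_word_mem[OF v that] by (simp add: P_def)
  have PE: "k < ?N \<and> P k = Over k s" if "Over k s \<in> set w" for k s
    using valid_word_crossing_less[OF v that] valid_word_positive[OF v that] by (simp add: P_def)
  have left_in_faces: "left_in w x \<in> faces w" if x: "x \<in> set w" for x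
  proof -
    obtain j where j: "j < length w" "x = w ! j" using x by (auto simp: in_set_conv_nth)
    obtain i where i: "i < length w" "j = Suc i mod length w" using ex_pred_mod[OF j(1)] .
    have "left_in w x = left_out w (w ! i)" using side_next(1)[OF v i(1)] i j by simp
    then show ?thesis unfolding faces_eq[OF v] using i(1) by simp
  qed
  have F0: "F0 \<in> faces w" unfolding F0_def by (rule left_in_faces) (use L in simp)
  have fin: "finite (faces w)" unfolding faces_eq[OF v] by simp
  define cin where "cin h x = h (left_in w x) - h (right_in w x)" for h :: "(passage \<times> bool) set \<Rightarrow> int" and x
  define cout where "cout h x = h (left_out w x) - h (right_out w x)" for h :: "(passage \<times> bool) set \<Rightarrow> int" and x
  \<comment> \<open>Prescribing 0 on \<open>F0\<close> removes the additive constant.\<close>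
  define ext where "ext f F = (if F = F0 then 0 else f F)" for f :: "(passage \<times> bool) set \<Rightarrow> int" and F
  \<comment> \<open>The \<open>N + 1\<close> parameters of a cochain: its value at the base point
    and its defects at the \<open>N\<close> over-passages.\<close>
  define T where "T f = (\<lambda>j\<in>{..?N}. (if j = 0 then cin (ext f) (w ! 0)
    else cout (ext f) (P (j - 1)) - cin (ext f) (P (j - 1))) mod n)" for f
  let ?A = "(faces w - {F0}) \<rightarrow>\<^sub>E {0..<n}" and ?B = "{..?N} \<rightarrow>\<^sub>E {0..<n}"
  \<comment> \<open>Here the \<open>N + 2\<close> faces enter: without \<open>F0\<close> they are as
    many as the parameters.\<close>
  have cA: "card ?A = nat n ^ (?N + 1)"
    using F0 fin cF by (simp add: card_PiE)
  have cB: "card ?B = nat n ^ (?N + 1)" by (simp add: card_PiE)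
  have TB: "T f \<in> ?B" for f using n by (auto simp: T_def)
  have T0: "T f 0 = cin (ext f) (w ! 0) mod n" for f by (simp add: T_def)
  have TS: "T f (Suc k) = (cout (ext f) (P k) - cin (ext f) (P k)) mod n" if "k < ?N" for f k
    using that by (simp add: T_def)
  \<comment> \<open>If all parameters vanish, so does the cochain; then \<open>h\<close> takes equal
    values on both sides of every edge and, along the knot, the value at \<open>F0\<close>
    everywhere.\<close>
  have inj: "inj_on T ?A"
  proof (rule inj_onI)
    fix f g assume f: "f \<in> ?A" and g: "g \<in> ?A" and e: "T f = T g"
    define h where "h F = ext f F - ext g F" for F
    have ch: "cin h x = cin (ext f) x - cin (ext g) x" "cout h x = cout (ext f) x - cout (ext g) x" for x
      by (simp_all add: cin_def cout_def h_def)
    have start: "[h (left_in w (w ! 0)) - h (right_in w (w ! 0)) = 0] (mod n)"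
    proof -
      have "[cin (ext f) (w ! 0) = cin (ext g) (w ! 0)] (mod n)"
        using T0[of f] T0[of g] e by (simp add: cong_def)
      then have "[cin h (w ! 0) = 0] (mod n)" unfolding ch by (simp add: cong_iff_dvd_diff)
      then show ?thesis by (simp only: cin_def)
    qed
    have over: "[h (left_out w (Over k s)) - h (right_out w (Over k s)) =
       h (left_in w (Over k s)) - h (right_in w (Over k s))] (mod n)" if "Over k s \<in> set w" for k s
    proof -
      have p: "k < ?N" "P k = Over k s" using PE[OF that] by auto
      have "[cout (ext f) (P k) - cin (ext f) (P k) = cout (ext g) (P k) - cin (ext g) (P k)] (mod n)"
        using TS[OF p(1), of f] TS[OF p(1), of g] e by (simp add: cong_def)
      then have "n dvd cout (ext f) (P k) - cin (ext f) (P k) - (cout (ext g) (P k) - cin (ext g) (P k))"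
        by (simp only: cong_iff_dvd_diff)
      also have "cout (ext f) (P k) - cin (ext f) (P k) - (cout (ext g) (P k) - cin (ext g) (P k)) =
          cout h (P k) - cin h (P k)" unfolding ch by simp
      finally show ?thesis by (simp only: cong_iff_dvd_diff p(2) cin_def cout_def)
    qed
    have c: "[h (left_in w x) - h (right_in w x) = 0] (mod n)"
      "[h (left_out w x) - h (right_out w x) = 0] (mod n)" if x: "x \<in> set w" for x
      using cochain_constant[OF v start _ x] over by simp_all
    have hL: "[h (left_in w x) = 0] (mod n)" if x: "x \<in> set w" for x
    proof -
      obtain i where "i < length w" "x = w ! i" using x by (auto simp: in_set_conv_nth)
      then have "[h (left_in w x) + 0 * height w i = h (left_in w (w ! 0))] (mod n)"
        by (simp only:) (rule cochain_height_position(1)[OF v c]; assumption)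
      moreover have "h (left_in w (w ! 0)) = 0" by (simp add: h_def ext_def F0_def)
      ultimately show ?thesis by simp
    qed
    have hlo: "[h (left_out w x) = 0] (mod n)" if x: "x \<in> set w" for x
    proof -
      obtain i where "i < length w" "x = w ! i" using x by (auto simp: in_set_conv_nth)
      then show ?thesis using side_next(1)[OF v] hL[OF nth_mem[OF Suc_mod_less]] by simp
    qed
    have hR: "[h (right_in w x) = 0] (mod n)" if x: "x \<in> set w" for x
    proof -
      have "[h (left_in w x) - (h (left_in w x) - h (right_in w x)) = 0 - 0] (mod n)"
        by (intro cong_diff hL c(1) x)
      then show ?thesis by simp
    qed
    have h0: "[h F = 0] (mod n)" if "F \<in> faces w" for F
      using that hlo hR unfolding faces_eq[OF v] by blast
    show "f = g"
    proof
      fix F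
      show "f F = g F"
      proof (cases "F \<in> faces w - {F0}")
        case True
        then have "[f F - g F = 0] (mod n)" using h0[of F] by (simp add: h_def ext_def)
        then have "[f F = g F] (mod n)" by (simp add: cong_iff_dvd_diff)
        moreover have "f F \<in> {0..<n}" "g F \<in> {0..<n}" using f g True by (auto simp: PiE_iff simp del: atLeastLessThan_iff)
        ultimately show ?thesis by (simp add: cong_def)
      next
        case False
        then show ?thesis using f g by (auto simp: PiE_iff extensional_def)
      qed
    qed
  qed
  have "finite ?B" by (intro finite_PiE) auto
  moreover have "card (T ` ?A) = card ?B" using card_image[OF inj] cA cB by simp
  moreover have "T ` ?A \<subseteq> ?B" using TB by blast
  ultimately have "T ` ?A = ?B" by (intro card_subset_eq)
  \<comment> \<open>The parameters of the constant cochain 1: value 1 at the base point, no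
    defects.\<close>
  moreover have "(\<lambda>j\<in>{..?N}. if j = 0 then 1 else 0) \<in> ?B" using n by auto
  ultimately have "(\<lambda>j\<in>{..?N}. if j = 0 then 1 else 0) \<in> T ` ?A" by simp
  then obtain f where f: "(\<lambda>j\<in>{..?N}. if j = 0 then 1 else 0) = T f" by (rule imageE)
  have start: "[ext f (left_in w (w ! 0)) - ext f (right_in w (w ! 0)) = 1] (mod n)"
    using T0[of f] n by (simp add: f[symmetric] cong_def cin_def)
  have over: "[ext f (left_out w (Over k s)) - ext f (right_out w (Over k s)) =
       ext f (left_in w (Over k s)) - ext f (right_in w (Over k s))] (mod n)" if "Over k s \<in> set w" for k s
  proof -
    have p: "k < ?N" "P k = Over k s" using PE[OF that] by auto
    have "n dvd cout (ext f) (P k) - cin (ext f) (P k)"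
      using TS[OF p(1), of f] p(1) by (simp add: f[symmetric] dvd_eq_mod_eq_0)
    then show ?thesis by (simp only: cong_iff_dvd_diff p(2) cin_def cout_def)
  qed
  show ?thesis
  proof (rule that[of "ext f"])
    fix x assume x: "x \<in> set w"
    show "[ext f (left_in w x) - ext f (right_in w x) = 1] (mod n)"
      by (rule cochain_constant(1)[OF v start _ x]) (rule over)
    show "[ext f (left_out w x) - ext f (right_out w x) = 1] (mod n)"
      by (rule cochain_constant(2)[OF v start _ x]) (rule over)
  qed
qed

text \<open>Face numberings are available only modulo \<open>n\<close>, but heights are integers
  independent of \<open>n\<close>, so it is enough to use one large modulus.\<close>

theorem knot_diagram_balanced:
  assumes k: "knot_diagram w"
  shows "balanced w"
  unfolding balanced_def
proof (intro allI impI)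
  fix i j assume i: "i < length w" "is_over (w ! i)" and j: "j < length w" "is_under (w ! j)"
    and e: "crossing (w ! i) = crossing (w ! j)"
  have v: "valid_word w" using k by (simp add: knot_diagram_def)
  have cong: "[height w i = height w (Suc j)] (mod n)" if "n \<ge> 2" for n
  proof -
    obtain h where h: "\<And>x. x \<in> set w \<Longrightarrow> [h (left_in w x) - h (right_in w x) = 1] (mod n)"
      "\<And>x. x \<in> set w \<Longrightarrow> [h (left_out w x) - h (right_out w x) = 1] (mod n)"
      using ex_face_numbering[OF k \<open>n \<ge> 2\<close>] by metis
    have p1: "[h (left_in w (w ! i)) + 1 * height w i = h (left_in w (w ! 0))] (mod n)"
      by (rule cochain_height_position(1)[OF v]) (use h i(1) in simp_all)
    have p2: "[h (left_out w (w ! j)) + 1 * height w (Suc j) = h (left_in w (w ! 0))] (mod n)"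
      by (rule cochain_height_position(2)[OF v]) (use h j(1) in simp_all)
    obtain k s where x: "w ! i = Over k s" "w ! j = Under k s"
      using i(2) j(2) e valid_word_positive[OF v nth_mem[OF i(1)]] valid_word_positive[OF v nth_mem[OF j(1)]]
      by (cases "w ! i"; cases "w ! j") auto
    \<comment> \<open>At a negative crossing the two corners are opposite; each is one less than the
      corner to the left of the outgoing over-strand.\<close>
    have "[h (left_in w (w ! i)) = h (left_out w (w ! j))] (mod n)"
    proof (cases s)
      case True
      then show ?thesis by (simp add: x side_crossing[OF v])
    next
      case False
      have m: "Under k s \<in> set w" "Over k s \<in> set w" using nth_mem[OF i(1)] nth_mem[OF j(1)] x by simp_all
      have "[h (left_out w (Under k s)) = h (left_in w (Under k s)) - 1 * weight (Under k s)] (mod n)"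
        by (rule cochain_height[OF v h m(1)])
      moreover have "[h (left_out w (Over k s)) = h (left_in w (Over k s)) - 1 * weight (Over k s)] (mod n)"
        by (rule cochain_height[OF v h m(2)])
      ultimately have "[h (left_out w (Under k s)) = h (left_out w (Over k s)) - 1] (mod n)"
        and o: "[h (left_out w (Over k s)) = h (left_in w (Over k s)) + 1] (mod n)"
        using False by (simp_all add: side_crossing(6)[OF v])
      moreover have "[h (left_out w (Over k s)) - 1 = h (left_in w (Over k s)) + 1 - 1] (mod n)"
        by (intro cong_diff o cong_refl)
      ultimately have "[h (left_out w (Under k s)) = h (left_in w (Over k s)) + 1 - 1] (mod n)"
        by (blast intro: cong_trans)
      then show ?thesis unfolding x by (simp add: cong_sym_eq)
    qed
    then have "[h (left_in w (w ! i)) + 1 * height w i - h (left_in w (w ! i)) =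
        h (left_out w (w ! j)) + 1 * height w (Suc j) - h (left_out w (w ! j))] (mod n)"
      by (intro cong_diff cong_trans[OF p1 cong_sym[OF p2]])
    then show ?thesis by simp
  qed
  \<comment> \<open>The modulus exceeds the absolute value of the difference, which must then
    vanish.\<close>
  have "[height w i = height w (Suc j)] (mod (\<bar>height w i - height w (Suc j)\<bar> + 2))"
    by (rule cong) simp
  then have "\<bar>height w i - height w (Suc j)\<bar> + 2 dvd height w i - height w (Suc j)"
    by (simp only: cong_iff_dvd_diff)
  then have "height w i - height w (Suc j) = 0"
    using zdvd_imp_le[of "\<bar>height w i - height w (Suc j)\<bar> + 2" "\<bar>height w i - height w (Suc j)\<bar>"] by fastforce
  then show "height w i = height w (Suc j)" by simp
qed

section \<open>Laurent polynomials\<close>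

lemma mpow_add: "mpow a * mpow b = mpow (a + b)"
  by (simp add: mpow_def mult_single)

lemma mpow_0 [simp]: "mpow 0 = 1"
  by (simp add: mpow_def single_one)

lemma mpow_power: "mpow (int n) = mpow 1 ^ n"
  by (induction n) (simp_all add: mpow_add[symmetric])

lemma mpow_inverse [simp]: "mpow a * mpow (- a) = 1" "mpow (- a) * mpow a = 1"
  by (simp_all add: mpow_add)

lemma poly_mapping_sum_single:
  "f = (\<Sum>k\<in>Poly_Mapping.keys f. Poly_Mapping.single k (Poly_Mapping.lookup f k))"
  by (rule poly_mapping_eqI)
     (auto simp: lookup_sum lookup_single when_def in_keys_iff sum.delta)

lemma lookup_laurent_of_poly:
  "Poly_Mapping.lookup (laurent_of_poly p) k = (if k \<ge> 0 then coeff p (nat k) else 0)"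
proof -
  have "Poly_Mapping.lookup (laurent_of_poly p) k = (\<Sum>i\<le>degree p. if int i = k then coeff p i else 0)"
    unfolding laurent_of_poly_def by (simp add: lookup_sum lookup_single when_def)
  also have "\<dots> = (if k \<ge> 0 then coeff p (nat k) else 0)"
  proof (cases "k \<ge> 0")
    case True
    then have "int i = k \<longleftrightarrow> i = nat k" for i by auto
    then show ?thesis using True by (auto simp: coeff_eq_0)
  next
    case False
    then have "(\<Sum>i\<le>degree p. if int i = k then coeff p i else 0) = 0"
      by (intro sum.neutral) auto
    then show ?thesis using False by simp
  qed
  finally show ?thesis .
qed

lemma laurent_of_poly_0 [simp]: "laurent_of_poly 0 = 0"
  by (simp add: laurent_of_poly_def)

lemma laurent_of_poly_1 [simp]: "laurent_of_poly 1 = 1"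
  by (simp add: laurent_of_poly_def single_one)

lemma laurent_of_poly_add: "laurent_of_poly (p + q) = laurent_of_poly p + laurent_of_poly q"
  by (rule poly_mapping_eqI) (simp add: lookup_laurent_of_poly lookup_add)

lemma laurent_of_poly_uminus: "laurent_of_poly (- p) = - laurent_of_poly p"
  by (rule poly_mapping_eqI) (simp add: lookup_laurent_of_poly)

lemma laurent_of_poly_const: "laurent_of_poly [:c:] = of_int c"
proof -
  have "of_int c = (Poly_Mapping.single 0 c :: laurent)"
    by (induction c) (simp_all add: single_uminus single_diff)
  then show ?thesis by (simp add: laurent_of_poly_def)
qed

lemma laurent_of_poly_pCons: "laurent_of_poly (pCons a p) = of_int a + mpow 1 * laurent_of_poly p"
proof -
  have "mpow 1 * laurent_of_poly p = laurent_of_poly (pCons 0 p)"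
  proof (rule poly_mapping_eqI)
    fix k
    have "mpow 1 * laurent_of_poly p = (\<Sum>i\<le>degree p. Poly_Mapping.single (1 + int i) (coeff p i))"
      by (simp add: laurent_of_poly_def mpow_def sum_distrib_left mult_single)
    then have "Poly_Mapping.lookup (mpow 1 * laurent_of_poly p) k =
        (\<Sum>i\<le>degree p. if 1 + int i = k then coeff p i else 0)"
      by (simp add: lookup_sum lookup_single when_def)
    also have "\<dots> = (if k \<ge> 1 then coeff p (nat (k - 1)) else 0)"
    proof (cases "k \<ge> 1")
      case True
      then have "1 + int i = k \<longleftrightarrow> i = nat (k - 1)" for i by auto
      then show ?thesis using True by (auto simp: coeff_eq_0)
    next
      case False
      then have "(\<Sum>i\<le>degree p. if 1 + int i = k then coeff p i else 0) = 0"
        by (intro sum.neutral) auto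
      then show ?thesis using False by simp
    qed
    also have "\<dots> = Poly_Mapping.lookup (laurent_of_poly (pCons 0 p)) k"
      by (auto simp: lookup_laurent_of_poly coeff_pCons nat_diff_distrib split: nat.split)
    finally show "Poly_Mapping.lookup (mpow 1 * laurent_of_poly p) k =
        Poly_Mapping.lookup (laurent_of_poly (pCons 0 p)) k" .
  qed
  moreover have "pCons a p = [:a:] + pCons 0 p" by simp
  ultimately show ?thesis by (simp only: laurent_of_poly_add laurent_of_poly_const)
qed

lemma laurent_of_poly_mult: "laurent_of_poly (p * q) = laurent_of_poly p * laurent_of_poly q"
proof (induction p)
  case (pCons a p)
  have s: "laurent_of_poly (smult c q) = of_int c * laurent_of_poly q" for c
    by (induction q) (simp_all add: laurent_of_poly_pCons algebra_simps)
  have "pCons a p * q = smult a q + pCons 0 (p * q)" by simp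
  then show ?case
    by (simp only: laurent_of_poly_add s laurent_of_poly_pCons pCons.IH) (simp add: algebra_simps)
qed simp

interpretation laurent_hom: comm_ring_hom laurent_of_poly
  by unfold_locales (simp_all add: laurent_of_poly_add laurent_of_poly_mult)

subsection \<open>Evaluation modulo \<open>n\<close>\<close>

definition power_mod :: "int \<Rightarrow> int \<Rightarrow> int \<Rightarrow> int" where
  "power_mod n m k = (if k \<ge> 0 then m ^ nat k else modular_inverse n m ^ nat (- k))"

text \<open>Integer-valued evaluation at \<open>m\<close>. It is additive outright but
  multiplicative only modulo \<open>n\<close>, since the modular inverse inverts \<open>m\<close>
  only there.\<close>

definition eval_mod :: "int \<Rightarrow> int \<Rightarrow> laurent \<Rightarrow> int" where
  "eval_mod n m f = (\<Sum>k\<in>Poly_Mapping.keys f. Poly_Mapping.lookup f k * power_mod n m k)"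

lemma eval_mod_superset:
  assumes "finite S" "Poly_Mapping.keys f \<subseteq> S"
  shows "eval_mod n m f = (\<Sum>k\<in>S. Poly_Mapping.lookup f k * power_mod n m k)"
  unfolding eval_mod_def by (rule sum.mono_neutral_left) (use assms in \<open>auto simp: in_keys_iff\<close>)

lemma eval_mod_add: "eval_mod n m (f + g) = eval_mod n m f + eval_mod n m g"
proof -
  let ?S = "Poly_Mapping.keys f \<union> Poly_Mapping.keys g"
  have "Poly_Mapping.keys (f + g) \<subseteq> ?S" by (rule keys_add)
  then show ?thesis
    by (simp add: eval_mod_superset[where S = ?S] lookup_add algebra_simps sum.distrib)
qed

lemma eval_mod_0 [simp]: "eval_mod n m 0 = 0"
  by (simp add: eval_mod_def)

lemma eval_mod_uminus: "eval_mod n m (- f) = - eval_mod n m f"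
  using eval_mod_add[of n m f "- f"] by simp

lemma eval_mod_diff: "eval_mod n m (f - g) = eval_mod n m f - eval_mod n m g"
  using eval_mod_add[of n m f "- g"] by (simp add: eval_mod_uminus)

lemma eval_mod_sum: "eval_mod n m (\<Sum>i\<in>I. f i) = (\<Sum>i\<in>I. eval_mod n m (f i))"
  by (induction I rule: infinite_finite_induct) (simp_all add: eval_mod_add)

lemma eval_mod_single: "eval_mod n m (Poly_Mapping.single k c) = c * power_mod n m k"
  by (simp add: eval_mod_def)

lemma eval_mod_mpow: "eval_mod n m (mpow k) = power_mod n m k"
  by (simp add: mpow_def eval_mod_single)

lemma eval_mod_1 [simp]: "eval_mod n m 1 = 1"
  using eval_mod_mpow[of n m 0] by (simp add: power_mod_def)

lemma eval_mod_laurent_of_poly: "eval_mod n m (laurent_of_poly p) = poly p m"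
  by (simp add: laurent_of_poly_def eval_mod_sum eval_mod_single power_mod_def poly_altdef)

context
  fixes n m :: int
  assumes c: "coprime m n"
begin

lemma power_mod_add: "[power_mod n m (a + b) = power_mod n m a * power_mod n m b] (mod n)"
proof -
  have inv: "[m * modular_inverse n m = 1] (mod n)" using cong_modular_inverse1[OF c] .
  have up: "[power_mod n m (a + 1) = power_mod n m a * m] (mod n)" for a
  proof (cases "a \<ge> 0")
    case True
    then show ?thesis by (simp add: power_mod_def nat_add_distrib mult.commute)
  next
    case False
    define l where "l = nat (- a - 1)"
    have a: "a = - int l - 1" using False by (simp add: l_def)
    have "nat (1 + int l) = Suc l" by simp
    then have 1: "power_mod n m a * m = modular_inverse n m ^ l * (m * modular_inverse n m)"
      by (simp add: power_mod_def a)
    have 2: "power_mod n m (a + 1) = modular_inverse n m ^ l * 1"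
      by (simp add: power_mod_def a)
    have "[modular_inverse n m ^ l * (m * modular_inverse n m) = modular_inverse n m ^ l * 1] (mod n)"
      by (intro cong_mult cong_refl inv)
    then show ?thesis unfolding 1 2 by (rule cong_sym)
  qed
  have down: "[power_mod n m (a - 1) = power_mod n m a * modular_inverse n m] (mod n)" for a
  proof -
    have "[power_mod n m a * modular_inverse n m = power_mod n m (a - 1) * m * modular_inverse n m] (mod n)"
      using up[of "a - 1"] by (intro cong_mult cong_refl) simp
    also have "power_mod n m (a - 1) * m * modular_inverse n m = power_mod n m (a - 1) * (m * modular_inverse n m)"
      by simp
    also have "[\<dots> = power_mod n m (a - 1) * 1] (mod n)" by (intro cong_mult cong_refl inv)
    finally show ?thesis by (simp add: cong_sym_eq)
  qed
  show ?thesis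
  proof (induction b rule: int_induct[where k = 0])
    case base
    then show ?case by (simp add: power_mod_def)
  next
    case (step1 i)
    have "[power_mod n m (a + i + 1) = power_mod n m (a + i) * m] (mod n)" by (rule up)
    also have "[power_mod n m (a + i) * m = power_mod n m a * power_mod n m i * m] (mod n)"
      by (intro cong_mult step1 cong_refl)
    also have "power_mod n m a * power_mod n m i * m = power_mod n m a * (power_mod n m i * m)" by simp
    also have "[\<dots> = power_mod n m a * power_mod n m (i + 1)] (mod n)"
      by (intro cong_mult cong_refl cong_sym[OF up])
    finally show ?case by (simp add: add.assoc)
  next
    case (step2 i)
    have "[power_mod n m (a + i - 1) = power_mod n m (a + i) * modular_inverse n m] (mod n)" by (rule down)
    also have "[power_mod n m (a + i) * modular_inverse n m = power_mod n m a * power_mod n m i * modular_inverse n m] (mod n)"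
      by (intro cong_mult step2 cong_refl)
    also have "power_mod n m a * power_mod n m i * modular_inverse n m =
      power_mod n m a * (power_mod n m i * modular_inverse n m)" by simp
    also have "[\<dots> = power_mod n m a * power_mod n m (i - 1)] (mod n)"
      by (intro cong_mult cong_refl cong_sym[OF down])
    finally show ?case by (simp add: add_diff_eq)
  qed
qed

lemma eval_mod_mult: "[eval_mod n m (f * g) = eval_mod n m f * eval_mod n m g] (mod n)"
proof -
  let ?l = Poly_Mapping.lookup
  have "f * g = (\<Sum>a\<in>Poly_Mapping.keys f. Poly_Mapping.single a (?l f a)) *
      (\<Sum>b\<in>Poly_Mapping.keys g. Poly_Mapping.single b (?l g b))"
    using poly_mapping_sum_single[of f] poly_mapping_sum_single[of g] by simp
  also have "\<dots> = (\<Sum>a\<in>Poly_Mapping.keys f. \<Sum>b\<in>Poly_Mapping.keys g.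
      Poly_Mapping.single (a + b) (?l f a * ?l g b))"
    by (simp add: sum_product mult_single)
  finally have "eval_mod n m (f * g) = (\<Sum>a\<in>Poly_Mapping.keys f. \<Sum>b\<in>Poly_Mapping.keys g.
      ?l f a * ?l g b * power_mod n m (a + b))"
    by (simp add: eval_mod_sum eval_mod_single)
  also have "[\<dots> = (\<Sum>a\<in>Poly_Mapping.keys f. \<Sum>b\<in>Poly_Mapping.keys g.
      ?l f a * ?l g b * (power_mod n m a * power_mod n m b))] (mod n)"
    by (intro cong_sum cong_mult cong_refl power_mod_add)
  also have "(\<Sum>a\<in>Poly_Mapping.keys f. \<Sum>b\<in>Poly_Mapping.keys g.
      ?l f a * ?l g b * (power_mod n m a * power_mod n m b)) = eval_mod n m f * eval_mod n m g"
    by (simp add: eval_mod_def sum_product mult_ac)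
  finally show ?thesis .
qed

lemma coprime_power_mod: "coprime (power_mod n m k) n"
  using c by (simp add: power_mod_def)

end

section \<open>Linear relations between the rows and columns of a colouring matrix\<close>

lemma colouring_matrix_index:
  assumes "k < crossings w" "j < crossings w"
  shows "colouring_matrix w $$ (k, j) =
    (let \<mu> = mpow (if is_positive w k then 1 else - 1) in
      (if j = under_arc w k then \<mu> else 0) + (if j = over_arc w k then 1 - \<mu> else 0)
         - (if j = k then 1 else 0))"
  using assms by (simp add: colouring_matrix_def)

text \<open>The exponents are the Alexander indices at the crossings. Only passages on arc
  \<open>j\<close> contribute to column \<open>j\<close>; with these weights each passage
  contributes a difference of consecutive terms, and the sum along the closed knot
  telescopes.\<close>

theorem balanced_row_relation:
  assumes v: "valid_word w" and b: "balanced w"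
  obtains H where "\<And>j. j < crossings w \<Longrightarrow>
    (\<Sum>k<crossings w. mpow (H k) * colouring_matrix w $$ (k, j)) = 0"
proof -
  let ?N = "crossings w" and ?L = "length w"
  have d: "distinct w" using v by (rule valid_word_distinct)
  have "\<forall>k\<in>{..<?N}. \<exists>i<?L. w ! i = Over k (is_positive w k)"
    using valid_word_positions[OF v] by (metis lessThan_iff)
  then obtain pos where pos: "\<And>k. k < ?N \<Longrightarrow> pos k < ?L \<and> w ! pos k = Over k (is_positive w k)"
    by (metis lessThan_iff)
  define H where "H k = height w (pos k)" for k
  have HO: "height w i = H k" if "i < ?L" "w ! i = Over k s" for i k s
  proof -
    have k: "k < ?N" "s = is_positive w k"
      using valid_word_crossing_less[OF v nth_mem[OF that(1)]] valid_word_positive[OF v nth_mem[OF that(1)]]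
      by (simp_all add: that(2))
    then have "pos k = i" using pos[OF k(1)] that nth_eq_iff_index_eq[OF d, of "pos k" i] by simp
    then show ?thesis by (simp add: H_def)
  qed
  have HU: "height w (Suc i) = H k" if "i < ?L" "w ! i = Under k s" for i k s
  proof -
    have k: "k < ?N"
      using valid_word_crossing_less[OF v nth_mem[OF that(1)]] by (simp add: that(2))
    then show ?thesis using b that pos[OF k] unfolding balanced_def H_def by fastforce
  qed
  show ?thesis
  proof (rule that[of H])
    fix j assume j: "j < ?N"
    \<comment> \<open>The index is taken modulo the length so that \<open>\<beta>\<close> closes up;
      this works because the height returns to 0.\<close>
    define \<beta> where "\<beta> i = (if arc_into w (w ! (i mod ?L)) = j then mpow (height w i) else 0)" for i
    \<comment> \<open>The row of a crossing is split between its two passages: the over-arc term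
      belongs to the over-passage, the two under-arc terms to the under-passage, where one arc gives
      way to the other.\<close>
    define F where "F x = (case x of
        Over k s \<Rightarrow> if arc_into w x = j then mpow (H k) * (1 - mpow (if s then 1 else - 1)) else 0
      | Under k s \<Rightarrow> (if arc_into w x = j then mpow (H k) * mpow (if s then 1 else - 1) else 0)
          - (if k = j then mpow (H k) else 0))" for x
    have F: "F (w ! i) = \<beta> i - \<beta> (Suc i)" if i: "i < ?L" for i
    proof (cases "w ! i")
      case (Over k s)
      have "mpow (height w (Suc i)) = mpow (H k) * mpow (if s then 1 else - 1)"
        using HO[OF i Over] height_Suc[OF i] Over by (simp add: mpow_add)
      then show ?thesis
        using i HO[OF i Over] arc_into_Suc[OF d i] by (simp add: F_def \<beta>_def Over algebra_simps)
    next
      case (Under k s)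
      have "height w i = H k + (if s then 1 else - 1)"
        using HU[OF i Under] height_Suc[OF i] Under by (cases s) simp_all
      then have "mpow (height w i) = mpow (H k) * mpow (if s then 1 else - 1)"
        by (simp only: mpow_add)
      then show ?thesis
        using i HU[OF i Under] arc_into_Suc[OF d i] by (simp add: F_def \<beta>_def Under)
    qed
    have "0 < ?L" using valid_word_length[OF v] valid_word_crossings[OF v] by simp
    then have "\<beta> ?L = \<beta> 0" by (simp add: \<beta>_def height_0 height_length[OF v])
    then have "(\<Sum>i<?L. F (w ! i)) = 0"
      using sum_lessThan_telescope'[of \<beta> ?L] F by simp
    then have "(\<Sum>k<?N. F (Over k (is_positive w k)) + F (Under k (is_positive w k))) = 0"
      unfolding sum_over_word[OF v] .
    moreover have "F (Over k (is_positive w k)) + F (Under k (is_positive w k)) =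
        mpow (H k) * colouring_matrix w $$ (k, j)" if "k < ?N" for k
      unfolding colouring_matrix_index[OF that j] F_def over_arc_def under_arc_def Let_def
      by (auto simp: algebra_simps)
    ultimately show "(\<Sum>k<?N. mpow (H k) * colouring_matrix w $$ (k, j)) = 0" by simp
  qed
qed

section \<open>Counting solutions of linear congruences\<close>

definition solutions :: "int \<Rightarrow> int mat \<Rightarrow> (nat \<Rightarrow> int) set" where
  "solutions n A = {X \<in> {..<dim_col A} \<rightarrow>\<^sub>E {0..<n}.
     \<forall>i<dim_row A. n dvd (\<Sum>j<dim_col A. A $$ (i, j) * X j)}"

lemma solutions_cong:
  assumes "dim_row A = dim_row B" "dim_col A = dim_col B"
    and "\<And>i j. i < dim_row B \<Longrightarrow> j < dim_col B \<Longrightarrow> [A $$ (i, j) = B $$ (i, j)] (mod n)"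
  shows "solutions n A = solutions n B"
proof -
  have "[(\<Sum>j<dim_col B. A $$ (i, j) * X j) = (\<Sum>j<dim_col B. B $$ (i, j) * X j)] (mod n)"
    if "i < dim_row B" for i X
    by (intro cong_sum cong_mult cong_refl assms(3)) (use that in auto)
  then have "n dvd (\<Sum>j<dim_col B. A $$ (i, j) * X j) \<longleftrightarrow> n dvd (\<Sum>j<dim_col B. B $$ (i, j) * X j)"
    if "i < dim_row B" for i X
    using that cong_dvd_iff by blast
  then show ?thesis unfolding solutions_def assms(1,2) by auto
qed

lemma solutions_scale_rows:
  assumes "dim_row A = dim_row B" "dim_col A = dim_col B"
    and "\<And>i. i < dim_row B \<Longrightarrow> coprime (c i) n"
    and "\<And>i j. i < dim_row B \<Longrightarrow> j < dim_col B \<Longrightarrow> [A $$ (i, j) = c i * B $$ (i, j)] (mod n)"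
  shows "solutions n A = solutions n B"
proof -
  let ?C = "mat (dim_row B) (dim_col B) (\<lambda>(i, j). c i * B $$ (i, j))"
  have "solutions n A = solutions n ?C"
    by (rule solutions_cong) (use assms in auto)
  also have "\<dots> = solutions n B"
  proof -
    have "n dvd (\<Sum>j<dim_col B. ?C $$ (i, j) * X j) \<longleftrightarrow> n dvd (\<Sum>j<dim_col B. B $$ (i, j) * X j)"
      if i: "i < dim_row B" for i X
    proof -
      have "(\<Sum>j<dim_col B. ?C $$ (i, j) * X j) = c i * (\<Sum>j<dim_col B. B $$ (i, j) * X j)"
        using i by (simp add: sum_distrib_left mult.assoc)
      then show ?thesis
        using assms(3)[OF i] by (simp add: coprime_dvd_mult_right_iff coprime_commute)
    qed
    then show ?thesis unfolding solutions_def by auto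
  qed
  finally show ?thesis .
qed

lemma solutions_addrow:
  assumes "i < dim_row A" "j < dim_row A" "i \<noteq> j"
  shows "solutions n (addrow c i j A) = solutions n A"
proof -
  let ?s = "\<lambda>k X. \<Sum>l<dim_col A. A $$ (k, l) * X l"
  have e: "(\<Sum>l<dim_col A. addrow c i j A $$ (k, l) * X l) = (if k = i then c * ?s j X + ?s i X else ?s k X)"
    if "k < dim_row A" for k X
  proof (cases "k = i")
    case True
    then have "(\<Sum>l<dim_col A. addrow c i j A $$ (k, l) * X l) =
        (\<Sum>l<dim_col A. c * (A $$ (j, l) * X l) + A $$ (i, l) * X l)"
      using that by (intro sum.cong) (auto simp: algebra_simps)
    then show ?thesis using True by (simp add: sum.distrib sum_distrib_left)
  next
    case False
    then show ?thesis using that by (auto intro: sum.cong)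
  qed
  have "(\<forall>k<dim_row A. n dvd (if k = i then c * ?s j X + ?s i X else ?s k X)) \<longleftrightarrow>
      (\<forall>k<dim_row A. n dvd ?s k X)" for X
  proof
    assume L: "\<forall>k<dim_row A. n dvd (if k = i then c * ?s j X + ?s i X else ?s k X)"
    have "n dvd ?s j X" using L assms by auto
    moreover have "n dvd c * ?s j X + ?s i X" using L assms(1) by auto
    ultimately have "n dvd ?s i X" by (simp only: dvd_add_right_iff dvd_mult)
    then show "\<forall>k<dim_row A. n dvd ?s k X" using L by (auto split: if_splits)
  next
    assume "\<forall>k<dim_row A. n dvd ?s k X"
    then show "\<forall>k<dim_row A. n dvd (if k = i then c * ?s j X + ?s i X else ?s k X)"
      using assms by auto
  qed
  moreover have "(\<forall>k<dim_row A. n dvd (\<Sum>l<dim_col A. addrow c i j A $$ (k, l) * X l)) \<longleftrightarrow>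
      (\<forall>k<dim_row A. n dvd (if k = i then c * ?s j X + ?s i X else ?s k X))" for X
    by (intro all_cong1 imp_cong HOL.refl) (simp only: e)
  moreover have "dim_row (addrow c i j A) = dim_row A" "dim_col (addrow c i j A) = dim_col A" by simp_all
  ultimately show ?thesis by (simp only: solutions_def)
qed

lemma solutions_swaprows:
  assumes "i < dim_row A" "j < dim_row A"
  shows "solutions n (swaprows i j A) = solutions n A"
proof -
  let ?s = "\<lambda>k X. \<Sum>l<dim_col A. A $$ (k, l) * X l"
  define p where "p k = (if k = i then j else if k = j then i else k)" for k
  have p: "p k < dim_row A" "p (p k) = k" if "k < dim_row A" for k
    using that assms by (auto simp: p_def)
  have e: "(\<Sum>l<dim_col A. swaprows i j A $$ (k, l) * X l) = ?s (p k) X" if "k < dim_row A" for k X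
    using that assms by (auto simp: p_def intro!: sum.cong)
  have "(\<forall>k<dim_row A. n dvd ?s (p k) X) \<longleftrightarrow> (\<forall>k<dim_row A. n dvd ?s k X)" for X
  proof
    assume L: "\<forall>k<dim_row A. n dvd ?s (p k) X"
    show "\<forall>k<dim_row A. n dvd ?s k X"
    proof (intro allI impI)
      fix k assume "k < dim_row A"
      then show "n dvd ?s k X" using L[rule_format, of "p k"] p[of k] by simp
    qed
  qed (use p in auto)
  moreover have "(\<forall>k<dim_row A. n dvd (\<Sum>l<dim_col A. swaprows i j A $$ (k, l) * X l)) \<longleftrightarrow>
      (\<forall>k<dim_row A. n dvd ?s (p k) X)" for X
    by (intro all_cong1 imp_cong HOL.refl) (simp only: e)
  moreover have "dim_row (swaprows i j A) = dim_row A" "dim_col (swaprows i j A) = dim_col A" by simp_all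
  ultimately show ?thesis by (simp only: solutions_def)
qed

lemma card_solutions_permute_columns:
  assumes p: "p permutes {..<dim_col A}"
  shows "card (solutions n (mat (dim_row A) (dim_col A) (\<lambda>(i, j). A $$ (i, p j)))) = card (solutions n A)"
    (is "card (solutions n ?B) = _")
proof -
  let ?C = "{..<dim_col A}"
  have s: "(\<Sum>j<dim_col A. A $$ (i, p j) * X (p j)) = (\<Sum>j<dim_col A. A $$ (i, j) * X j)" for i X
    by (rule sum.permute[OF p, symmetric, unfolded comp_def])
  have q: "inv_into UNIV p permutes ?C" using permutes_inv[OF p] .
  have pq: "p (inv_into UNIV p x) = x" "inv_into UNIV p (p x) = x" for x
    using permutes_inverses[OF p] by auto
  have pm: "p x < dim_col A \<longleftrightarrow> x < dim_col A" "inv_into UNIV p x < dim_col A \<longleftrightarrow> x < dim_col A" for x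
    using permutes_in_image[OF p, of x] permutes_in_image[OF q, of x] by auto
  have "bij_betw (\<lambda>X. restrict (X \<circ> p) ?C) (solutions n A) (solutions n ?B)"
  proof (rule bij_betw_byWitness[where f' = "\<lambda>X. restrict (X \<circ> inv_into UNIV p) ?C"])
    show "\<forall>X\<in>solutions n A. restrict (restrict (X \<circ> p) ?C \<circ> inv_into UNIV p) ?C = X"
      "\<forall>X\<in>solutions n ?B. restrict (restrict (X \<circ> inv_into UNIV p) ?C \<circ> p) ?C = X"
      by (auto simp: solutions_def PiE_iff extensional_def fun_eq_iff pq pm)
    show "(\<lambda>X. restrict (X \<circ> p) ?C) ` solutions n A \<subseteq> solutions n ?B"
      using s by (auto simp: solutions_def PiE_iff pm)
    show "(\<lambda>X. restrict (X \<circ> inv_into UNIV p) ?C) ` solutions n ?B \<subseteq> solutions n A"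
    proof clarify
      fix X assume X: "X \<in> solutions n ?B"
      have "(\<Sum>j<dim_col A. A $$ (i, j) * restrict (X \<circ> inv_into UNIV p) ?C j) =
          (\<Sum>j<dim_col A. A $$ (i, p j) * X j)" for i
        using s[of i "restrict (X \<circ> inv_into UNIV p) ?C"] by (simp add: pq pm)
      then show "restrict (X \<circ> inv_into UNIV p) ?C \<in> solutions n A"
        using X by (auto simp: solutions_def PiE_iff pm)
    qed
  qed
  then show ?thesis by (metis bij_betw_same_card)
qed

lemma solutions_permute_rows:
  assumes p: "p permutes {..<dim_row A}"
  shows "solutions n (mat (dim_row A) (dim_col A) (\<lambda>(i, j). A $$ (p i, j))) = solutions n A"
proof -
  let ?P = "\<lambda>X i. n dvd (\<Sum>j<dim_col A. A $$ (i, j) * X j)"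
  have "(\<forall>i<dim_row A. ?P X (p i)) \<longleftrightarrow> (\<forall>i<dim_row A. ?P X i)" for X
  proof -
    have "(\<forall>i\<in>{..<dim_row A}. ?P X (p i)) \<longleftrightarrow> (\<forall>i\<in>p ` {..<dim_row A}. ?P X i)" by simp
    then show ?thesis unfolding permutes_image[OF p] Ball_def lessThan_iff .
  qed
  then show ?thesis by (simp add: solutions_def)
qed

text \<open>Division by the gcd \<open>g\<close> leaves an invertible coefficient modulo
  \<open>n div g\<close>, hence one residue class, which has \<open>g\<close> representatives below
  \<open>n\<close>.\<close>

lemma card_linear_congruence:
  fixes n a s :: int
  assumes n: "n \<ge> 1" and g: "gcd a n dvd s"
  shows "card {x \<in> {0..<n}. n dvd a * x + s} = nat (gcd a n)"
proof -
  define g where "g = gcd a n"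
  have gp: "g > 0" using n by (simp add: g_def)
  obtain a' where a: "a = g * a'" unfolding g_def by (metis dvdE gcd_dvd1)
  obtain n' where n': "n = g * n'" unfolding g_def by (metis dvdE gcd_dvd2)
  obtain s' where s: "s = g * s'" using assms(2) by (auto simp: g_def)
  have "g * n' > 0" using n n' by linarith
  then have n'p: "n' > 0" using gp by (simp add: zero_less_mult_iff)
  have "coprime a' n'"
  proof -
    have "gcd a n = g * gcd a' n'" unfolding a n' using gp by (simp add: gcd_mult_distrib_int[symmetric] abs_of_pos)
    then have "gcd a' n' = 1" using gp by (simp add: g_def[symmetric])
    then show ?thesis by (simp add: coprime_iff_gcd_eq_1)
  qed
  then obtain b where b: "[a' * b = 1] (mod n')" using cong_solve_coprime_int by blast
  define x0 where "x0 = (- s' * b) mod n'"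
  have x0: "0 \<le> x0" "x0 < n'" using n'p by (simp_all add: x0_def)
  have "[a' * x0 = a' * (- s' * b)] (mod n')" by (intro cong_mult cong_refl) (simp add: x0_def cong_def)
  also have "a' * (- s' * b) = (a' * b) * - s'" by simp
  also have "[(a' * b) * - s' = 1 * - s'] (mod n')" by (intro cong_mult cong_refl b)
  finally have sol: "n' dvd a' * x0 + s'" by (simp add: cong_iff_dvd_diff)
  have iff: "n dvd a * x + s \<longleftrightarrow> n' dvd x - x0" for x
  proof -
    have "n dvd a * x + s \<longleftrightarrow> g * n' dvd g * (a' * x + s')"
      by (simp add: n' a s algebra_simps)
    also have "\<dots> \<longleftrightarrow> n' dvd a' * x + s'" using gp by simp
    also have "a' * x + s' = a' * (x - x0) + (a' * x0 + s')" by (simp add: algebra_simps)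
    also have "n' dvd \<dots> \<longleftrightarrow> n' dvd a' * (x - x0)" using sol by (rule dvd_add_left_iff)
    also have "\<dots> \<longleftrightarrow> n' dvd x - x0"
      using \<open>coprime a' n'\<close> by (simp add: coprime_dvd_mult_right_iff coprime_commute)
    finally show ?thesis .
  qed
  have "bij_betw (\<lambda>k. x0 + n' * k) {0..<g} {x \<in> {0..<n}. n dvd a * x + s}"
  proof (rule bij_betwI[where g = "\<lambda>x. (x - x0) div n'"])
    show "(\<lambda>k. x0 + n' * k) \<in> {0..<g} \<rightarrow> {x \<in> {0..<n}. n dvd a * x + s}"
    proof
      fix k assume k: "k \<in> {0..<g}"
      have "n' * k \<le> n' * (g - 1)" using k n'p by (intro mult_left_mono) auto
      then have "x0 + n' * k < n" using x0 by (simp add: n' algebra_simps)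
      then show "x0 + n' * k \<in> {x \<in> {0..<n}. n dvd a * x + s}"
        using k x0 n'p by (simp add: iff)
    qed
    show "(\<lambda>x. (x - x0) div n') \<in> {x \<in> {0..<n}. n dvd a * x + s} \<rightarrow> {0..<g}"
    proof
      fix x assume x: "x \<in> {x \<in> {0..<n}. n dvd a * x + s}"
      then obtain k where k: "x - x0 = n' * k" by (auto simp: iff)
      have "0 \<le> k"
      proof (rule ccontr)
        assume "\<not> 0 \<le> k"
        then have "n' * k \<le> n' * - 1" using n'p by (intro mult_left_mono) auto
        then show False using k x x0 by simp
      qed
      moreover have "k < g"
      proof (rule ccontr)
        assume "\<not> k < g"
        then have "n' * g \<le> n' * k" using n'p by (intro mult_left_mono) auto
        moreover have "x < n' * g" using x n' by (simp add: mult.commute[of n'])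
        ultimately show False using k x0 by linarith
      qed
      ultimately show "(x - x0) div n' \<in> {0..<g}" using k n'p by simp
    qed
    show "(x0 + n' * k - x0) div n' = k" for k using n'p by simp
    show "x0 + n' * ((x - x0) div n') = x" if "x \<in> {x \<in> {0..<n}. n dvd a * x + s}" for x
      using that n'p by (auto simp: iff)
  qed
  from bij_betw_same_card[OF this] show ?thesis by (simp add: g_def)
qed

text \<open>The first unknown occurs in the first row only, so a solution of the remaining rows
  extends by the solutions of one congruence. Their number is the same for all \<open>X\<close> once
  solvability is known; this is the condition \<open>dvd\<close>, established differently for type I
  matrices and for determinants.\<close>

lemma card_solutions_peel:
  assumes n: "n \<ge> 1" and A: "A \<in> carrier_mat (Suc N) (Suc N)"
    and z: "\<And>i. i < N \<Longrightarrow> A $$ (Suc i, 0) = 0"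
    and dvd: "\<And>X. X \<in> solutions n (mat_delete A 0 0) \<Longrightarrow>
      gcd (A $$ (0, 0)) n dvd (\<Sum>j<N. A $$ (0, Suc j) * X j)"
  shows "card (solutions n A) = nat (gcd (A $$ (0, 0)) n) * card (solutions n (mat_delete A 0 0))"
proof -
  let ?B = "mat_delete A 0 0"
  let ?R = "\<lambda>X. {x \<in> {0..<n}. n dvd A $$ (0, 0) * x + (\<Sum>j<N. A $$ (0, Suc j) * X j)}"
  have B: "dim_row ?B = N" "dim_col ?B = N" "\<And>i j. i < N \<Longrightarrow> j < N \<Longrightarrow> ?B $$ (i, j) = A $$ (Suc i, Suc j)"
    using A by (auto simp: mat_delete_def)
  have s: "(\<Sum>j<Suc N. A $$ (i, j) * X j) = A $$ (i, 0) * X 0 + (\<Sum>j<N. A $$ (i, Suc j) * X (Suc j))" for i X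
    by (simp only: sum.lessThan_Suc_shift)
  have iff: "X \<in> solutions n A \<longleftrightarrow> X \<in> {..<Suc N} \<rightarrow>\<^sub>E {0..<n} \<and>
      n dvd A $$ (0, 0) * X 0 + (\<Sum>j<N. A $$ (0, Suc j) * X (Suc j)) \<and>
      (\<forall>i<N. n dvd (\<Sum>j<N. A $$ (Suc i, Suc j) * X (Suc j)))" for X
    using A z unfolding solutions_def by (simp add: All_less_Suc2 s del: sum.lessThan_Suc)
  have iffB: "Z \<in> solutions n ?B \<longleftrightarrow> Z \<in> {..<N} \<rightarrow>\<^sub>E {0..<n} \<and>
      (\<forall>i<N. n dvd (\<Sum>j<N. A $$ (Suc i, Suc j) * Z j))" for Z
    unfolding solutions_def using B by simp
  have "bij_betw (\<lambda>X. (restrict (\<lambda>j. X (Suc j)) {..<N}, X 0)) (solutions n A) (Sigma (solutions n ?B) ?R)"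
  proof (rule bij_betw_byWitness[where f' = "\<lambda>(Z, x). restrict (case_nat x Z) {..<Suc N}"])
    show "\<forall>X\<in>solutions n A. (case (restrict (\<lambda>j. X (Suc j)) {..<N}, X 0) of
        (Z, x) \<Rightarrow> restrict (case_nat x Z) {..<Suc N}) = X"
    proof
      fix X assume "X \<in> solutions n A"
      then have "X j = undefined" if "\<not> j < Suc N" for j
        using that unfolding iff by (auto simp: PiE_iff extensional_def)
      then show "(case (restrict (\<lambda>j. X (Suc j)) {..<N}, X 0) of
        (Z, x) \<Rightarrow> restrict (case_nat x Z) {..<Suc N}) = X"
        by (auto simp: fun_eq_iff restrict_def split: nat.split)
    qed
    show "\<forall>p\<in>Sigma (solutions n ?B) ?R. (restrict (\<lambda>j. (case p of
        (Z, x) \<Rightarrow> restrict (case_nat x Z) {..<Suc N}) (Suc j)) {..<N},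
        (case p of (Z, x) \<Rightarrow> restrict (case_nat x Z) {..<Suc N}) 0) = p"
      by (auto simp: iffB PiE_iff extensional_def fun_eq_iff restrict_def)
    show "(\<lambda>X. (restrict (\<lambda>j. X (Suc j)) {..<N}, X 0)) ` solutions n A \<subseteq> Sigma (solutions n ?B) ?R"
    proof (rule image_subsetI)
      fix X assume "X \<in> solutions n A"
      then show "(restrict (\<lambda>j. X (Suc j)) {..<N}, X 0) \<in> Sigma (solutions n ?B) ?R"
        unfolding iff by (auto simp: iffB PiE_iff)
    qed
    show "(\<lambda>(Z, x). restrict (case_nat x Z) {..<Suc N}) ` Sigma (solutions n ?B) ?R \<subseteq> solutions n A"
    proof clarify
      fix Z x assume Z: "Z \<in> solutions n ?B" and x: "x \<in> {0..<n}"
        "n dvd A $$ (0, 0) * x + (\<Sum>j<N. A $$ (0, Suc j) * Z j)"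
      show "restrict (case_nat x Z) {..<Suc N} \<in> solutions n A"
        unfolding iff using Z x by (auto simp: iffB PiE_iff split: nat.split)
    qed
  qed
  then have "card (solutions n A) = card (Sigma (solutions n ?B) ?R)" by (rule bij_betw_same_card)
  also have "\<dots> = (\<Sum>X\<in>solutions n ?B. card (?R X))"
  proof (rule card_SigmaI)
    have "finite ({..<N} \<rightarrow>\<^sub>E {0..<n})" by (intro finite_PiE) auto
    then show "finite (solutions n ?B)" by (rule finite_subset[rotated]) (use iffB in blast)
    show "\<forall>X\<in>solutions n ?B. finite (?R X)"
      by (intro ballI finite_subset[of "?R _" "{0..<n}"]) auto
  qed
  also have "\<dots> = (\<Sum>X\<in>solutions n ?B. nat (gcd (A $$ (0, 0)) n))"
    by (intro sum.cong HOL.refl card_linear_congruence n dvd)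
  finally show ?thesis by simp
qed

lemma card_solutions_empty: "A \<in> carrier_mat 0 0 \<Longrightarrow> card (solutions n A) = 1"
proof -
  assume "A \<in> carrier_mat 0 0"
  then have "solutions n A = {\<lambda>_. undefined}" by (auto simp: solutions_def)
  then show ?thesis by simp
qed

text \<open>Unit pivots fix their unknown and the last unknown is free. The row of \<alpha> is
  always solvable for its pivot, because its other entry is a multiple of \<alpha>.\<close>

lemma card_solutions_type_I:
  assumes n: "n \<ge> 1"
  shows "A \<in> carrier_mat (k + 2) (k + 2) \<Longrightarrow> (\<And>i j. j < i \<Longrightarrow> i < k + 2 \<Longrightarrow> A $$ (i, j) = 0) \<Longrightarrow>
    (\<And>i. i < k \<Longrightarrow> A $$ (i, i) = 1) \<Longrightarrow> A $$ (k, k) = a \<Longrightarrow> A $$ (k, k + 1) = - a \<Longrightarrow>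
    A $$ (k + 1, k + 1) = 0 \<Longrightarrow> card (solutions n A) = nat n * nat (gcd a n)"
proof (induction k arbitrary: A)
  case 0
  let ?B = "mat_delete A 0 0"
  have B: "?B \<in> carrier_mat (Suc 0) (Suc 0)" "?B $$ (0, 0) = 0"
    using 0 by (auto simp: mat_delete_def)
  have "mat_delete ?B 0 0 \<in> carrier_mat 0 0" using mat_delete_carrier[OF B(1)] by simp
  then have "card (solutions n ?B) = nat n"
    using card_solutions_peel[OF n B(1)] B(2) n by (simp add: card_solutions_empty)
  moreover have "card (solutions n A) = nat (gcd (A $$ (0, 0)) n) * card (solutions n ?B)"
    by (rule card_solutions_peel[OF n, of A 1]) (use 0 in auto)
  ultimately show ?case using 0 by simp
next
  case (Suc k)
  let ?B = "mat_delete A 0 0"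
  have B: "?B $$ (i, j) = A $$ (Suc i, Suc j)" if "i < k + 2" "j < k + 2" for i j
    using Suc.prems(1) that by (auto simp: mat_delete_def)
  have "card (solutions n ?B) = nat n * nat (gcd a n)"
    by (rule Suc.IH) (use mat_delete_carrier[OF Suc.prems(1)] Suc.prems in \<open>auto simp: B\<close>)
  moreover have "card (solutions n A) = nat (gcd (A $$ (0, 0)) n) * card (solutions n ?B)"
    by (rule card_solutions_peel[OF n, of A "k + 2"]) (use Suc.prems in auto)
  ultimately show ?case using Suc.prems(3)[of 0] by simp
qed

subsection \<open>The number of solutions and the determinant\<close>

text \<open>Subtractive Euclidean algorithm in the first column, with the sum of absolute values as
  measure; a final row exchange brings the surviving entry to the top.\<close>

lemma first_column_reduction:
  assumes "A \<in> carrier_mat (Suc N) (Suc N)"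
  shows "\<exists>B. B \<in> carrier_mat (Suc N) (Suc N) \<and> (\<forall>i<N. B $$ (Suc i, 0) = 0) \<and>
    (det B = det A \<or> det B = - det A) \<and> solutions n B = solutions n A"
  using assms
proof (induction "\<Sum>i<Suc N. nat \<bar>A $$ (i, 0)\<bar>" arbitrary: A rule: less_induct)
  case less
  note A = less.prems
  show ?case
  proof (cases "\<exists>i<Suc N. \<exists>j<Suc N. i \<noteq> j \<and> A $$ (i, 0) \<noteq> 0 \<and> A $$ (j, 0) \<noteq> 0")
    case True
    then obtain i j where ij: "i < Suc N" "j < Suc N" "i \<noteq> j" "A $$ (i, 0) \<noteq> 0" "A $$ (j, 0) \<noteq> 0"
      "\<bar>A $$ (j, 0)\<bar> \<le> \<bar>A $$ (i, 0)\<bar>"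
      by (metis linear)
    \<comment> \<open>Subtract for equal signs, add for opposite ones; as the smaller entry is
      nonzero, the larger one shrinks.\<close>
    define c :: int where "c = (if (A $$ (i, 0) > 0) = (A $$ (j, 0) > 0) then - 1 else 1)"
    let ?B = "addrow c i j A"
    have B: "?B \<in> carrier_mat (Suc N) (Suc N)" using A by simp
    have e: "?B $$ (k, 0) = (if k = i then c * A $$ (j, 0) + A $$ (i, 0) else A $$ (k, 0))" if "k < Suc N" for k
      using A that by auto
    have "(\<Sum>k<Suc N. nat \<bar>?B $$ (k, 0)\<bar>) < (\<Sum>k<Suc N. nat \<bar>A $$ (k, 0)\<bar>)"
    proof (rule sum_strict_mono_ex1)
      have "nat \<bar>?B $$ (i, 0)\<bar> < nat \<bar>A $$ (i, 0)\<bar>"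
      proof -
        have "?B $$ (i, 0) = c * A $$ (j, 0) + A $$ (i, 0)" using e[OF ij(1)] by simp
        then show ?thesis
          using ij(4-6) by (simp only:) (auto simp: c_def abs_if split: if_splits)
      qed
      then show "\<exists>k\<in>{..<Suc N}. nat \<bar>?B $$ (k, 0)\<bar> < nat \<bar>A $$ (k, 0)\<bar>" using ij(1) by blast
      then show "\<forall>k\<in>{..<Suc N}. nat \<bar>?B $$ (k, 0)\<bar> \<le> nat \<bar>A $$ (k, 0)\<bar>"
        using \<open>nat \<bar>?B $$ (i, 0)\<bar> < nat \<bar>A $$ (i, 0)\<bar>\<close> e by (metis lessThan_iff less_imp_le order_refl)
    qed simp
    from less.hyps[OF this B] obtain C where "C \<in> carrier_mat (Suc N) (Suc N)"
      "\<forall>i<N. C $$ (Suc i, 0) = 0" "det C = det ?B \<or> det C = - det ?B" "solutions n C = solutions n ?B"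
      by blast
    moreover have "det ?B = det A" by (rule det_addrow[OF ij(2,3) A])
    moreover have "solutions n ?B = solutions n A" by (rule solutions_addrow) (use ij A in auto)
    ultimately show ?thesis by metis
  next
    case False
    show ?thesis
    proof (cases "\<forall>i<N. A $$ (Suc i, 0) = 0")
      case True
      then show ?thesis using A by blast
    next
      case F: False
      then obtain i where i: "i < N" "A $$ (Suc i, 0) \<noteq> 0" by auto
      let ?B = "swaprows 0 (Suc i) A"
      have "?B $$ (Suc k, 0) = 0" if "k < N" for k
        using that i A False by (cases "k = i") auto
      moreover have "det ?B = - det A" by (rule det_swaprows[of _ "Suc N"]) (use i A in auto)
      moreover have "solutions n ?B = solutions n A" by (rule solutions_swaprows) (use i A in auto)
      ultimately show ?thesis using A by (intro exI[of _ ?B]) auto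
    qed
  qed
qed

text \<open>Multiplying the congruences by the adjugate isolates each unknown with coefficient
  \<open>det A\<close>.\<close>

lemma solutions_det_dvd:
  assumes A: "A \<in> carrier_mat N N" and X: "X \<in> solutions n A" and j: "j < N"
  shows "n dvd det A * X j"
proof -
  have d: "dim_row A = N" "dim_col A = N" using A by auto
  let ?C = "adj_mat A"
  have C: "?C \<in> carrier_mat N N" "?C * A = det A \<cdot>\<^sub>m 1\<^sub>m N" using adj_mat[OF A] by auto
  have "(\<Sum>i<N. ?C $$ (j, i) * (\<Sum>l<N. A $$ (i, l) * X l)) =
      (\<Sum>i<N. \<Sum>l<N. ?C $$ (j, i) * (A $$ (i, l) * X l))"
    by (simp only: sum_distrib_left)
  also have "\<dots> = (\<Sum>l<N. \<Sum>i<N. ?C $$ (j, i) * (A $$ (i, l) * X l))"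
    by (rule sum.swap)
  also have "\<dots> = (\<Sum>l<N. (\<Sum>i<N. ?C $$ (j, i) * A $$ (i, l)) * X l)"
    by (simp only: sum_distrib_right mult.assoc)
  also have "\<dots> = (\<Sum>l<N. (if l = j then det A else 0) * X l)"
  proof (rule sum.cong[OF HOL.refl])
    fix l assume l: "l \<in> {..<N}"
    have "(\<Sum>i<N. ?C $$ (j, i) * A $$ (i, l)) = (?C * A) $$ (j, l)"
      using C(1) A j l by (simp add: scalar_prod_def lessThan_atLeast0)
    also have "\<dots> = (if l = j then det A else 0)" unfolding C(2) using j l by auto
    finally show "(\<Sum>i<N. ?C $$ (j, i) * A $$ (i, l)) * X l = (if l = j then det A else 0) * X l" by simp
  qed
  also have "\<dots> = det A * X j" using j by (simp add: if_distrib[of "\<lambda>x. x * _"] cong: if_cong)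
  finally have "det A * X j = (\<Sum>i<N. ?C $$ (j, i) * (\<Sum>l<N. A $$ (i, l) * X l))" by simp
  also have "n dvd \<dots>" by (rule dvd_sum, rule dvd_mult) (use X in \<open>auto simp: solutions_def d\<close>)
  finally show ?thesis .
qed

text \<open>Multiplicativity fails for \<open>a = b = n = 2\<close>. If \<open>a * b\<close> divides
  \<open>n\<close> up to a factor coprime to \<open>n\<close>, no prime of \<open>n\<close> occurs
  in \<open>a * b\<close> more often than in \<open>n\<close>, and nothing is cut off by the
  gcd.\<close>

lemma gcd_mult_gcd:
  fixes a b n u :: int
  assumes n: "n \<ge> 1" and u: "coprime u n" and ab: "a * b dvd n * u" and 0: "a * b \<noteq> 0"
  shows "gcd (a * b) n = gcd a n * gcd b n"
proof -
  \<comment> \<open>Removing from a divisor of \<open>n * u\<close> its gcd with \<open>n\<close>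
    leaves no prime of \<open>n\<close> behind.\<close>
  have part: "coprime (x div gcd x n) n" if x: "x dvd n * u" "x \<noteq> 0" for x
  proof (rule ccontr)
    define g where "g = gcd x n"
    have g: "g \<noteq> 0" using n by (simp add: g_def)
    assume "\<not> coprime (x div gcd x n) n"
    then have "\<not> is_unit (gcd (x div g) n)" unfolding g_def is_unit_gcd .
    moreover have "gcd (x div g) n \<noteq> 0" using n by simp
    ultimately obtain p where "p dvd gcd (x div g) n" "prime p"
      using prime_divisor_exists by blast
    then have p: "prime p" "p dvd x div g" "p dvd n" by simp_all
    have e: "g * (x div g) = x" "g * ((n div g) * u) = n * u"
      by (simp_all add: g_def mult.assoc[symmetric])
    have "g * (x div g) dvd g * ((n div g) * u)" unfolding e by (rule x(1))
    then have "x div g dvd (n div g) * u" using g by simp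
    then have "p dvd (n div g) * u" using p(2) by (rule dvd_trans[rotated])
    moreover have "\<not> p dvd u" using p u by (meson coprime_common_divisor not_prime_unit)
    ultimately have "p dvd n div g" using p(1) by (simp add: prime_dvd_mult_iff)
    moreover have "coprime (x div g) (n div g)" unfolding g_def by (rule div_gcd_coprime) (use n in simp)
    ultimately show False using p by (meson coprime_common_divisor not_prime_unit)
  qed
  define A B a' b' where "A = gcd a n" and "B = gcd b n" and "a' = a div gcd a n" and "b' = b div gcd b n"
  have a: "a = A * a'" and b: "b = B * b'" by (simp_all add: A_def B_def a'_def b'_def)
  have "a dvd n * u" "b dvd n * u" using ab by (auto intro: dvd_trans)
  then have c: "coprime a' n" "coprime b' n"
    using part[of a] part[of b] 0 by (simp_all add: a'_def b'_def)
  have "coprime A u" "coprime B u"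
    by (rule coprime_divisors[of _ n u u]; use u in \<open>simp add: A_def B_def coprime_commute\<close>)+
  then have "coprime (A * B) u" by simp
  moreover have "A * B dvd n * u"
    using ab by (rule dvd_trans[rotated]) (simp add: A_def B_def mult_dvd_mono)
  ultimately have AB: "A * B dvd n" by (simp only: coprime_dvd_mult_left_iff)
  have "a * b = (A * B) * (a' * b')" by (subst a, subst b) (simp add: ac_simps)
  then have "gcd (a * b) n = gcd (A * B * (a' * b')) n" by simp
  also have "\<dots> = gcd (A * B) n"
    by (rule gcd_mult_left_right_cancel) (use c in \<open>simp add: coprime_commute\<close>)
  also have "\<dots> = A * B" using AB by (simp add: A_def B_def)
  finally show ?thesis by (simp add: A_def B_def)
qed

text \<open>Divisibility of \<open>n * u\<close> by the determinant has two uses: through the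
  adjugate it makes the first row solvable, and through \<open>gcd_mult_gcd\<close> it makes the
  gcds multiply. It passes to the smaller determinant, a divisor of \<open>det A\<close>. In the
  application \<open>u\<close> is a power of the value of \<open>m\<close>.\<close>

theorem card_solutions_det:
  assumes n: "n \<ge> 1" and u: "coprime u n"
  shows "A \<in> carrier_mat N N \<Longrightarrow> det A \<noteq> 0 \<Longrightarrow> det A dvd n * u \<Longrightarrow>
    card (solutions n A) = nat (gcd (det A) n)"
proof (induction N arbitrary: A)
  case 0
  then show ?case by (simp add: card_solutions_empty)
next
  case (Suc N)
  obtain B where B: "B \<in> carrier_mat (Suc N) (Suc N)" "\<And>i. i < N \<Longrightarrow> B $$ (Suc i, 0) = 0"
    "det B = det A \<or> det B = - det A" "solutions n B = solutions n A"
    using first_column_reduction[OF Suc.prems(1), of n] by blast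
  let ?D = "mat_delete B 0 0" and ?a = "B $$ (0, 0)"
  have D: "?D \<in> carrier_mat N N" using B(1) by (auto simp: mat_delete_def)
  have "det B = (\<Sum>i<Suc N. B $$ (i, 0) * cofactor B i 0)"
    by (rule laplace_expansion_column[OF B(1)]) simp
  also have "\<dots> = ?a * det ?D"
    using B(2) by (simp add: sum.lessThan_Suc_shift cofactor_def del: sum.lessThan_Suc)
  finally have dB: "det B = ?a * det ?D" .
  have d: "?a * det ?D dvd n * u" "?a * det ?D \<noteq> 0" using B(3) Suc.prems dB by auto
  have "card (solutions n ?D) = nat (gcd (det ?D) n)"
    by (rule Suc.IH[OF D]) (use d in \<open>auto intro: dvd_trans\<close>)
  moreover have "card (solutions n B) = nat (gcd ?a n) * card (solutions n ?D)"
  proof (rule card_solutions_peel[OF n B(1,2)])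
    fix X assume X: "X \<in> solutions n ?D"
    \<comment> \<open>The adjugate yields \<open>n dvd det ?D * X j\<close>. Since
      \<open>?a * det ?D\<close> divides \<open>n * u\<close>, cancelling \<open>det ?D\<close>
      shows that \<open>?a\<close> divides \<open>X j * u\<close>, and \<open>u\<close> is coprime
      to \<open>n\<close>.\<close>
    have "gcd ?a n dvd X j" if j: "j < N" for j
    proof -
      have "n * u dvd det ?D * X j * u"
        using solutions_det_dvd[OF D X j] by (rule mult_dvd_mono) simp
      with d(1) have "det ?D * ?a dvd det ?D * (X j * u)" by (metis dvd_trans mult.assoc mult.commute)
      then have "?a dvd X j * u" using d(2) by simp
      then have "gcd ?a n dvd X j * u" by (meson dvd_trans gcd_dvd1)
      moreover have "coprime (gcd ?a n) u"
        using u by (metis coprime_commute coprime_divisors dvd_refl gcd_dvd2)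
      ultimately show ?thesis by (simp add: coprime_dvd_mult_left_iff)
    qed
    then show "gcd ?a n dvd (\<Sum>j<N. B $$ (0, Suc j) * X j)" by (intro dvd_sum dvd_mult) auto
  qed
  moreover have "gcd (?a * det ?D) n = gcd ?a n * gcd (det ?D) n" by (rule gcd_mult_gcd[OF n u d])
  moreover have "gcd (det A) n = gcd (?a * det ?D) n" using B(3) dB by auto
  ultimately show ?case using B(4) by (simp add: nat_mult_distrib)
qed

text \<open>Constant vectors solve the first \<open>N\<close> rows, so the last unknown is free and
  subtracting it from the others leads to the minor. The relation with coefficients \<open>c\<close>
  expresses the last row by the others, \<open>c N\<close> being invertible modulo
  \<open>n\<close>.\<close>

lemma card_solutions_delete:
  assumes n: "n \<ge> 1" and A: "A \<in> carrier_mat (Suc N) (Suc N)"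
    and row: "\<And>i. i < N \<Longrightarrow> n dvd (\<Sum>j<Suc N. A $$ (i, j))"
    and col: "\<And>j. j < Suc N \<Longrightarrow> n dvd (\<Sum>i<Suc N. c i * A $$ (i, j))"
    and c: "coprime (c N) n"
  shows "card (solutions n A) = nat n * card (solutions n (mat_delete A N N))"
proof -
  let ?B = "mat_delete A N N"
  have B: "dim_row ?B = N" "dim_col ?B = N" "\<And>i j. i < N \<Longrightarrow> j < N \<Longrightarrow> ?B $$ (i, j) = A $$ (i, j)"
    using A by (auto simp: mat_delete_def)
  let ?s = "\<lambda>i X. \<Sum>j<Suc N. A $$ (i, j) * X j"
  have last: "n dvd ?s N X" if "\<And>i. i < N \<Longrightarrow> n dvd ?s i X" for X
  proof -
    have "(\<Sum>i<Suc N. c i * ?s i X) = (\<Sum>i<Suc N. \<Sum>j<Suc N. c i * (A $$ (i, j) * X j))"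
      by (simp only: sum_distrib_left)
    also have "\<dots> = (\<Sum>j<Suc N. \<Sum>i<Suc N. c i * (A $$ (i, j) * X j))"
      by (rule sum.swap)
    also have "\<dots> = (\<Sum>j<Suc N. (\<Sum>i<Suc N. c i * A $$ (i, j)) * X j)"
      by (simp only: sum_distrib_right mult.assoc)
    also have "n dvd \<dots>" by (rule dvd_sum, rule dvd_mult2) (use col in blast)
    finally have "n dvd c N * ?s N X + (\<Sum>i<N. c i * ?s i X)" by (simp only: sum.lessThan_Suc add.commute)
    moreover have "n dvd (\<Sum>i<N. c i * ?s i X)" by (rule dvd_sum, rule dvd_mult) (use that in blast)
    ultimately have "n dvd c N * ?s N X" by (simp only: dvd_add_left_iff)
    then show ?thesis using c by (simp only: coprime_dvd_mult_right_iff coprime_commute)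
  qed
  have iff: "X \<in> solutions n A \<longleftrightarrow> X \<in> {..<Suc N} \<rightarrow>\<^sub>E {0..<n} \<and> (\<forall>i<N. n dvd ?s i X)" for X
  proof -
    have "(\<forall>i<Suc N. n dvd ?s i X) \<longleftrightarrow> (\<forall>i<N. n dvd ?s i X)"
      using last[of X] by (metis less_Suc_eq)
    then show ?thesis using A unfolding solutions_def by simp
  qed
  have iffB: "Z \<in> solutions n ?B \<longleftrightarrow> Z \<in> {..<N} \<rightarrow>\<^sub>E {0..<n} \<and> (\<forall>i<N. n dvd (\<Sum>j<N. A $$ (i, j) * Z j))" for Z
    unfolding solutions_def using B by simp
  have shift: "n dvd ?s i X \<longleftrightarrow> n dvd (\<Sum>j<N. A $$ (i, j) * Z j)"
    if i: "i < N" and Z: "\<And>j. j < N \<Longrightarrow> [Z j = X j - X N] (mod n)" for i X Z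
  proof -
    have "?s i X = (\<Sum>j<Suc N. A $$ (i, j) * (X j - X N)) + (\<Sum>j<Suc N. A $$ (i, j)) * X N"
      by (simp only: sum_distrib_right sum.distrib[symmetric]) (simp only: right_diff_distrib diff_add_cancel)
    then have "n dvd ?s i X \<longleftrightarrow> n dvd (\<Sum>j<Suc N. A $$ (i, j) * (X j - X N))"
      using row[OF i] by (simp only: dvd_add_left_iff dvd_mult2)
    also have "(\<Sum>j<Suc N. A $$ (i, j) * (X j - X N)) = (\<Sum>j<N. A $$ (i, j) * (X j - X N))" by simp
    also have "n dvd \<dots> \<longleftrightarrow> n dvd (\<Sum>j<N. A $$ (i, j) * Z j)"
      by (intro cong_dvd_iff cong_sum cong_mult cong_refl) (use Z cong_sym in auto)
    finally show ?thesis .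
  qed
  have "bij_betw (\<lambda>X. (restrict (\<lambda>j. (X j - X N) mod n) {..<N}, X N)) (solutions n A)
      (solutions n ?B \<times> {0..<n})"
  proof (rule bij_betw_byWitness[where
        f' = "\<lambda>(Z, b). restrict (\<lambda>j. if j < N then (Z j + b) mod n else b) {..<Suc N}"])
    show "\<forall>X\<in>solutions n A. (case (restrict (\<lambda>j. (X j - X N) mod n) {..<N}, X N) of
        (Z, b) \<Rightarrow> restrict (\<lambda>j. if j < N then (Z j + b) mod n else b) {..<Suc N}) = X"
    proof
      fix X assume "X \<in> solutions n A"
      then have "X \<in> {..<Suc N} \<rightarrow>\<^sub>E {0..<n}" by (simp add: iff)
      then have "X j \<in> {0..<n}" if "j < Suc N" for j using that by (auto simp: PiE_iff simp del: atLeastLessThan_iff)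
      moreover have "X j = undefined" if "\<not> j < Suc N" for j
        using that \<open>X \<in> {..<Suc N} \<rightarrow>\<^sub>E {0..<n}\<close> by (auto simp: PiE_iff extensional_def)
      ultimately show "(case (restrict (\<lambda>j. (X j - X N) mod n) {..<N}, X N) of
        (Z, b) \<Rightarrow> restrict (\<lambda>j. if j < N then (Z j + b) mod n else b) {..<Suc N}) = X"
        by (auto simp: fun_eq_iff mod_add_left_eq less_Suc_eq)
    qed
    show "\<forall>p\<in>solutions n ?B \<times> {0..<n}. (restrict (\<lambda>j. ((case p of
        (Z, b) \<Rightarrow> restrict (\<lambda>j. if j < N then (Z j + b) mod n else b) {..<Suc N}) j - (case p of
        (Z, b) \<Rightarrow> restrict (\<lambda>j. if j < N then (Z j + b) mod n else b) {..<Suc N}) N) mod n) {..<N}, (case p of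
        (Z, b) \<Rightarrow> restrict (\<lambda>j. if j < N then (Z j + b) mod n else b) {..<Suc N}) N) = p"
      by (auto simp: iffB PiE_iff extensional_def fun_eq_iff mod_diff_left_eq)
    show "(\<lambda>X. (restrict (\<lambda>j. (X j - X N) mod n) {..<N}, X N)) ` solutions n A \<subseteq> solutions n ?B \<times> {0..<n}"
    proof (rule image_subsetI)
      fix X assume X: "X \<in> solutions n A"
      have "restrict (\<lambda>j. (X j - X N) mod n) {..<N} \<in> solutions n ?B"
        unfolding iffB
      proof (intro conjI allI impI)
        fix i assume i: "i < N"
        show "n dvd (\<Sum>j<N. A $$ (i, j) * restrict (\<lambda>j. (X j - X N) mod n) {..<N} j)"
          by (subst shift[where X = X, symmetric, OF i]) (use X i in \<open>auto simp: iff cong_def\<close>)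
      qed (use n in auto)
      then show "(restrict (\<lambda>j. (X j - X N) mod n) {..<N}, X N) \<in> solutions n ?B \<times> {0..<n}"
        using X by (auto simp: iff PiE_iff)
    qed
    show "(\<lambda>(Z, b). restrict (\<lambda>j. if j < N then (Z j + b) mod n else b) {..<Suc N}) `
        (solutions n ?B \<times> {0..<n}) \<subseteq> solutions n A"
    proof (rule image_subsetI, clarify)
      fix Z b assume Z: "Z \<in> solutions n ?B" and b: "b \<in> {0..<n}"
      let ?X = "restrict (\<lambda>j. if j < N then (Z j + b) mod n else b) {..<Suc N}"
      show "?X \<in> solutions n A"
        unfolding iff
      proof (intro conjI allI impI)
        fix i assume i: "i < N"
        have "[Z j = ?X j - ?X N] (mod n)" if "j < N" for j
          using that by (simp add: cong_def mod_diff_left_eq)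
        then show "n dvd ?s i ?X"
          using shift[OF i, of Z ?X] Z i by (simp only: iffB)
      qed (use n b in auto)
    qed
  qed
  then have "card (solutions n A) = card (solutions n ?B \<times> {0..<n})" by (rule bij_betw_same_card)
  then show ?thesis by (simp add: card_cartesian_product)
qed

section \<open>Reduction to type I\<close>

text \<open>Exactly the products of the multipliers \<open>m\<close>, \<open>m^-1\<close> and
  \<open>-1\<close> that rows may be scaled with.\<close>

definition laurent_unit :: "laurent \<Rightarrow> bool" where
  "laurent_unit f \<longleftrightarrow> (\<exists>k. f = mpow k \<or> f = - mpow k)"

lemma laurent_unit_mpow [simp]: "laurent_unit (mpow k)"
  and laurent_unit_1 [simp]: "laurent_unit 1"
  unfolding laurent_unit_def by (auto intro: exI[of _ 0])

lemma laurent_unit_mult: "laurent_unit f \<Longrightarrow> laurent_unit g \<Longrightarrow> laurent_unit (f * g)"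
proof -
  assume "laurent_unit f" "laurent_unit g"
  then obtain k l where "f = mpow k \<or> f = - mpow k" "g = mpow l \<or> g = - mpow l"
    by (auto simp: laurent_unit_def)
  then have "f * g = mpow (k + l) \<or> f * g = - mpow (k + l)" by (auto simp: mpow_add)
  then show ?thesis unfolding laurent_unit_def by blast
qed

lemma laurent_unit_inverse:
  assumes "laurent_unit f"
  obtains g where "laurent_unit g" "g * f = 1" "f * g = 1"
proof -
  from assms consider k where "f = mpow k" | k where "f = - mpow k"
    unfolding laurent_unit_def by blast
  then show ?thesis
  proof cases
    case 1
    then show ?thesis by (intro that[of "mpow (- k)"]) simp_all
  next
    case 2
    then show ?thesis by (intro that[of "- mpow (- k)"]) (auto simp: laurent_unit_def)
  qed
qed

lemma laurent_unit_divide: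
  assumes "laurent_unit g" "laurent_unit (f * g)"
  shows "laurent_unit f"
proof -
  obtain h where h: "laurent_unit h" "g * h = 1" using laurent_unit_inverse[OF assms(1)] by metis
  have "f = f * (g * h)" using h(2) by simp
  also have "\<dots> = (f * g) * h" by (simp only: mult.assoc)
  finally have e: "f = (f * g) * h" .
  show ?thesis by (subst e) (rule laurent_unit_mult[OF assms(2) h(1)])
qed

section \<open>Row operations with arbitrary Laurent polynomials as coefficients\<close>

lemma equivalent_matrix_trans:
  "equivalent_matrix B C \<Longrightarrow> equivalent_matrix A B \<Longrightarrow> equivalent_matrix A C"
  by (induction rule: equivalent_matrix.induct) (auto intro: equivalent_matrix.intros)

lemma equivalent_multrow:
  assumes "laurent_unit u" "i < dim_row B" "equivalent_matrix A B"
  shows "equivalent_matrix A (multrow i u B)"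
proof -
  have mm: "multrow i c (multrow i d C) = multrow i (c * d) C" for c d and C :: "laurent mat"
    by (rule eq_matI) (auto simp: mult.assoc)
  have neg: "equivalent_matrix A (multrow i (- 1) C)"
    if "equivalent_matrix A C" "i < dim_row C" for C
    using equivalent_matrix.mult[OF that(1,2), of "- 1"] by simp
  have pos: "equivalent_matrix A (multrow i (mpow k) B)" for k
  proof (induction k rule: int_induct[where k = 0])
    case base
    have "multrow i (mpow 0) B = B" by (rule eq_matI) auto
    then show ?case using assms(3) by simp
  next
    case (step1 k)
    have "equivalent_matrix A (multrow i (mpow 1) (multrow i (mpow k) B))"
      by (rule equivalent_matrix.mult[OF step1(2)]) (use assms(2) in auto)
    then show ?case by (simp add: mm mpow_add add.commute)
  next
    case (step2 k)
    have "equivalent_matrix A (multrow i (mpow (- 1)) (multrow i (mpow k) B))"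
      by (rule equivalent_matrix.mult[OF step2(2)]) (use assms(2) in auto)
    then show ?case by (simp add: mm mpow_add)
  qed
  obtain k where "u = mpow k \<or> u = - mpow k" using assms(1) by (auto simp: laurent_unit_def)
  moreover have "equivalent_matrix A (multrow i (- mpow k) B)"
    using neg[OF pos[of k]] assms(2) by (simp add: mm)
  ultimately show ?thesis using pos[of k] by auto
qed

text \<open>The elementary operation adds a row just once. Scaling that row by a unit before and by
  the inverse unit afterwards adds a unit multiple, and repetition adds any sum of units, which
  every Laurent polynomial is.\<close>

lemma equivalent_addrow:
  assumes ij: "i < dim_row B" "j < dim_row B" "i \<noteq> j" and e: "equivalent_matrix A B"
  shows "equivalent_matrix A (addrow f i j B)"
proof -
  define P where "P f \<longleftrightarrow> (\<forall>B. i < dim_row B \<longrightarrow> j < dim_row B \<longrightarrow> equivalent_matrix A B \<longrightarrow>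
    equivalent_matrix A (addrow f i j B))" for f
  have add: "P (f + g)" if "P f" "P g" for f g
  proof -
    have "addrow (f + g) i j B = addrow f i j (addrow g i j B)" if "j < dim_row B" for B :: "laurent mat"
      by (rule eq_matI) (use ij(3) that in \<open>auto simp: algebra_simps\<close>)
    then show ?thesis using that unfolding P_def by simp
  qed
  have unit: "P u" if u: "laurent_unit u" for u
  proof -
    obtain v where v: "laurent_unit v" "v * u = 1" using laurent_unit_inverse[OF u] by metis
    have "addrow u i j B = multrow j v (addrow 1 i j (multrow j u B))"
      if "i < dim_row B" "j < dim_row B" for B :: "laurent mat"
      by (rule eq_matI) (use ij(3) that v(2) in \<open>auto simp: mult.assoc[symmetric]\<close>)
    then show ?thesis
      unfolding P_def using ij(3) u v(1)
      by (auto intro!: equivalent_multrow equivalent_matrix.add)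
  qed
  have zero: "P 0"
  proof -
    have "addrow 0 i j B = B" for B :: "laurent mat" by (rule eq_matI) auto
    then show ?thesis by (simp add: P_def)
  qed
  have single: "P (Poly_Mapping.single k c)" for k c
  proof (induction c rule: int_induct[where k = 0])
    case base
    then show ?case using zero by simp
  next
    case (step1 c)
    have "P (Poly_Mapping.single k c + mpow k)" by (intro add step1 unit) simp
    then show ?case by (simp add: mpow_def single_add[symmetric])
  next
    case (step2 c)
    have "P (Poly_Mapping.single k c + - mpow k)"
      by (intro add step2 unit) (auto simp: laurent_unit_def)
    then show ?case by (simp add: mpow_def single_diff)
  qed
  have "P (\<Sum>k\<in>S. Poly_Mapping.single k (c k))" if "finite S" for S c
    using that by (induction S rule: finite_induct) (simp_all add: zero add single)
  then have "P f" using poly_mapping_sum_single[of f] finite_keys[of f] by metis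
  then show ?thesis using ij(1,2) e by (simp add: P_def)
qed

text \<open>Component \<open>i\<close> of the product of \<open>A\<close> with the vector
  \<open>x\<close>. Elimination is followed through its effect on a few vectors, not through
  formulas for the entries.\<close>

definition row_value :: "'a::comm_ring_1 mat \<Rightarrow> nat \<Rightarrow> (nat \<Rightarrow> 'a) \<Rightarrow> 'a" where
  "row_value A i x = (\<Sum>j<dim_col A. A $$ (i, j) * x j)"

lemma row_combination:
  assumes A: "A \<in> carrier_mat N N" and r: "r < N" and u: "laurent_unit u"
    and L: "finite L" "L \<subseteq> {..<N} - {r}"
  shows "\<exists>B. equivalent_matrix A B \<and> B \<in> carrier_mat N N \<and>
    (\<forall>i<N. i \<noteq> r \<longrightarrow> (\<forall>j<N. B $$ (i, j) = A $$ (i, j))) \<and>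
    (\<forall>j<N. B $$ (r, j) = u * A $$ (r, j) + (\<Sum>l\<in>L. y l * A $$ (l, j)))"
  using L
proof (induction L rule: finite_induct)
  case empty
  have "equivalent_matrix A (multrow r u A)"
    by (rule equivalent_multrow[OF u _ equivalent_matrix.refl]) (use A r in auto)
  then show ?case using A r by (intro exI[of _ "multrow r u A"]) auto
next
  case (insert l L)
  then obtain B where B: "equivalent_matrix A B" "B \<in> carrier_mat N N"
    "\<And>i j. i < N \<Longrightarrow> i \<noteq> r \<Longrightarrow> j < N \<Longrightarrow> B $$ (i, j) = A $$ (i, j)"
    "\<And>j. j < N \<Longrightarrow> B $$ (r, j) = u * A $$ (r, j) + (\<Sum>l\<in>L. y l * A $$ (l, j))"
    by auto
  have l: "l < N" "l \<noteq> r" using insert.prems by auto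
  have "equivalent_matrix A (addrow (y l) r l B)"
    by (rule equivalent_addrow[OF _ _ _ B(1)]) (use B(2) r l in auto)
  then show ?case using B(2-4) r l insert.hyps
    by (intro exI[of _ "addrow (y l) r l B"]) auto
qed

lemma row_value_combination:
  assumes "A \<in> carrier_mat N N" "B \<in> carrier_mat N N"
    and "\<And>j. j < N \<Longrightarrow> B $$ (r, j) = u * A $$ (r, j) + (\<Sum>l\<in>L. y l * A $$ (l, j))"
  shows "row_value B r x = u * row_value A r x + (\<Sum>l\<in>L. y l * row_value A l x)"
proof -
  have "row_value B r x = (\<Sum>j<N. u * (A $$ (r, j) * x j) + (\<Sum>l\<in>L. y l * (A $$ (l, j) * x j)))"
    unfolding row_value_def using assms(1,2)
    by (intro sum.cong) (auto simp: assms(3) algebra_simps sum_distrib_left)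
  also have "\<dots> = u * row_value A r x + (\<Sum>j<N. \<Sum>l\<in>L. y l * (A $$ (l, j) * x j))"
    unfolding row_value_def using assms(1) by (simp add: sum.distrib sum_distrib_left)
  also have "(\<Sum>j<N. \<Sum>l\<in>L. y l * (A $$ (l, j) * x j)) = (\<Sum>l\<in>L. \<Sum>j<N. y l * (A $$ (l, j) * x j))"
    by (rule sum.swap)
  also have "\<dots> = (\<Sum>l\<in>L. y l * row_value A l x)"
    unfolding row_value_def using assms(1) by (simp add: sum_distrib_left)
  finally show ?thesis .
qed

text \<open>Triangular rows with unit pivots clear the first \<open>t\<close> entries from left to
  right. The last clause makes it possible to read off entries later: a vector killed by the rows
  used does not notice the elimination.\<close>

lemma clear_row:
  assumes A: "A \<in> carrier_mat N N" and t: "t \<le> r" "r < N"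
    and tri: "\<And>i j. j < i \<Longrightarrow> i < t \<Longrightarrow> A $$ (i, j) = 0" "\<And>i. i < t \<Longrightarrow> laurent_unit (A $$ (i, i))"
  shows "\<exists>B. equivalent_matrix A B \<and> B \<in> carrier_mat N N \<and>
    (\<forall>i<N. i \<noteq> r \<longrightarrow> (\<forall>j<N. B $$ (i, j) = A $$ (i, j))) \<and> (\<forall>j<t. B $$ (r, j) = 0) \<and>
    (\<forall>x. (\<forall>i<t. row_value A i x = 0) \<longrightarrow> row_value B r x = row_value A r x)"
proof -
  have "\<exists>y. \<forall>j<t. A $$ (r, j) + (\<Sum>l<t. y l * A $$ (l, j)) = 0"
    using t(1) tri
  proof (induction t)
    case (Suc t)
    have "\<exists>y. \<forall>j<t. A $$ (r, j) + (\<Sum>l<t. y l * A $$ (l, j)) = 0"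
      by (rule Suc.IH) (use Suc.prems in auto)
    then obtain y where y: "\<And>j. j < t \<Longrightarrow> A $$ (r, j) + (\<Sum>l<t. y l * A $$ (l, j)) = 0" by blast
    obtain v where v: "v * A $$ (t, t) = 1" using laurent_unit_inverse Suc.prems(3)[of t] by blast
    let ?e = "A $$ (r, t) + (\<Sum>l<t. y l * A $$ (l, t))"
    \<comment> \<open>The new coefficient cancels what is left in column \<open>t\<close>; earlier
      columns are not disturbed, because row \<open>t\<close> vanishes there.\<close>
    let ?z = "y(t := - ?e * v)"
    have s: "(\<Sum>l<t. ?z l * A $$ (l, j)) = (\<Sum>l<t. y l * A $$ (l, j))" for j
      by (rule sum.cong) auto
    have "A $$ (r, j) + (\<Sum>l<Suc t. ?z l * A $$ (l, j)) = 0" if "j < Suc t" for j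
    proof (cases "j = t")
      case True
      have *: "?z t * A $$ (t, t) = - ?e" using v by (simp only: fun_upd_same mult.assoc mult_1_right)
      show ?thesis unfolding True sum.lessThan_Suc s * by simp
    next
      case False
      then show ?thesis using that y[of j] Suc.prems(2)[of j t] unfolding sum.lessThan_Suc s by simp
    qed
    then show ?case by blast
  qed simp
  then obtain y where y: "\<And>j. j < t \<Longrightarrow> A $$ (r, j) + (\<Sum>l<t. y l * A $$ (l, j)) = 0" by blast
  have L: "finite {..<t}" "{..<t} \<subseteq> {..<N} - {r}" using t by auto
  obtain B where B: "equivalent_matrix A B" "B \<in> carrier_mat N N"
    "\<And>i j. i < N \<Longrightarrow> i \<noteq> r \<Longrightarrow> j < N \<Longrightarrow> B $$ (i, j) = A $$ (i, j)"
    "\<And>j. j < N \<Longrightarrow> B $$ (r, j) = 1 * A $$ (r, j) + (\<Sum>l\<in>{..<t}. y l * A $$ (l, j))"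
    using row_combination[OF A t(2) laurent_unit_1 L, of y] by blast
  have "row_value B r x = row_value A r x" if "\<forall>i<t. row_value A i x = 0" for x
    using row_value_combination[OF A B(2,4)] that by simp
  then show ?thesis using B y t by (intro exI[of _ B]) auto
qed

lemma scale_rows:
  assumes A: "A \<in> carrier_mat N N" and u: "\<And>i. i < N \<Longrightarrow> laurent_unit (u i)"
  shows "equivalent_matrix A (mat N N (\<lambda>(i, j). u i * A $$ (i, j)))"
proof -
  have "t \<le> N \<Longrightarrow> equivalent_matrix A (mat N N (\<lambda>(i, j). (if i < t then u i else 1) * A $$ (i, j)))" for t
  proof (induction t)
    case 0
    have "mat N N (\<lambda>(i, j). (if i < 0 then u i else 1) * A $$ (i, j)) = A"
      by (rule eq_matI) (use A in auto)
    then show ?case by (simp only: equivalent_matrix.refl)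
  next
    case (Suc t)
    let ?B = "mat N N (\<lambda>(i, j). (if i < t then u i else 1) * A $$ (i, j))"
    have "equivalent_matrix A (multrow t (u t) ?B)"
      by (rule equivalent_multrow) (use u Suc in auto)
    moreover have "multrow t (u t) ?B = mat N N (\<lambda>(i, j). (if i < Suc t then u i else 1) * A $$ (i, j))"
      by (rule eq_matI) (auto simp: less_Suc_eq)
    ultimately show ?case by simp
  qed
  from this[of N] have "equivalent_matrix A (mat N N (\<lambda>(i, j). (if i < N then u i else 1) * A $$ (i, j)))"
    by simp
  moreover have "mat N N (\<lambda>(i, j). (if i < N then u i else 1) * A $$ (i, j)) = mat N N (\<lambda>(i, j). u i * A $$ (i, j))"
    by (rule eq_matI) auto
  ultimately show ?thesis by simp
qed

text \<open>
  The first \<open>N - 3\<close> rows have unit pivots. The vectors \<open>x\<close> and \<open>z\<close>, annihilated by these rows, read off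
  the remaining entries of the rows \<open>N - 3\<close> and \<open>N - 2\<close> after elimination, of which the former is first
  replaced by a combination of both that gets a unit pivot.
\<close>

theorem type_I_certificate:
  fixes A :: "laurent mat"
  assumes A: "A \<in> carrier_mat (M + 3) (M + 3)"
    and null: "\<And>j. j < M + 3 \<Longrightarrow> (\<Sum>i<M + 3. u i * A $$ (i, j)) = 0" "laurent_unit (u (M + 2))"
    and ones: "\<And>i. i < M + 3 \<Longrightarrow> row_value A i (\<lambda>_. 1) = 0"
    and tri: "\<And>i j. j < i \<Longrightarrow> i < M \<Longrightarrow> A $$ (i, j) = 0" "\<And>i. i < M \<Longrightarrow> laurent_unit (A $$ (i, i))"
    and g: "laurent_unit g"
    and x: "\<And>i. i < M \<Longrightarrow> row_value A i x = 0" "laurent_unit (x M)" "x (M + 1) = 0" "x (M + 2) = 0"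
      "laurent_unit (g * row_value A M x + f * row_value A (M + 1) x)"
    and z: "\<And>i. i < M \<Longrightarrow> row_value A i z = 0" "laurent_unit (z (M + 1))" "z (M + 2) = 0"
      "g * row_value A M z + f * row_value A (M + 1) z = 0"
  obtains B v where "equivalent_matrix A B" "type_I B" "B \<in> carrier_mat (M + 3) (M + 3)"
    "laurent_unit v" "B $$ (M + 1, M + 1) = v * row_value A (M + 1) z"
proof -
  let ?N = "M + 3"
  have rv: "row_value B i y = (\<Sum>j<?N. B $$ (i, j) * y j)"
    if "B \<in> carrier_mat ?N ?N" for B :: "laurent mat" and i y
    using that by (simp add: row_value_def)
  have rv_cong: "row_value B i y = row_value C i y"
    if "B \<in> carrier_mat ?N ?N" "C \<in> carrier_mat ?N ?N" "\<And>j. j < ?N \<Longrightarrow> B $$ (i, j) = C $$ (i, j)"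
    for B C :: "laurent mat" and i y
    unfolding rv[OF that(1)] rv[OF that(2)] by (rule sum.cong) (use that(3) in auto)
  have "finite {..<M + 2}" "{..<M + 2} \<subseteq> {..<?N} - {M + 2}" "M + 2 < ?N" by auto
  \<comment> \<open>The relation between the rows has a unit coefficient at the last row, which can
    thus be replaced by the relation itself, that is, by zero.\<close>
  from row_combination[OF A this(3) null(2) this(1,2), of u]
  obtain B0 where B0: "equivalent_matrix A B0" "B0 \<in> carrier_mat ?N ?N"
    "\<And>i j. i < ?N \<Longrightarrow> i \<noteq> M + 2 \<Longrightarrow> j < ?N \<Longrightarrow> B0 $$ (i, j) = A $$ (i, j)"
    "\<And>j. j < ?N \<Longrightarrow> B0 $$ (M + 2, j) = u (M + 2) * A $$ (M + 2, j) + (\<Sum>l\<in>{..<M + 2}. u l * A $$ (l, j))"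
    by blast
  have B0z: "B0 $$ (M + 2, j) = 0" if "j < ?N" for j
  proof -
    have "?N = Suc (M + 2)" by simp
    then have "(\<Sum>i<M + 2. u i * A $$ (i, j)) + u (M + 2) * A $$ (M + 2, j) = 0"
      using null(1)[OF that] by (simp only: sum.lessThan_Suc)
    then show ?thesis unfolding B0(4)[OF that] by (simp only: add.commute)
  qed
  have "finite {M + 1}" "{M + 1} \<subseteq> {..<?N} - {M}" "M < ?N" by auto
  from row_combination[OF B0(2) this(3) g this(1,2), of "\<lambda>_. f"]
  obtain B1 where B1: "equivalent_matrix B0 B1" "B1 \<in> carrier_mat ?N ?N"
    "\<And>i j. i < ?N \<Longrightarrow> i \<noteq> M \<Longrightarrow> j < ?N \<Longrightarrow> B1 $$ (i, j) = B0 $$ (i, j)"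
    "\<And>j. j < ?N \<Longrightarrow> B1 $$ (M, j) = g * B0 $$ (M, j) + (\<Sum>l\<in>{M + 1}. f * B0 $$ (l, j))"
    by blast
  have rB0: "row_value B0 i y = row_value A i y" if "i < M + 2" for i y
    by (rule rv_cong[OF B0(2) A]) (use B0(3) that in auto)
  have rB1: "row_value B1 i y = row_value A i y" if "i < M + 2" "i \<noteq> M" for i y
    using rv_cong[OF B1(2) B0(2), of i y] B1(3) that rB0 by auto
  have rB1M: "row_value B1 M y = g * row_value A M y + f * row_value A (M + 1) y" for y
    using row_value_combination[OF B0(2) B1(2,4)] rB0 by simp
  have tri1: "B1 $$ (i, j) = A $$ (i, j)" if "i < M" "j < ?N" for i j
    using B1(3) B0(3) that by simp
  have "\<exists>B. equivalent_matrix B1 B \<and> B \<in> carrier_mat ?N ?N \<and>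
    (\<forall>i<?N. i \<noteq> M \<longrightarrow> (\<forall>j<?N. B $$ (i, j) = B1 $$ (i, j))) \<and> (\<forall>j<M. B $$ (M, j) = 0) \<and>
    (\<forall>x. (\<forall>i<M. row_value B1 i x = 0) \<longrightarrow> row_value B M x = row_value B1 M x)"
    by (rule clear_row[OF B1(2)]) (use tri tri1 in auto)
  then obtain B2 where B2: "equivalent_matrix B1 B2" "B2 \<in> carrier_mat ?N ?N"
    "\<And>i j. i < ?N \<Longrightarrow> i \<noteq> M \<Longrightarrow> j < ?N \<Longrightarrow> B2 $$ (i, j) = B1 $$ (i, j)" "\<And>j. j < M \<Longrightarrow> B2 $$ (M, j) = 0"
    "\<And>y. (\<forall>i<M. row_value B1 i y = 0) \<Longrightarrow> row_value B2 M y = row_value B1 M y"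
    by blast
  have rB2: "row_value B2 i y = row_value A i y" if "i < M + 2" "i \<noteq> M" for i y
    using rv_cong[OF B2(2) B1(2), of i y] B2(3) that rB1 by auto
  have rB2M: "row_value B2 M y = g * row_value A M y + f * row_value A (M + 1) y"
    if "\<And>i. i < M \<Longrightarrow> row_value A i y = 0" for y
    using B2(5)[of y] rB1 rB1M that by simp
  \<comment> \<open>The row is cleared to the left of the diagonal and \<open>x\<close> vanishes to
    the right of it. The value at \<open>x\<close>, a unit, is therefore the pivot times the unit
    \<open>x M\<close>.\<close>
  have "row_value B2 M x = (\<Sum>j<M. B2 $$ (M, j) * x j) + B2 $$ (M, M) * x M
      + B2 $$ (M, M + 1) * x (M + 1) + B2 $$ (M, M + 2) * x (M + 2)"
    unfolding rv[OF B2(2)] by (simp add: numeral_3_eq_3 numeral_2_eq_2)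
  then have "row_value B2 M x = B2 $$ (M, M) * x M" using B2(4) x(3,4) by simp
  then have unitM: "laurent_unit (B2 $$ (M, M))"
    using x(5) rB2M[OF x(1)] laurent_unit_divide[OF x(2)] by simp
  have tri2: "B2 $$ (i, j) = 0" if "j < i" "i < M + 1" for i j
    using that tri(1) tri1 B2(3,4) by (cases "i = M") auto
  have unit2: "laurent_unit (B2 $$ (i, i))" if "i < M + 1" for i
    using that unitM tri(2) tri1 B2(3) by (cases "i = M") auto
  have "\<exists>B. equivalent_matrix B2 B \<and> B \<in> carrier_mat ?N ?N \<and>
    (\<forall>i<?N. i \<noteq> M + 1 \<longrightarrow> (\<forall>j<?N. B $$ (i, j) = B2 $$ (i, j))) \<and> (\<forall>j<M + 1. B $$ (M + 1, j) = 0) \<and>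
    (\<forall>x. (\<forall>i<M + 1. row_value B2 i x = 0) \<longrightarrow> row_value B (M + 1) x = row_value B2 (M + 1) x)"
    by (rule clear_row[OF B2(2)]) (use tri2 unit2 in auto)
  then obtain B3 where B3: "equivalent_matrix B2 B3" "B3 \<in> carrier_mat ?N ?N"
    "\<And>i j. i < ?N \<Longrightarrow> i \<noteq> M + 1 \<Longrightarrow> j < ?N \<Longrightarrow> B3 $$ (i, j) = B2 $$ (i, j)" "\<And>j. j < M + 1 \<Longrightarrow> B3 $$ (M + 1, j) = 0"
    "\<And>y. (\<forall>i<M + 1. row_value B2 i y = 0) \<Longrightarrow> row_value B3 (M + 1) y = row_value B2 (M + 1) y"
    by blast
  have r3: "row_value B3 (M + 1) y = B3 $$ (M + 1, M + 1) * y (M + 1) + B3 $$ (M + 1, M + 2) * y (M + 2)" for y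
  proof -
    have "row_value B3 (M + 1) y = (\<Sum>j<M + 1. B3 $$ (M + 1, j) * y j)
      + B3 $$ (M + 1, M + 1) * y (M + 1) + B3 $$ (M + 1, M + 2) * y (M + 2)"
      unfolding rv[OF B3(2)] by (simp add: numeral_3_eq_3 numeral_2_eq_2)
    then show ?thesis using B3(4) by simp
  qed
  have r3A: "row_value B3 (M + 1) y = row_value A (M + 1) y"
    if "\<And>i. i < M \<Longrightarrow> row_value A i y = 0" "g * row_value A M y + f * row_value A (M + 1) y = 0" for y
  proof -
    have "row_value B2 i y = 0" if "i < M + 1" for i
      using rB2[of i y] rB2M[of y] that \<open>\<And>i. i < M \<Longrightarrow> row_value A i y = 0\<close>
        \<open>g * row_value A M y + f * row_value A (M + 1) y = 0\<close> by (cases "i = M") auto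
    then show ?thesis using B3(5)[of y] rB2[of "M + 1" y] by simp
  qed
  obtain v where v: "laurent_unit v" "z (M + 1) * v = 1" using laurent_unit_inverse[OF z(2)] by metis
  \<comment> \<open>The same reading with \<open>z\<close>, which the replaced row \<open>M\<close>
    annihilates as well, yields the entry \<alpha> up to a unit.\<close>
  have "B3 $$ (M + 1, M + 1) * z (M + 1) = row_value A (M + 1) z"
    using r3[of z] r3A[OF z(1) z(4)] z(3) by simp
  then have "B3 $$ (M + 1, M + 1) * (z (M + 1) * v) = row_value A (M + 1) z * v"
    by (simp only: mult.assoc[symmetric])
  then have alpha: "B3 $$ (M + 1, M + 1) = v * row_value A (M + 1) z"
    unfolding v(2) by (simp add: mult.commute)
  \<comment> \<open>The constant vector is the trivial colouring. It is annihilated by all rows of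
    \<open>A\<close> and remains so here, which makes the last entry of the row minus its
    pivot.\<close>
  have "row_value B3 (M + 1) (\<lambda>_. 1) = 0"
    using r3A[of "\<lambda>_. 1"] ones by simp
  then have last: "B3 $$ (M + 1, M + 2) = - B3 $$ (M + 1, M + 1)"
    using r3[of "\<lambda>_. 1"] by (simp add: eq_neg_iff_add_eq_0 add.commute)
  have unit3: "laurent_unit (B3 $$ (i, i))" if "i < M + 1" for i
    using unit2[OF that] B3(3)[of i i] that by simp
  have "\<forall>i. \<exists>c. laurent_unit c \<and> (i < M + 1 \<longrightarrow> c * B3 $$ (i, i) = 1) \<and> (\<not> i < M + 1 \<longrightarrow> c = 1)"
    using unit3 laurent_unit_inverse laurent_unit_1 by metis
  then obtain c where c: "\<And>i. laurent_unit (c i)" "\<And>i. i < M + 1 \<Longrightarrow> c i * B3 $$ (i, i) = 1"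
    "\<And>i. \<not> i < M + 1 \<Longrightarrow> c i = 1"
    by metis
  define B4 where "B4 = mat ?N ?N (\<lambda>(i, j). c i * B3 $$ (i, j))"
  have e4: "equivalent_matrix B3 B4" unfolding B4_def by (rule scale_rows[OF B3(2) c(1)])
  have B4: "B4 $$ (i, j) = c i * B3 $$ (i, j)" if "i < ?N" "j < ?N" for i j
    using that by (simp add: B4_def)
  have zero: "B3 $$ (i, j) = 0" if ji: "j < i" "i < ?N" for i j
  proof -
    from ji consider "i < M + 1" | "i = M + 1" | "i = M + 2" by linarith
    then show ?thesis
    proof cases
      case 1
      then show ?thesis using B3(3)[of i j] tri2[of j i] ji by simp
    next
      case 2
      then show ?thesis using B3(4) ji by simp
    next
      case 3
      then show ?thesis using B3(3)[of i j] B2(3)[of i j] B1(3)[of i j] B0z[of j] ji by simp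
    qed
  qed
  have lastz: "B3 $$ (M + 2, M + 2) = 0"
    using B3(3)[of "M + 2" "M + 2"] B2(3)[of "M + 2" "M + 2"] B1(3)[of "M + 2" "M + 2"] B0z[of "M + 2"] by simp
  have "type_I B4"
    unfolding type_I_def
  proof (intro exI[of _ ?N] exI[of _ "B3 $$ (M + 1, M + 1)"] conjI allI impI)
    show "upper_triangular B4" using zero B4 by (auto simp: B4_def upper_triangular_def)
  qed (use B4 c last lastz in \<open>auto simp: B4_def\<close>)
  moreover have "equivalent_matrix A B4"
    using B0(1) B1(1) B2(1) B3(1) e4 equivalent_matrix_trans by metis
  ultimately show ?thesis
    using that[of B4 v] v(1) alpha B4[of "M + 1" "M + 1"] c(3) by (simp add: B4_def)
qed

section \<open>Colouring numbers from matrices\<close>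

lemma sum_sparse_row:
  fixes a b c :: "'a::comm_ring_1" and u v k N :: nat
  assumes "u < N" "v < N" "k < N"
  shows "(\<Sum>j<N. ((if j = u then a else 0) + (if j = v then b else 0) - (if j = k then c else 0)) * X j) =
    a * X u + b * X v - c * X k"
proof -
  have "(\<Sum>j<N. ((if j = u then a else 0) + (if j = v then b else 0) - (if j = k then c else 0)) * X j) =
      (\<Sum>j<N. (if j = u then a * X j else 0) + (if j = v then b * X j else 0) - (if j = k then c * X j else 0))"
    by (rule sum.cong) (auto simp: algebra_simps)
  also have "\<dots> = a * X u + b * X v - c * X k"
    using assms by (simp add: sum.distrib sum_subtractf)
  finally show ?thesis .
qed

abbreviation eval_matrix :: "int \<Rightarrow> int \<Rightarrow> laurent mat \<Rightarrow> int mat" where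
  "eval_matrix n m \<equiv> map_mat (eval_mod n m)"

lemma colouring_matrix_carrier: "colouring_matrix w \<in> carrier_mat (crossings w) (crossings w)"
  by (simp add: colouring_matrix_def)

lemma eval_colouring_row:
  assumes v: "valid_word w" and k: "k < crossings w"
  shows "(\<Sum>j<crossings w. eval_mod n m (colouring_matrix w $$ (k, j)) * X j) =
    (let c = if is_positive w k then m else modular_inverse n m in
      c * X (under_arc w k) + (1 - c) * X (over_arc w k) - X k)"
proof -
  let ?c = "if is_positive w k then m else modular_inverse n m"
  have "eval_mod n m (colouring_matrix w $$ (k, j)) = (if j = under_arc w k then ?c else 0)
      + (if j = over_arc w k then 1 - ?c else 0) - (if j = k then 1 else 0)" if "j < crossings w" for j
    unfolding colouring_matrix_index[OF k that] Let_def
    by (simp add: eval_mod_add eval_mod_diff eval_mod_mpow power_mod_def)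
  then have "(\<Sum>j<crossings w. eval_mod n m (colouring_matrix w $$ (k, j)) * X j) =
      (\<Sum>j<crossings w. ((if j = under_arc w k then ?c else 0)
      + (if j = over_arc w k then 1 - ?c else 0) - (if j = k then 1 else 0)) * X j)"
    by (intro sum.cong) auto
  also have "\<dots> = ?c * X (under_arc w k) + (1 - ?c) * X (over_arc w k) - 1 * X k"
    by (rule sum_sparse_row[OF under_arc_less[OF v k] over_arc_less[OF v k] k])
  finally show ?thesis by (simp add: Let_def)
qed

lemma colourings_solutions:
  assumes v: "valid_word w" and n: "n \<ge> 1"
  shows "colourings n m w = solutions n (eval_matrix n m (colouring_matrix w))"
proof (rule Set.set_eqI)
  fix X
  let ?C = "eval_matrix n m (colouring_matrix w)"
  have d: "dim_row ?C = crossings w" "dim_col ?C = crossings w"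
    using colouring_matrix_carrier[of w] by auto
  have row: "X k = linear_op n m (is_positive w k) (X (under_arc w k)) (X (over_arc w k)) \<longleftrightarrow>
      n dvd (\<Sum>j<crossings w. ?C $$ (k, j) * X j)"
    if X: "X \<in> {..<crossings w} \<rightarrow>\<^sub>E {0..<n}" and k: "k < crossings w" for k
  proof -
    let ?c = "if is_positive w k then m else modular_inverse n m"
    let ?y = "?c * X (under_arc w k) + (1 - ?c) * X (over_arc w k)"
    have "(\<Sum>j<crossings w. ?C $$ (k, j) * X j) =
        (\<Sum>j<crossings w. eval_mod n m (colouring_matrix w $$ (k, j)) * X j)"
      by (rule sum.cong) (use k colouring_matrix_carrier[of w] in auto)
    then have s: "(\<Sum>j<crossings w. ?C $$ (k, j) * X j) = ?y - X k"
      by (simp only: eval_colouring_row[OF v k] Let_def)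
    have "X k \<in> {0..<n}" by (rule PiE_mem[OF X]) (simp add: k)
    then have m: "X k mod n = X k" by simp
    show ?thesis
      unfolding s linear_op_eq Let_def mod_eq_dvd_iff[symmetric] m by (rule eq_commute)
  qed
  have "X \<in> solutions n ?C \<longleftrightarrow> X \<in> {..<crossings w} \<rightarrow>\<^sub>E {0..<n} \<and>
      (\<forall>k<crossings w. n dvd (\<Sum>j<crossings w. ?C $$ (k, j) * X j))"
    by (simp only: solutions_def d mem_Collect_eq)
  then show "X \<in> colourings n m w \<longleftrightarrow> X \<in> solutions n ?C"
    unfolding colourings_iff
    by (simp only:) (intro conj_cong HOL.refl all_cong1 imp_cong row)
qed

lemma colouring_matrices_solutions:
  assumes A: "A \<in> colouring_matrices w"
  shows "card (solutions n (eval_matrix n m A)) = card (solutions n (eval_matrix n m (colouring_matrix w)))"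
proof -
  let ?N = "crossings w" and ?C = "eval_matrix n m (colouring_matrix w)"
  obtain \<rho> \<sigma> where p: "\<rho> permutes {..<?N}" "\<sigma> permutes {..<?N}"
    and A: "A = mat ?N ?N (\<lambda>(i, j). colouring_matrix w $$ (\<rho> i, \<sigma> j))"
    using A unfolding colouring_matrices_def mem_Collect_eq by (elim exE conjE) (rule that)
  have d: "dim_row ?C = ?N" "dim_col ?C = ?N" using colouring_matrix_carrier[of w] by auto
  have less: "\<rho> i < ?N" "\<sigma> i < ?N" if "i < ?N" for i
    using permutes_in_image[OF p(1), of i] permutes_in_image[OF p(2), of i] that by simp_all
  let ?D = "mat (dim_row ?C) (dim_col ?C) (\<lambda>(i, j). ?C $$ (\<rho> i, j))"
  have e: "eval_matrix n m A = mat (dim_row ?D) (dim_col ?D) (\<lambda>(i, j). ?D $$ (i, \<sigma> j))"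
    by (rule eq_matI) (use less colouring_matrix_carrier[of w] in \<open>auto simp: A d\<close>)
  have "card (solutions n (eval_matrix n m A)) = card (solutions n ?D)"
    unfolding e by (rule card_solutions_permute_columns) (use p d in simp)
  moreover have "solutions n ?D = solutions n ?C"
    by (rule solutions_permute_rows) (use p d in simp)
  ultimately show ?thesis by (simp only:)
qed

text \<open>Row operations keep the solution set, but column swaps rename the unknowns, so only the
  number of solutions is preserved.\<close>

lemma equivalent_matrix_solutions:
  assumes "equivalent_matrix A B" "coprime m n"
  shows "card (solutions n (eval_matrix n m B)) = card (solutions n (eval_matrix n m A))"
  using assms(1)
proof (induction rule: equivalent_matrix.induct)
  case (mult B i c)
  have c: "coprime (eval_mod n m c) n"
    using mult.hyps(3) coprime_power_mod[OF assms(2)]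
    by (auto simp: eval_mod_mpow eval_mod_uminus)
  have "solutions n (eval_matrix n m (multrow i c B)) = solutions n (eval_matrix n m B)"
  proof (rule solutions_scale_rows[where c = "\<lambda>k. if k = i then eval_mod n m c else 1"])
    fix k l assume "k < dim_row (eval_matrix n m B)" "l < dim_col (eval_matrix n m B)"
    then show "[eval_matrix n m (multrow i c B) $$ (k, l) =
        (if k = i then eval_mod n m c else 1) * eval_matrix n m B $$ (k, l)] (mod n)"
      using eval_mod_mult[OF assms(2)] by simp
  qed (use c in auto)
  then show ?case using mult.IH by simp
next
  case (add B i j)
  have "eval_matrix n m (addrow 1 i j B) = addrow 1 i j (eval_matrix n m B)"
    by (rule eq_matI) (use add.hyps in \<open>auto simp: eval_mod_add\<close>)
  then show ?case using add by (simp add: solutions_addrow)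
next
  case (swap_rows B i j)
  have "eval_matrix n m (swaprows i j B) = swaprows i j (eval_matrix n m B)"
    by (rule eq_matI) (use swap_rows.hyps in auto)
  then show ?case using swap_rows by (simp add: solutions_swaprows)
next
  case (swap_cols B i j)
  let ?B = "eval_matrix n m B"
  have "eval_matrix n m (swapcols i j B) =
      mat (dim_row ?B) (dim_col ?B) (\<lambda>(k, l). ?B $$ (k, Transposition.transpose i j l))"
    by (rule eq_matI) (use swap_cols.hyps in \<open>auto simp: Transposition.transpose_def\<close>)
  moreover have "Transposition.transpose i j permutes {..<dim_col ?B}"
    by (rule permutes_swap_id) (use swap_cols.hyps in auto)
  ultimately show ?case using swap_cols.IH card_solutions_permute_columns by metis
qed simp

definition colour_count :: "gauss_word \<Rightarrow> int poly \<Rightarrow> bool" where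
  "colour_count w p \<longleftrightarrow> (\<forall>n m. n \<ge> 1 \<longrightarrow> coprime m n \<longrightarrow>
     colouring_number n m w = nat n * nat (gcd (poly p m) n))"

theorem type_I_colour_count:
  assumes v: "valid_word w" and A: "A \<in> colouring_matrices w" and e: "equivalent_matrix A B"
    and t: "type_I B" "B \<in> carrier_mat (M + 2) (M + 2)"
    and u: "laurent_unit u" "B $$ (M, M) = u * laurent_of_poly p"
  shows "colour_count w p"
  unfolding colour_count_def
proof (intro allI impI)
  fix n m :: int assume n: "n \<ge> 1" and c: "coprime m n"
  obtain N \<alpha> where B: "2 \<le> N" "B \<in> carrier_mat N N" "upper_triangular B"
    "\<And>i. i < N - 2 \<Longrightarrow> B $$ (i, i) = 1" "B $$ (N - 2, N - 2) = \<alpha>" "B $$ (N - 2, N - 1) = - \<alpha>"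
    "B $$ (N - 1, N - 1) = 0"
    using t(1) unfolding type_I_def by blast
  have N: "N = M + 2" using B(2) t(2) by auto
  let ?B = "eval_matrix n m B" and ?a = "eval_mod n m \<alpha>"
  have "card (solutions n ?B) = nat n * nat (gcd ?a n)"
  proof (rule card_solutions_type_I[OF n, where k = M])
    show "?B $$ (i, j) = 0" if "j < i" "i < M + 2" for i j
      using upper_triangularD[OF B(3), of j i] t(2) that by auto
  qed (use B t(2) in \<open>auto simp: N eval_mod_uminus\<close>)
  moreover have "colouring_number n m w = card (solutions n ?B)"
    using equivalent_matrix_solutions[OF e c] colouring_matrices_solutions[OF A]
      colourings_solutions[OF v n] by (simp add: colouring_number_def)
  moreover have "gcd ?a n = gcd (poly p m) n"
  proof -
    have au: "coprime (eval_mod n m u) n"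
      using u(1) coprime_power_mod[OF c] by (auto simp: laurent_unit_def eval_mod_mpow eval_mod_uminus)
    have "\<alpha> = u * laurent_of_poly p" using B(5) u(2) by (simp add: N)
    then have "[?a = eval_mod n m u * poly p m] (mod n)"
      using eval_mod_mult[OF c, of u "laurent_of_poly p"] by (simp add: eval_mod_laurent_of_poly)
    then have "gcd ?a n = gcd (eval_mod n m u * poly p m) n" by (rule cong_gcd_eq)
    also have "\<dots> = gcd (poly p m) n"
      by (rule gcd_mult_left_left_cancel) (use au in \<open>simp add: coprime_commute\<close>)
    finally show ?thesis .
  qed
  ultimately show "colouring_number n m w = nat n * nat (gcd (poly p m) n)" by simp
qed

section \<open>The Alexander polynomial from the colouring numbers\<close>




lemma prime_gt:
  fixes b :: int
  obtains q :: int where "prime q" "q > b"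
proof -
  obtain p :: nat where "prime p" "nat b < p" using bigger_prime by blast
  then show ?thesis using that[of "int p"] by auto
qed

text \<open>The value at \<open>q\<close> is congruent to the constant term modulo \<open>q\<close>,
  and the latter is too small to be a multiple of \<open>q\<close>.\<close>

lemma poly_not_dvd_prime:
  fixes p :: "int poly"
  assumes "prime q" "q > \<bar>poly p 0\<bar>" "poly p 0 \<noteq> 0"
  shows "\<not> q dvd poly p q"
proof
  assume "q dvd poly p q"
  moreover obtain a r where p: "p = pCons a r" by (cases p)
  ultimately have "q dvd a" by (simp add: dvd_add_left_iff)
  then have "q dvd poly p 0" by (simp add: p)
  then show False using zdvd_imp_le[of q "\<bar>poly p 0\<bar>"] assms by auto
qed

text \<open>The sign may vary with \<open>q\<close>; the product \<open>(g - p) * (g + p)\<close>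
  has infinitely many zeros in any case, so one factor is zero.\<close>

lemma poly_eq_if_abs_eq:
  fixes p g :: "int poly"
  assumes "\<And>q. prime q \<Longrightarrow> q > b \<Longrightarrow> \<bar>poly g q\<bar> = \<bar>poly p q\<bar>"
  shows "g = p \<or> g = - p"
proof (rule ccontr)
  assume "\<not> ?thesis"
  then have "g - p \<noteq> 0" "g + p \<noteq> 0" by (auto simp: eq_neg_iff_add_eq_0)
  then have fin: "finite {x. poly ((g - p) * (g + p)) x = 0}" by (intro poly_roots_finite) simp
  obtain q where q: "prime q" "q > Max (insert b {x. poly ((g - p) * (g + p)) x = 0})"
    using prime_gt by blast
  have "q > b" using q(2) fin by simp
  then have "poly g q = poly p q \<or> poly g q = - poly p q" using assms[OF q(1)] by linarith
  then have "poly ((g - p) * (g + p)) q = 0" by auto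
  then have "q \<le> Max (insert b {x. poly ((g - p) * (g + p)) x = 0})" using fin by (intro Max_ge) auto
  then show False using q(2) by simp
qed

theorem determinant_from_solutions:
  fixes P :: "int poly mat" and p :: "int poly"
  assumes P: "P \<in> carrier_mat N N" and p0: "coeff p 0 > 0"
    and count: "\<And>n q. n \<ge> 1 \<Longrightarrow> coprime q n \<Longrightarrow>
      card (solutions n (map_mat (\<lambda>f. poly f q) P)) = nat (gcd (poly p q) n)"
  obtains j g where "det P = [:0, 1:] ^ j * g" "g = p \<or> g = - p"
proof -
  have hom: "det (map_mat (\<lambda>f. poly f q) P) = poly (det P) q" for q :: int
  proof -
    interpret comm_ring_hom "\<lambda>f. poly f q" by unfold_locales auto
    show ?thesis by (rule hom_det)
  qed
  have Pq: "map_mat (\<lambda>f. poly f q) P \<in> carrier_mat N N" for q :: int using P by simp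
  have p0': "poly p 0 \<noteq> 0" using p0 by (simp add: poly_0_coeff_0)
  \<comment> \<open>A zero determinant would give an integer kernel vector at some prime
    \<open>q\<close>. Modulo a prime \<open>n\<close> larger than its entry \<open>v $ l\<close> it
    stays nonzero, while for \<open>n\<close> coprime to the value of \<open>p\<close> at
    \<open>q\<close> the count admits the zero solution only.\<close>
  have "det P \<noteq> 0"
  proof
    assume "det P = 0"
    obtain q :: int where q: "prime q" "q > \<bar>poly p 0\<bar>" using prime_gt by blast
    have pq: "poly p q \<noteq> 0" using poly_not_dvd_prime[OF q p0'] by auto
    have "det (map_mat (\<lambda>f. poly f q) P) = 0" using hom \<open>det P = 0\<close> by simp
    then obtain v where v: "v \<in> carrier_vec N" "v \<noteq> 0\<^sub>v N" "map_mat (\<lambda>f. poly f q) P *\<^sub>v v = 0\<^sub>v N"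
      using det_0_iff_vec_prod_zero[OF Pq] by blast
    obtain l where l: "l < N" "v $ l \<noteq> 0" using v(1,2) by (metis carrier_vecD eq_vecI index_zero_vec)
    obtain n :: int where n: "prime n" "n > \<bar>poly p q\<bar> + \<bar>v $ l\<bar> + q" using prime_gt by blast
    have qpos: "q > 0" using q(1) prime_gt_0_int by blast
    have n1: "n \<ge> 1" using n(2) qpos by linarith
    have small: "coprime x n" if "x \<noteq> 0" "\<bar>x\<bar> < n" for x
    proof -
      have "\<not> n dvd x" using that zdvd_imp_le[of n "\<bar>x\<bar>"] by auto
      then have "coprime n x" by (rule prime_imp_coprime[OF n(1)])
      then show ?thesis by (rule coprime_commute[THEN iffD1])
    qed
    let ?A = "map_mat (\<lambda>f. poly f q) P"
    have "gcd (poly p q) n = 1" using small[OF pq] n(2) qpos by simp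
    then have c1: "card (solutions n ?A) = 1"
      using count[OF n1 small[of q]] n(2) qpos by simp
    have "restrict (\<lambda>_. 0) {..<N} \<in> solutions n ?A"
      using n1 P by (auto simp: solutions_def)
    moreover have "restrict (\<lambda>j. v $ j mod n) {..<N} \<in> solutions n ?A"
    proof -
      have "n dvd (\<Sum>j<N. ?A $$ (i, j) * (v $ j mod n))" if i: "i < N" for i
      proof -
        have "[(\<Sum>j<N. ?A $$ (i, j) * (v $ j mod n)) = (\<Sum>j<N. ?A $$ (i, j) * v $ j)] (mod n)"
          by (intro cong_sum cong_mult cong_refl) (simp add: cong_def)
        moreover have "(\<Sum>j<N. ?A $$ (i, j) * v $ j) = (?A *\<^sub>v v) $ i"
          using i v(1) Pq[of q] by (auto simp: scalar_prod_def lessThan_atLeast0 intro!: sum.cong)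
        ultimately show ?thesis using v(3) i by (simp add: cong_0_iff)
      qed
      then show ?thesis using n1 P by (auto simp: solutions_def)
    qed
    ultimately have "restrict (\<lambda>_. 0) {..<N} = restrict (\<lambda>j. v $ j mod n) {..<N}"
      using c1 by (metis card_1_singletonE singletonD)
    then have "v $ l mod n = 0" using l(1) by (metis lessThan_iff restrict_apply')
    then have "n dvd v $ l" by (simp add: dvd_eq_mod_eq_0)
    then show False using zdvd_imp_le[of n "\<bar>v $ l\<bar>"] l(2) n(2) qpos by auto
  qed
  \<comment> \<open>With the power of the variable split off, \<open>g\<close> has nonzero constant
    term, so a large prime \<open>q\<close> does not divide the value of \<open>g\<close> at
    \<open>q\<close>.\<close>
  then obtain g where "det P = [:- 0, 1:] ^ order 0 (det P) * g" "\<not> [:- 0, 1:] dvd g"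
    using order_decomp by blast
  then have g: "det P = [:0, 1:] ^ order 0 (det P) * g" "poly g 0 \<noteq> 0"
    by (simp_all add: poly_eq_0_iff_dvd)
  have "\<bar>poly g q\<bar> = \<bar>poly p q\<bar>" if q: "prime q" "q > max \<bar>poly p 0\<bar> \<bar>poly g 0\<bar>" for q
  proof -
    \<comment> \<open>A common multiple of both values, for which the two gcds are their absolute
      values. It is coprime to \<open>q\<close>, because \<open>q\<close> divides neither.\<close>
    define n where "n = \<bar>poly p q * poly g q\<bar>"
    have nd: "\<not> q dvd poly p q" "\<not> q dvd poly g q"
      using poly_not_dvd_prime[OF q(1)] q(2) p0' g(2) by auto
    then have nz: "poly p q \<noteq> 0" "poly g q \<noteq> 0" by auto
    have "poly p q * poly g q \<noteq> 0" using nz by simp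
    then have n1: "n \<ge> 1" unfolding n_def by linarith
    have c: "coprime q n"
      using prime_imp_coprime[OF q(1)] nd by (simp add: n_def)
    let ?j = "order 0 (det P)"
    let ?A = "map_mat (\<lambda>f. poly f q) P"
    \<comment> \<open>This power is the factor coprime to the modulus that
      \<open>card_solutions_det\<close> allows in the determinant.\<close>
    have cj: "coprime (q ^ ?j) n" using c by simp
    have d: "det ?A = q ^ ?j * poly g q"
      unfolding hom by (subst g(1)) (simp add: poly_power)
    have "q \<noteq> 0" using q(1) by auto
    have "det ?A dvd n * q ^ ?j" unfolding d by (simp add: n_def mult.commute mult_dvd_mono)
    then have "card (solutions n ?A) = nat (gcd (det ?A) n)"
      by (intro card_solutions_det[OF n1 cj Pq]) (use d nz \<open>q \<noteq> 0\<close> in auto)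
    also have "gcd (det ?A) n = gcd (poly g q) n"
      unfolding d by (rule gcd_mult_left_left_cancel) (use cj in \<open>simp add: coprime_commute\<close>)
    finally have "nat (gcd (poly g q) n) = nat (gcd (poly p q) n)" using count[OF n1 c] by simp
    then show ?thesis by (simp add: n_def)
  qed
  then have "g = p \<or> g = - p" by (intro poly_eq_if_abs_eq)
  then show ?thesis using that g(1) by blast
qed

text \<open>Multiplying the rows of negative crossings by \<open>m\<close> clears the denominators.\<close>

definition cleared_entry :: "gauss_word \<Rightarrow> nat \<Rightarrow> nat \<Rightarrow> int poly" where
  "cleared_entry w k j = (if is_positive w k
    then (if j = under_arc w k then [:0, 1:] else 0) + (if j = over_arc w k then [:1, - 1:] else 0)
      - (if j = k then 1 else 0)
    else (if j = under_arc w k then 1 else 0) + (if j = over_arc w k then [:- 1, 1:] else 0)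
      - (if j = k then [:0, 1:] else 0))"

lemma laurent_of_poly_cleared_entry:
  assumes "k < crossings w" "j < crossings w"
  shows "laurent_of_poly (cleared_entry w k j) =
    mpow (if is_positive w k then 0 else 1) * colouring_matrix w $$ (k, j)"
  unfolding colouring_matrix_index[OF assms] cleared_entry_def Let_def
  by (simp add: laurent_hom.hom_minus laurent_hom.hom_add laurent_of_poly_uminus laurent_of_poly_pCons algebra_simps)

text \<open>The full matrix has \<open>n\<close> times as many solutions as its minor, and the
  colouring number is \<open>n\<close> times a gcd; cancelling \<open>n\<close> leaves a count for
  the minor. The numberings are carried along as permutations, so any row and any column may be the
  deleted ones.\<close>

theorem alexander_from_colour_count:
  assumes v: "valid_word w" and b: "balanced w" and cc: "colour_count w p" and p0: "coeff p 0 > 0"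
    and A: "A \<in> colouring_matrices w"
  shows "\<exists>\<epsilon>\<in>{1, - 1}. \<exists>k. det (mat_delete A (crossings w - 1) (crossings w - 1)) =
    \<epsilon> * mpow k * laurent_of_poly p"
proof -
  obtain N where N: "crossings w = Suc N" using valid_word_crossings[OF v] by (cases "crossings w") auto
  let ?C = "colouring_matrix w"
  obtain \<rho> \<sigma> where p: "\<rho> permutes {..<crossings w}" "\<sigma> permutes {..<crossings w}"
    and Adef: "A = mat (crossings w) (crossings w) (\<lambda>(i, j). ?C $$ (\<rho> i, \<sigma> j))"
    using A unfolding colouring_matrices_def mem_Collect_eq by (elim exE conjE) (rule that)
  have less: "\<rho> i < Suc N" "\<sigma> i < Suc N" if "i < Suc N" for i
    using permutes_in_image[OF p(1), of i] permutes_in_image[OF p(2), of i] that by (simp_all add: N)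
  have Ac: "A \<in> carrier_mat (Suc N) (Suc N)" by (simp add: Adef N)
  have Aij: "A $$ (i, j) = ?C $$ (\<rho> i, \<sigma> j)" if "i < Suc N" "j < Suc N" for i j
    using that by (simp add: Adef N)
  let ?M = "mat_delete A N N"
  have Mc: "?M \<in> carrier_mat N N" using mat_delete_carrier[OF Ac] by simp
  have Mij: "?M $$ (i, j) = ?C $$ (\<rho> i, \<sigma> j)" if "i < N" "j < N" for i j
    using that Ac Aij by (auto simp: mat_delete_def)
  define e where "e i = (if is_positive w (\<rho> i) then 0 else 1 :: int)" for i
  define P where "P = mat N N (\<lambda>(i, j). cleared_entry w (\<rho> i) (\<sigma> j))"
  have Pc: "P \<in> carrier_mat N N" by (simp add: P_def)
  have LP: "laurent_of_poly (P $$ (i, j)) = mpow (e i) * ?M $$ (i, j)" if "i < N" "j < N" for i j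
    using that less[of i] less[of j] unfolding Mij[OF that] e_def
    by (simp add: P_def laurent_of_poly_cleared_entry N)
  obtain H where H: "\<And>j. j < crossings w \<Longrightarrow> (\<Sum>k<crossings w. mpow (H k) * ?C $$ (k, j)) = 0"
    using balanced_row_relation[OF v b] by blast
  have count: "card (solutions n (map_mat (\<lambda>f. poly f q) P)) = nat (gcd (poly p q) n)"
    if n: "n \<ge> 1" and c: "coprime q n" for n q
  proof -
    let ?A = "eval_matrix n q A" and ?ev = "eval_mod n q"
    have "card (solutions n ?A) = nat n * card (solutions n (mat_delete ?A N N))"
    proof (rule card_solutions_delete[OF n, where c = "\<lambda>i. ?ev (mpow (H (\<rho> i)))"])
      show "?A \<in> carrier_mat (Suc N) (Suc N)" using Ac by simp
      show "coprime (?ev (mpow (H (\<rho> N)))) n" by (simp add: eval_mod_mpow coprime_power_mod[OF c])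
      show "n dvd (\<Sum>j<Suc N. ?A $$ (i, j))" if i: "i < N" for i
      proof -
        have "(\<Sum>j<Suc N. ?A $$ (i, j)) = (\<Sum>j<Suc N. ?ev (?C $$ (\<rho> i, \<sigma> j)))"
          by (rule sum.cong) (use Ac Aij i in auto)
        also have "\<dots> = (\<Sum>j<Suc N. ?ev (?C $$ (\<rho> i, j)))"
          using sum.permute[OF p(2), of "\<lambda>j. ?ev (?C $$ (\<rho> i, j))"] by (simp only: N comp_def)
        also have "\<dots> = 0"
          using eval_colouring_row[OF v, of "\<rho> i" n q "\<lambda>_. 1"] less(1)[of i] i
          by (simp add: N Let_def del: sum.lessThan_Suc)
        finally show ?thesis by simp
      qed
      show "n dvd (\<Sum>i<Suc N. ?ev (mpow (H (\<rho> i))) * ?A $$ (i, j))" if j: "j < Suc N" for j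
      proof -
        have "[(\<Sum>i<Suc N. ?ev (mpow (H (\<rho> i))) * ?A $$ (i, j)) =
            (\<Sum>i<Suc N. ?ev (mpow (H (\<rho> i)) * ?C $$ (\<rho> i, \<sigma> j)))] (mod n)"
        proof (rule cong_sum)
          fix i assume "i \<in> {..<Suc N}"
          then have "?A $$ (i, j) = ?ev (?C $$ (\<rho> i, \<sigma> j))" using Ac Aij j by auto
          then show "[?ev (mpow (H (\<rho> i))) * ?A $$ (i, j) =
              ?ev (mpow (H (\<rho> i)) * ?C $$ (\<rho> i, \<sigma> j))] (mod n)"
            using cong_sym[OF eval_mod_mult[OF c]] by simp
        qed
        also have "(\<Sum>i<Suc N. ?ev (mpow (H (\<rho> i)) * ?C $$ (\<rho> i, \<sigma> j))) =
            ?ev (\<Sum>i<Suc N. mpow (H (\<rho> i)) * ?C $$ (\<rho> i, \<sigma> j))"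
          by (simp only: eval_mod_sum)
        also have "(\<Sum>i<Suc N. mpow (H (\<rho> i)) * ?C $$ (\<rho> i, \<sigma> j)) = (\<Sum>k<Suc N. mpow (H k) * ?C $$ (k, \<sigma> j))"
          using sum.permute[OF p(1), of "\<lambda>k. mpow (H k) * ?C $$ (k, \<sigma> j)"] by (simp only: N comp_def)
        also have "\<dots> = 0" using H[of "\<sigma> j"] less(2)[OF j] by (simp only: N)
        finally show ?thesis by (simp add: cong_0_iff)
      qed
    qed
    also have "mat_delete ?A N N = eval_matrix n q ?M"
      by (rule eq_matI) (use Ac in \<open>auto simp: mat_delete_def\<close>)
    also have "solutions n (eval_matrix n q ?M) = solutions n (map_mat (\<lambda>f. poly f q) P)"
    proof (rule HOL.sym, rule solutions_scale_rows[where c = "\<lambda>i. ?ev (mpow (e i))"])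
      fix i j assume "i < dim_row (eval_matrix n q ?M)" "j < dim_col (eval_matrix n q ?M)"
      then have ij: "i < N" "j < N" using Mc by auto
      have "poly (P $$ (i, j)) q = ?ev (mpow (e i) * ?M $$ (i, j))"
        using LP[OF ij] eval_mod_laurent_of_poly[of n q "P $$ (i, j)"] by simp
      moreover have "map_mat (\<lambda>f. poly f q) P $$ (i, j) = poly (P $$ (i, j)) q"
        by (rule index_map_mat(1)) (use ij Pc in auto)
      moreover have "eval_matrix n q ?M $$ (i, j) = ?ev (?M $$ (i, j))"
        by (rule index_map_mat(1)) (use ij Mc in auto)
      ultimately show "[map_mat (\<lambda>f. poly f q) P $$ (i, j) = ?ev (mpow (e i)) * eval_matrix n q ?M $$ (i, j)] (mod n)"
        using eval_mod_mult[OF c, of "mpow (e i)" "?M $$ (i, j)"] by (simp only:)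
    qed (use Pc Mc in \<open>auto simp: eval_mod_mpow coprime_power_mod[OF c]\<close>)
    finally have "colouring_number n q w = nat n * card (solutions n (map_mat (\<lambda>f. poly f q) P))"
      using colouring_matrices_solutions[OF A] colourings_solutions[OF v n]
      by (simp only: colouring_number_def)
    moreover have "colouring_number n q w = nat n * nat (gcd (poly p q) n)"
      using cc n c by (simp add: colour_count_def)
    ultimately show ?thesis using n by simp
  qed
  obtain j g where g: "det P = [:0, 1:] ^ j * g" "g = p \<or> g = - p"
    using determinant_from_solutions[OF Pc p0 count] by blast
  have X: "laurent_of_poly [:0, 1:] = mpow 1"
    by (simp add: laurent_of_poly_pCons)
  have "laurent_of_poly (det P) = mpow (int j) * laurent_of_poly g"
    unfolding g(1) by (simp add: laurent_hom.hom_mult laurent_hom.hom_power X mpow_power)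
  moreover have "laurent_of_poly (det P) = det (map_mat laurent_of_poly P)"
    by (rule laurent_hom.hom_det[symmetric])
  \<comment> \<open>Undoes the clearing of denominators: the determinants differ by a power of
    \<open>m\<close>, divided out at the end.\<close>
  moreover have "map_mat laurent_of_poly P = mat_diag N (\<lambda>i. mpow (e i)) * ?M"
    unfolding mat_diag_mult_left[OF Mc]
    by (rule eq_matI) (use Pc LP in auto)
  moreover have "det (mat_diag N (\<lambda>i. mpow (e i)) * ?M) = det (mat_diag N (\<lambda>i. mpow (e i))) * det ?M"
    by (rule det_mult[OF _ Mc]) simp
  moreover have "det (mat_diag N (\<lambda>i. mpow (e i))) = mpow (\<Sum>i<N. e i)"
  proof -
    have "mat_diag N (\<lambda>i. mpow (e i)) \<in> carrier_mat N N" by simp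
    moreover have "upper_triangular (mat_diag N (\<lambda>i. mpow (e i)))"
      by (auto simp: mat_diag_def upper_triangular_def)
    ultimately have "det (mat_diag N (\<lambda>i. mpow (e i))) = prod_list (diag_mat (mat_diag N (\<lambda>i. mpow (e i))))"
      by (rule det_upper_triangular[rotated])
    also have "\<dots> = (\<Prod>i<N. mpow (e i))"
      by (simp add: prod_list_diag_prod mat_diag_def lessThan_atLeast0)
    also have "\<dots> = mpow (\<Sum>i<N. e i)"
      by (induction N) (simp_all add: mpow_add)
    finally show ?thesis .
  qed
  ultimately have d: "mpow (\<Sum>i<N. e i) * det ?M = mpow (int j) * laurent_of_poly g" by simp
  define E where "E = (\<Sum>i<N. e i)"
  have "det ?M = mpow (- E) * (mpow E * det ?M)"
    by (simp only: mult.assoc[symmetric] mpow_inverse mult_1_left)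
  also have "\<dots> = mpow (- E) * (mpow (int j) * laurent_of_poly g)"
    using d by (simp only: E_def)
  also have "\<dots> = mpow (int j - E) * laurent_of_poly g"
    by (simp only: mult.assoc[symmetric] mpow_add) (simp add: add.commute)
  finally have "det ?M = mpow (int j - E) * laurent_of_poly g" .
  then have "det ?M = 1 * mpow (int j - E) * laurent_of_poly p \<or>
      det ?M = - 1 * mpow (int j - E) * laurent_of_poly p"
    using g(2) by (auto simp: laurent_of_poly_uminus)
  then show ?thesis unfolding N diff_Suc_1 by blast
qed

section \<open>Transport of the properties along isotopies\<close>

lemma isotopic_invariant:
  assumes i: "isotopic w w'" and w: "valid_word w" "balanced w" "colour_count w p"
  shows "valid_word w' \<and> balanced w' \<and> colour_count w' p"
proof -
  have inv: "colour_count w p \<longleftrightarrow> colour_count w' p"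
    if "knot_diagram w" "knot_diagram w'" "reidemeister w w'" for w w'
  proof -
    have "valid_word w" "valid_word w'" using that by (auto simp: knot_diagram_def)
    then show ?thesis
      using colouring_number_reidemeister[OF that(3)] by (simp add: colour_count_def)
  qed
  show ?thesis
    using i[unfolded isotopic_def]
  proof (induction rule: equivclp_induct)
    \<comment> \<open>Isotopy is reflexive on all words; for \<open>w\<close> itself the properties
      are the hypotheses, without recourse to \<open>knot_diagram\<close>.\<close>
    case base
    then show ?case using w by simp
  next
    case (step y z)
    then have k: "knot_diagram y" "knot_diagram z" by auto
    \<comment> \<open>Only the count has to be carried through the moves; validity and balance hold
      for every knot diagram.\<close>
    have "colour_count z p" using step inv[of y z] inv[of z y] by blast
    then show ?case using k knot_diagram_balanced by (simp add: knot_diagram_def)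
  qed
qed

lemma knot_of_self: "w \<in> knot_of w"
  by (simp add: knot_of_def isotopic_def)

theorem has_alexander_polynomial_knot_of:
  assumes "valid_word w" "balanced w" "colour_count w p" "coeff p 0 > 0"
  shows "has_alexander_polynomial (knot_of w) p"
  unfolding has_alexander_polynomial_def knot_of_def
proof (intro conjI ballI)
  fix w' A assume "w' \<in> {w'. isotopic w w'}" and A: "A \<in> colouring_matrices w'"
  then have "valid_word w' \<and> balanced w' \<and> colour_count w' p"
    using isotopic_invariant assms by simp
  then show "\<exists>\<epsilon>\<in>{1, - 1}. \<exists>k. det (mat_delete A (crossings w' - 1) (crossings w' - 1)) =
      \<epsilon> * mpow k * laurent_of_poly p"
    using alexander_from_colour_count assms(4) A by blast
qed (rule assms(4))

theorem colouring_number_knot_of: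
  assumes "valid_word w" "balanced w" "colour_count w p" "w' \<in> knot_of w" "n \<ge> 1" "coprime m n"
  shows "colouring_number n m w' = nat n * nat (gcd (poly p m) n)"
  using isotopic_invariant[OF _ assms(1-3)] assms(4-6) by (simp add: knot_of_def colour_count_def)

section \<open>Reflection and reversal\<close>

lemma reflect_simps [simp]:
  "crossing (reflect x) = crossing x" "is_over (reflect x) = is_over x"
  "is_under (reflect x) = is_under x" "positive (reflect x) \<longleftrightarrow> \<not> positive x" "reflect (reflect x) = x"
  by (cases x; simp)+

lemma crossings_map_reflect [simp]: "crossings (map reflect w) = crossings w"
  and crossings_rev [simp]: "crossings (rev w) = crossings w"
  by (simp_all add: crossings_def)

lemma inj_reflect: "inj reflect"
  by (metis injI reflect_simps(5))

lemma valid_word_rev: "valid_word w \<Longrightarrow> valid_word (rev w)"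
  by (simp add: valid_word_def)

lemma valid_word_reflect: "valid_word w \<Longrightarrow> valid_word (map reflect w)"
proof -
  assume v: "valid_word w"
  have "set (map reflect w) = reflect ` (\<Union>k<crossings w. {Over k (is_positive w k), Under k (is_positive w k)})"
    using valid_word_set[OF v] by simp
  also have "\<dots> = (\<Union>k<crossings w. {Over k (\<not> is_positive w k), Under k (\<not> is_positive w k)})"
    by (simp add: image_UN)
  finally have "\<exists>\<epsilon>. set (map reflect w) = (\<Union>k<crossings w. {Over k (\<epsilon> k), Under k (\<epsilon> k)})"
    by (rule exI[of _ "\<lambda>k. \<not> is_positive w k"])
  moreover have "distinct (map reflect w)"
    using valid_word_distinct[OF v] inj_on_subset[OF inj_reflect subset_UNIV] by (simp add: distinct_map)
  ultimately show ?thesis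
    using valid_word_crossings[OF v] unfolding valid_word_def crossings_map_reflect by blast
qed

lemma is_positive_rev [simp]: "is_positive (rev w) k = is_positive w k"
  by (simp add: is_positive_def)

lemma is_positive_reflect:
  assumes v: "valid_word w" and k: "k < crossings w"
  shows "is_positive (map reflect w) k = (\<not> is_positive w k)"
proof -
  have "reflect (Over k (is_positive w k)) \<in> set (map reflect w)"
    unfolding set_map by (rule imageI[OF valid_word_mem(1)[OF v k]])
  then have "Over k (\<not> is_positive w k) \<in> set (map reflect w)"
    unfolding reflect.simps .
  then show ?thesis using valid_word_positive[OF valid_word_reflect[OF v]] by fastforce
qed

lemma height_reflect: "height (map reflect w) i = - height w i"
proof -
  have "weight (reflect x) = - weight x" for x by (cases x) simp_all
  then show ?thesis unfolding height_def take_map map_map comp_def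
    by (simp add: uminus_sum_list_map comp_def)
qed

lemma balanced_reflect: "balanced w \<Longrightarrow> balanced (map reflect w)"
  by (simp add: balanced_def height_reflect)

text \<open>As the total height is 0, reversal reads the heights backwards with opposite sign. The
  condition then compares the height behind the over-passage with that before the under-passage, and
  follows because the two weights of a crossing are opposite.\<close>

lemma balanced_rev:
  assumes v: "valid_word w" and b: "balanced w"
  shows "balanced (rev w)"
proof -
  let ?L = "length w"
  have h: "height (rev w) (?L - i) = - height w i" if "i \<le> ?L" for i
  proof -
    have "height w i + sum_list (map weight (drop i w)) = sum_list (map weight (take i w @ drop i w))"
      unfolding height_def map_append sum_list_append ..
    also have "\<dots> = height w ?L" by (simp add: height_def)
    finally have "sum_list (map weight (drop i w)) = - height w i"
      by (simp add: height_length[OF v])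
    moreover have "height (rev w) (?L - i) = sum_list (map weight (rev (drop i w)))"
      using that by (simp add: height_def take_rev)
    ultimately show ?thesis by (simp add: rev_map[symmetric])
  qed
  show ?thesis
    unfolding balanced_def
  proof (intro allI impI)
    fix i j assume ij: "i < length (rev w)" "j < length (rev w)" "is_over (rev w ! i)" "is_under (rev w ! j)"
      "crossing (rev w ! i) = crossing (rev w ! j)"
    define i' j' where "i' = ?L - Suc i" and "j' = ?L - Suc j"
    have x: "rev w ! i = w ! i'" "rev w ! j = w ! j'" "i' < ?L" "j' < ?L"
      using ij(1,2) by (simp_all add: i'_def j'_def rev_nth)
    then have e: "height w i' = height w (Suc j')" using b ij(3-5) by (simp add: balanced_def)
    have "i = ?L - Suc i'" "Suc j = ?L - j'" using ij(1,2) by (simp_all add: i'_def j'_def)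
    then have "height (rev w) i = - height w (Suc i')" "height (rev w) (Suc j) = - height w j'"
      using h[of "Suc i'"] h[of j'] x(3,4) by simp_all
    moreover have "positive (w ! i') = positive (w ! j')"
      using valid_word_positive[OF v nth_mem[OF x(3)]] valid_word_positive[OF v nth_mem[OF x(4)]] ij(5) x(1,2) by simp
    then have "weight (w ! i') = - weight (w ! j')"
      using ij(3,4) x(1,2) by (cases "w ! i'"; cases "w ! j'") auto
    ultimately show "height (rev w) i = height (rev w) (Suc j)"
      using e height_Suc[OF x(3)] height_Suc[OF x(4)] by simp
  qed
qed

lemma arc_into_reflect: "arc_into (map reflect w) (reflect x) = arc_into w x"
proof -
  have "((\<noteq>) (reflect x)) \<circ> reflect = (\<noteq>) x"
    using inj_reflect by (auto simp: fun_eq_iff inj_def)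
  then have "read_from (map reflect w) (reflect x) = map reflect (read_from w x)"
    unfolding read_from_def dropWhile_map takeWhile_map by simp
  moreover have "is_under \<circ> reflect = is_under" by auto
  moreover have "crossing (last (map reflect l)) = crossing (last l)" for l
    by (cases "l = []") (simp_all add: last_map)
  ultimately show ?thesis unfolding arc_into_def by (simp add: filter_map)
qed

lemma arcs_reflect:
  assumes "valid_word w" "k < crossings w"
  shows "under_arc (map reflect w) k = under_arc w k" "over_arc (map reflect w) k = over_arc w k"
  using arc_into_reflect[of w "Under k (is_positive w k)"] arc_into_reflect[of w "Over k (is_positive w k)"]
  by (simp_all add: under_arc_def over_arc_def is_positive_reflect[OF assms])

lemma modular_inverse_involution:
  fixes n m :: int
  assumes "n \<ge> 1" "coprime m n"
  shows "[modular_inverse n (modular_inverse n m) = m] (mod n)"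
proof -
  let ?i = "modular_inverse n m"
  have i: "[m * ?i = 1] (mod n)" using cong_modular_inverse1[OF assms(2)] .
  have "coprime ?i n" using assms(2) by simp
  then have ii: "[?i * modular_inverse n ?i = 1] (mod n)" by (rule cong_modular_inverse1)
  have "[modular_inverse n ?i * 1 = modular_inverse n ?i * (m * ?i)] (mod n)"
    by (intro cong_mult cong_refl cong_sym[OF i])
  also have "modular_inverse n ?i * (m * ?i) = m * (?i * modular_inverse n ?i)" by (simp add: mult_ac)
  also have "[\<dots> = m * 1] (mod n)" by (intro cong_mult cong_refl ii)
  finally show ?thesis by simp
qed

lemma linear_op_inverse:
  assumes "n \<ge> 1" "coprime m n"
  shows "linear_op n (modular_inverse n m) s = linear_op n m (\<not> s)"
proof (intro ext)
  fix a b
  have "[modular_inverse n (modular_inverse n m) * a + (1 - modular_inverse n (modular_inverse n m)) * b =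
      m * a + (1 - m) * b] (mod n)"
    by (intro cong_add cong_mult cong_diff cong_refl modular_inverse_involution assms)
  then show "linear_op n (modular_inverse n m) s a b = linear_op n m (\<not> s) a b"
    by (cases s) (simp_all add: linear_op_eq Let_def cong_def)
qed

lemma colouring_number_reflect:
  assumes v: "valid_word w" and n: "n \<ge> 1" "coprime m n"
  shows "colouring_number n m (map reflect w) = colouring_number n (modular_inverse n m) w"
proof -
  have "X \<in> colourings n m (map reflect w) \<longleftrightarrow> X \<in> colourings n (modular_inverse n m) w" for X
    unfolding colourings_iff linear_op_inverse[OF n]
    by (simp add: arcs_reflect[OF v] is_positive_reflect[OF v] cong: conj_cong)
  then have "colourings n m (map reflect w) = colourings n (modular_inverse n m) w" by blast
  then show ?thesis by (simp add: colouring_number_def)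
qed

lemma colouring_number_rev:
  assumes v: "valid_word w" and n: "n \<ge> 1" "coprime m n"
  shows "colouring_number n m (rev w) = colouring_number n (modular_inverse n m) w"
proof -
  have "colouring_number n m (rev w) = card (loops {0..<n} (linear_op n m) (rev w))"
    by (rule colouring_number_loops[OF valid_word_rev[OF v] n(1)])
  also have "linear_op n m = (\<lambda>s. linear_op n (modular_inverse n m) (\<not> s))"
    by (simp add: linear_op_inverse[OF n])
  also have "loops {0..<n} (\<lambda>s. linear_op n (modular_inverse n m) (\<not> s)) (rev w) =
      loops {0..<n} (linear_op n (modular_inverse n m)) w"
    by (rule quandle_pair.loops_rev[OF quandle_pair_linear[OF n(1)]]) (use n in simp)
  also have "card \<dots> = colouring_number n (modular_inverse n m) w"
    by (rule colouring_number_loops[OF v n(1), symmetric])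
  finally show ?thesis .
qed

text \<open>The reciprocal polynomial, with \<open>y\<close> in the role of the inverse of
  \<open>x\<close> modulo \<open>n\<close>.\<close>

lemma poly_reflect_cong:
  fixes p :: "int poly"
  assumes "[x * y = 1] (mod n)"
  shows "[x ^ degree p * poly p y = poly (reflect_poly p) x] (mod n)"
proof -
  have pw: "[x ^ k * y ^ k = 1] (mod n)" for k
    using cong_pow[OF assms, of k] by (simp add: power_mult_distrib)
  have "[x ^ degree p * (\<Sum>i\<le>degree p. coeff p i * y ^ i) = (\<Sum>i\<le>degree p. coeff p i * x ^ (degree p - i))] (mod n)"
    unfolding sum_distrib_left
  proof (rule cong_sum)
    fix i assume "i \<in> {..degree p}"
    then have "x ^ degree p = x ^ (degree p - i) * x ^ i" by (simp add: power_add[symmetric])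
    then have "x ^ degree p * (coeff p i * y ^ i) = coeff p i * x ^ (degree p - i) * (x ^ i * y ^ i)"
      by (simp add: mult_ac)
    also have "[\<dots> = coeff p i * x ^ (degree p - i) * 1] (mod n)" by (intro cong_mult cong_refl pw)
    finally show "[x ^ degree p * (coeff p i * y ^ i) = coeff p i * x ^ (degree p - i)] (mod n)" by simp
  qed
  also have "(\<Sum>i\<le>degree p. coeff p i * x ^ (degree p - i)) = (\<Sum>i\<le>degree p. coeff p (degree p - i) * x ^ i)"
    by (rule sum.reindex_bij_witness[where i = "\<lambda>i. degree p - i" and j = "\<lambda>i. degree p - i"]) auto
  also have "\<dots> = poly (reflect_poly p) x"
  proof -
    have "poly (reflect_poly p) x = (\<Sum>i\<le>degree p. coeff (reflect_poly p) i * x ^ i)"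
      unfolding poly_altdef
      by (rule sum.mono_neutral_left) (auto simp: degree_reflect_poly_le coeff_eq_0 intro: order_trans)
    then show ?thesis by (simp add: coeff_reflect_poly)
  qed
  finally show ?thesis by (simp add: poly_altdef)
qed

lemma gcd_poly_inverse:
  fixes p :: "int poly"
  assumes "reflect_poly p = p" "coprime m n"
  shows "gcd (poly p (modular_inverse n m)) n = gcd (poly p m) n"
proof -
  have "[m ^ degree p * poly p (modular_inverse n m) = poly p m] (mod n)"
    using poly_reflect_cong[OF cong_modular_inverse1[OF assms(2)], of p] by (simp add: assms(1))
  then have "gcd (m ^ degree p * poly p (modular_inverse n m)) n = gcd (poly p m) n" by (rule cong_gcd_eq)
  moreover have "gcd (m ^ degree p * poly p (modular_inverse n m)) n = gcd (poly p (modular_inverse n m)) n"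
    by (rule gcd_mult_left_left_cancel) (use assms(2) in \<open>simp add: coprime_commute\<close>)
  ultimately show ?thesis by simp
qed

lemma colour_count_reflect:
  assumes "valid_word w" "colour_count w p" "reflect_poly p = p"
  shows "colour_count (map reflect w) p" "colour_count (rev w) p"
  using assms by (simp_all add: colour_count_def colouring_number_reflect colouring_number_rev gcd_poly_inverse)

section \<open>Type I matrices of reversed diagrams\<close>

definition type_I_diagram :: "gauss_word \<Rightarrow> bool" where
  "type_I_diagram w \<longleftrightarrow> (\<exists>A\<in>colouring_matrices w. \<exists>B. equivalent_matrix A B \<and> type_I B)"

lemma has_type_I_matrix_knot_of: "type_I_diagram w \<Longrightarrow> has_type_I_matrix (knot_of w)"
  using knot_of_self by (auto simp: has_type_I_matrix_def type_I_diagram_def)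

text \<open>Arcs are named by the crossing they leave. A reversed arc leaves the crossing where it
  used to end, so \<open>under_arc w\<close> translates names for \<open>rev w\<close> into names
  for \<open>w\<close>. An under-passage is now entered along the arc that formerly left it.\<close>

lemma under_arc_rev:
  assumes v: "valid_word w" and x: "x \<in> set w"
  shows "under_arc w (arc_into (rev w) x) = (if is_under x then crossing x else arc_into w x)"
proof -
  let ?L = "length w"
  have d: "distinct w" "distinct (rev w)" using valid_word_distinct[OF v] by auto
  let ?P = "\<lambda>x. under_arc w (arc_into (rev w) x) = (if is_under x then crossing x else arc_into w x)"
  text \<open>The predecessor in the reversed word is the successor in \<open>w\<close>.\<close>
  have step: "arc_into (rev w) (rev w ! (Suc i mod ?L)) =
      (if is_under (rev w ! i) then crossing (rev w ! i) else arc_into (rev w) (rev w ! i))" if "i < ?L" for i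
    using arc_into_Suc[OF d(2), of i] that by simp
  have next_arc: "arc_into w (rev w ! i) =
      (if is_under (rev w ! (Suc i mod ?L)) then crossing (rev w ! (Suc i mod ?L)) else arc_into w (rev w ! (Suc i mod ?L)))"
    if i: "i < ?L" for i
  proof -
    define j where "j = ?L - Suc (Suc i mod ?L)"
    have s: "Suc i mod ?L < ?L" using i by (rule Suc_mod_less)
    have j: "j < ?L" "rev w ! (Suc i mod ?L) = w ! j" using s by (simp_all add: j_def rev_nth)
    have "Suc j mod ?L = ?L - Suc i"
    proof (cases "Suc i = ?L")
      case True
      then show ?thesis by (simp add: j_def True[symmetric])
    next
      case False
      then show ?thesis using i by (simp add: j_def)
    qed
    then have "rev w ! i = w ! (Suc j mod ?L)" using i by (simp add: rev_nth)
    then show ?thesis using arc_into_Suc[OF d(1) j(1)] j(2) by simp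
  qed
  have *: "?P (rev w ! (Suc i mod ?L))" if i: "i < ?L" and prev: "is_under (rev w ! i) \<or> ?P (rev w ! i)" for i
  proof (cases "is_under (rev w ! i)")
    case True
    let ?k = "crossing (rev w ! i)"
    have m: "rev w ! i \<in> set w" using i by (metis length_rev nth_mem set_rev)
    have "rev w ! i = Under ?k (is_positive w ?k)"
      using valid_word_positive[OF v m] True by (intro passage.expand) auto
    then have "under_arc w ?k = arc_into w (rev w ! i)" unfolding under_arc_def by simp
    then show ?thesis using step[OF i] next_arc[OF i] True by simp
  next
    case False
    then show ?thesis using step[OF i] next_arc[OF i] prev by simp
  qed
  obtain i0 where i0: "i0 < ?L" "is_under (rev w ! i0)"
    using ex_under_position[OF valid_word_rev[OF v]] by auto
  have "?P (rev w ! i)" if "i < ?L" for i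
  proof (rule cyclic_induct[where ?i0.0 = "Suc i0 mod ?L" and L = ?L and P = "\<lambda>i. ?P (rev w ! i)"])
    show "Suc i0 mod ?L < ?L" using i0(1) by (rule Suc_mod_less)
    show "?P (rev w ! (Suc i0 mod ?L))" using *[OF i0(1)] i0(2) by blast
  qed (use * that in blast)+
  then show ?thesis using x by (metis in_set_conv_nth length_rev set_rev)
qed

text \<open>Up to renaming the arcs, each row of the reversed diagram is a unit times that of the
  mirror image: exchanging the under-arc coefficients \<mu> and -1 amounts to inverting \<mu> and
  multiplying by -\<mu>.\<close>

lemma type_I_diagram_rev:
  assumes v: "valid_word w" and t: "type_I_diagram (map reflect w)"
  shows "type_I_diagram (rev w)"
proof -
  let ?N = "crossings w" and ?R = "colouring_matrix (map reflect w)" and ?V = "colouring_matrix (rev w)"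
  define \<pi> where "\<pi> j = (if j < ?N then under_arc w j else j)" for j
  have vr: "valid_word (rev w)" using v by (rule valid_word_rev)
  have under: "under_arc w (under_arc (rev w) k) = k" and over: "under_arc w (over_arc (rev w) k) = over_arc w k"
    if k: "k < ?N" for k
    using under_arc_rev[OF v valid_word_mem(2)[OF v k]] under_arc_rev[OF v valid_word_mem(1)[OF v k]]
    by (simp_all add: under_arc_def over_arc_def)
  have ul: "under_arc (rev w) k < ?N" "over_arc (rev w) k < ?N" if "k < ?N" for k
    using under_arc_less[OF vr] over_arc_less[OF vr] that by simp_all
  have surj: "{..<?N} \<subseteq> under_arc w ` {..<?N}"
    using under ul(1) by (metis image_eqI lessThan_iff subsetI)
  have "under_arc w ` {..<?N} = {..<?N}"
    using surj under_arc_less[OF v] by auto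
  then have inj: "inj_on (under_arc w) {..<?N}" by (intro eq_card_imp_inj_on) simp_all
  have "bij_betw (under_arc w) {..<?N} {..<?N}"
    using inj \<open>under_arc w ` {..<?N} = {..<?N}\<close> by (simp add: bij_betw_def)
  then have "bij_betw \<pi> {..<?N} {..<?N}"
    by (subst bij_betw_cong[where g = "under_arc w"]) (auto simp: \<pi>_def)
  then have perm: "\<pi> permutes {..<?N}"
    by (rule bij_imp_permutes) (auto simp: \<pi>_def)
  have inj': "under_arc w i = under_arc w j \<longleftrightarrow> i = j" if "i < ?N" "j < ?N" for i j
    using inj that by (auto simp: inj_on_def)
  text \<open>Reversal interchanges the two under-arcs at each crossing.\<close>
  have entry: "?V $$ (k, j) = - mpow (if is_positive w k then 1 else - 1) * ?R $$ (k, \<pi> j)"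
    if k: "k < ?N" and j: "j < ?N" for k j
  proof -
    have e: "j = under_arc (rev w) k \<longleftrightarrow> \<pi> j = k" "j = over_arc (rev w) k \<longleftrightarrow> \<pi> j = over_arc w k"
      "j = k \<longleftrightarrow> \<pi> j = under_arc w k"
      using inj'[OF j ul(1)[OF k]] inj'[OF j ul(2)[OF k]] inj'[OF j k] under[OF k] over[OF k] j
      by (simp_all add: \<pi>_def)
    have pj: "\<pi> j < ?N" using under_arc_less[OF v j] j by (simp add: \<pi>_def)
    have V: "?V $$ (k, j) = (let \<mu> = mpow (if is_positive w k then 1 else - 1) in
        (if \<pi> j = k then \<mu> else 0) + (if \<pi> j = over_arc w k then 1 - \<mu> else 0) - (if \<pi> j = under_arc w k then 1 else 0))"
      using colouring_matrix_index[of k "rev w" j] k j by (simp add: e)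
    have R: "?R $$ (k, \<pi> j) = (let \<mu> = mpow (if is_positive w k then - 1 else 1) in
        (if \<pi> j = under_arc w k then \<mu> else 0) + (if \<pi> j = over_arc w k then 1 - \<mu> else 0) - (if \<pi> j = k then 1 else 0))"
      using colouring_matrix_index[of k "map reflect w" "\<pi> j"] k pj
      by (simp add: is_positive_reflect[OF v k] arcs_reflect[OF v k])
    show ?thesis unfolding V R Let_def
      by (cases "is_positive w k") (simp_all add: algebra_simps mpow_add)
  qed
  obtain A B where A: "A \<in> colouring_matrices (map reflect w)" and B: "equivalent_matrix A B" "type_I B"
    using t by (auto simp: type_I_diagram_def)
  obtain \<rho> \<sigma> where p: "\<rho> permutes {..<?N}" "\<sigma> permutes {..<?N}"
    and Adef: "A = mat ?N ?N (\<lambda>(i, j). ?R $$ (\<rho> i, \<sigma> j))"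
    using A unfolding colouring_matrices_def mem_Collect_eq crossings_map_reflect
    by (elim exE conjE) (rule that)
  define \<tau> where "\<tau> = inv_into UNIV \<pi> \<circ> \<sigma>"
  have \<tau>: "\<tau> permutes {..<?N}" unfolding \<tau>_def by (rule permutes_compose[OF p(2) permutes_inv[OF perm]])
  have \<pi>\<tau>: "\<pi> (\<tau> j) = \<sigma> j" for j using permutes_inverses(1)[OF perm] by (simp add: \<tau>_def)
  have less: "\<rho> i < ?N" "\<tau> i < ?N" if "i < ?N" for i
    using permutes_in_image[OF p(1), of i] permutes_in_image[OF \<tau>, of i] that by simp_all
  define V where "V = mat ?N ?N (\<lambda>(i, j). ?V $$ (\<rho> i, \<tau> j))"
  have "V \<in> colouring_matrices (rev w)"
    unfolding colouring_matrices_def mem_Collect_eq crossings_rev V_def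
    by (intro exI[of _ \<rho>] exI[of _ \<tau>] conjI HOL.refl p(1) \<tau>)
  moreover have "equivalent_matrix V A"
  proof -
    let ?c = "\<lambda>i. - mpow (if is_positive w (\<rho> i) then - 1 else 1)"
    have "equivalent_matrix V (mat ?N ?N (\<lambda>(i, j). ?c i * V $$ (i, j)))"
      by (rule scale_rows) (auto simp: V_def laurent_unit_def)
    also have "mat ?N ?N (\<lambda>(i, j). ?c i * V $$ (i, j)) = A"
    proof (rule eq_matI)
      fix i j assume "i < dim_row A" "j < dim_col A"
      then have ij: "i < ?N" "j < ?N" by (simp_all add: Adef)
      have "?c i * V $$ (i, j) = (mpow (if is_positive w (\<rho> i) then - 1 else 1) *
          mpow (if is_positive w (\<rho> i) then 1 else - 1)) * ?R $$ (\<rho> i, \<sigma> j)"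
        using ij entry[OF less(1) less(2)] by (simp add: V_def \<pi>\<tau>)
      also have "\<dots> = ?R $$ (\<rho> i, \<sigma> j)" by simp
      finally show "mat ?N ?N (\<lambda>(i, j). ?c i * V $$ (i, j)) $$ (i, j) = A $$ (i, j)"
        using ij by (simp add: Adef)
    qed (simp_all add: Adef)
    finally show ?thesis .
  qed
  ultimately show ?thesis
    using equivalent_matrix_trans[OF B(1)] B(2) unfolding type_I_diagram_def by blast
qed

theorem rolfsen_knots_properties:
  assumes v: "valid_word w" and b: "balanced w" and c: "colour_count w p" and p: "coeff p 0 > 0" "reflect_poly p = p"
    and t: "type_I_diagram w" "type_I_diagram (map reflect w)" and w: "rolfsen_diagram k = w"
    and K: "K \<in> rolfsen_knots k"
  shows "has_type_I_matrix K" "has_alexander_polynomial K p"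
    "\<And>n m w'. n \<ge> 1 \<Longrightarrow> coprime m n \<Longrightarrow> w' \<in> K \<Longrightarrow>
      colouring_number n m w' = nat n * nat (gcd (poly p m) n)"
proof -
  let ?r = "map reflect w"
  have r: "valid_word ?r" "balanced ?r" "colour_count ?r p"
    using valid_word_reflect[OF v] balanced_reflect[OF b] colour_count_reflect(1)[OF v c p(2)] .
  have rr: "map reflect ?r = w" by (simp add: comp_def)
  \<comment> \<open>The type I matrix of \<open>rev w\<close> comes from the mirror image, that of
    the reversed mirror image from \<open>w\<close> itself.\<close>
  have 1: "type_I_diagram u \<and> valid_word u \<and> balanced u \<and> colour_count u p"
    if "u \<in> {w, ?r, rev w, rev ?r}" for u
    using that v b c t r valid_word_rev[OF v] valid_word_rev[OF r(1)] balanced_rev[OF v b] balanced_rev[OF r(1,2)]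
      colour_count_reflect(2)[OF v c p(2)] colour_count_reflect(2)[OF r(1,3) p(2)]
      type_I_diagram_rev[OF v t(2)] type_I_diagram_rev[OF r(1)] t(1) by (auto simp only: rr)
  obtain u where u: "u \<in> {w, ?r, rev w, rev ?r}" "K = knot_of u"
    using K w unfolding rolfsen_knots_def Let_def by blast
  show "has_type_I_matrix K" "has_alexander_polynomial K p"
    using 1[OF u(1)] has_type_I_matrix_knot_of has_alexander_polynomial_knot_of[OF _ _ _ p(1)] u(2) by simp_all
  show "colouring_number n m w' = nat n * nat (gcd (poly p m) n)"
    if "n \<ge> 1" "coprime m n" "w' \<in> K" for n m w'
    using colouring_number_knot_of[of u p w' n m] 1[OF u(1)] u(2) that by simp
qed

section \<open>Certificates\<close>

text \<open>Polynomials in an indeterminate \<open>t\<close> as lists of coefficients; \<open>t\<close> stands for \<open>m\<close> or \<open>m\<^sup>-\<^sup>1\<close>.\<close>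

fun ladd :: "int list \<Rightarrow> int list \<Rightarrow> int list" where
  "ladd [] ys = ys"
| "ladd xs [] = xs"
| "ladd (x # xs) (y # ys) = (x + y) # ladd xs ys"

definition lsub :: "int list \<Rightarrow> int list \<Rightarrow> int list" where
  "lsub xs ys = ladd xs (map uminus ys)"

fun lmul :: "int list \<Rightarrow> int list \<Rightarrow> int list" where
  "lmul [] ys = []"
| "lmul (x # xs) ys = ladd (map ((*) x) ys) (0 # lmul xs ys)"

text \<open>Arithmetic on lists may leave trailing zeros, so zero has many representations.\<close>

definition lzero :: "int list \<Rightarrow> bool" where
  "lzero xs \<longleftrightarrow> list_all (\<lambda>x. x = 0) xs"

text \<open>Equality with \<open>ps\<close> up to sign and a power of \<open>t\<close>: leading
  zeros are stripped as factors \<open>t\<close>. With \<open>[1]\<close> in place of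
  \<open>ps\<close> it recognizes units.\<close>

fun lassoc :: "int list \<Rightarrow> int list \<Rightarrow> bool" where
  "lassoc ps [] \<longleftrightarrow> False"
| "lassoc ps (x # xs) \<longleftrightarrow> (if x = 0 then lassoc ps xs
    else lzero (lsub (x # xs) ps) \<or> lzero (ladd (x # xs) ps))"

definition leval :: "laurent \<Rightarrow> int list \<Rightarrow> laurent" where
  "leval t xs = foldr (\<lambda>x r. of_int x + t * r) xs 0"

lemma leval_simps [simp]: "leval t [] = 0" "leval t (x # xs) = of_int x + t * leval t xs"
  by (simp_all add: leval_def)

lemma leval_ladd [simp]: "leval t (ladd xs ys) = leval t xs + leval t ys"
  by (induction xs ys rule: ladd.induct) (simp_all add: algebra_simps)

lemma leval_scale [simp]: "leval t (map ((*) x) ys) = of_int x * leval t ys"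
  by (induction ys) (simp_all add: algebra_simps)

lemma leval_uminus [simp]: "leval t (map uminus ys) = - leval t ys"
  by (induction ys) (simp_all add: algebra_simps)

lemma leval_lsub [simp]: "leval t (lsub xs ys) = leval t xs - leval t ys"
  by (simp add: lsub_def)

lemma leval_lmul [simp]: "leval t (lmul xs ys) = leval t xs * leval t ys"
  by (induction xs) (simp_all add: algebra_simps)

lemma leval_shift [simp]: "leval t (replicate g 0 @ xs) = t ^ g * leval t xs"
  by (induction g) (simp_all add: algebra_simps)

lemma leval_lzero: "lzero xs \<Longrightarrow> leval t xs = 0"
  by (induction xs) (simp_all add: lzero_def)

lemma leval_lassoc: "lassoc ps xs \<Longrightarrow> \<exists>e. leval t xs = t ^ e * leval t ps \<or> leval t xs = - (t ^ e * leval t ps)"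
proof (induction xs)
  case (Cons x xs)
  show ?case
  proof (cases "x = 0")
    case True
    then obtain e where "leval t xs = t ^ e * leval t ps \<or> leval t xs = - (t ^ e * leval t ps)"
      using Cons by auto
    then have "leval t (x # xs) = t ^ Suc e * leval t ps \<or> leval t (x # xs) = - (t ^ Suc e * leval t ps)"
      using True by (auto simp: mult.assoc)
    then show ?thesis by blast
  next
    case False
    then have "lzero (lsub (x # xs) ps) \<or> lzero (ladd (x # xs) ps)" using Cons.prems by simp
    then have "leval t (lsub (x # xs) ps) = 0 \<or> leval t (ladd (x # xs) ps) = 0"
      using leval_lzero by blast
    then have "leval t (x # xs) = leval t ps \<or> leval t (x # xs) = - leval t ps"
      unfolding leval_lsub leval_ladd by (simp only: right_minus_eq eq_neg_iff_add_eq_0)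
    then show ?thesis by (intro exI[of _ 0]) (simp only: power_0 mult_1_left)
  qed
qed simp

lemma laurent_unit_uminus: "laurent_unit f \<Longrightarrow> laurent_unit (- f)"
  by (auto simp: laurent_unit_def)

lemma laurent_unit_power: "laurent_unit f \<Longrightarrow> laurent_unit (f ^ n)"
  by (induction n) (simp_all add: laurent_unit_mult)

lemma leval_lassoc_1:
  assumes "lassoc [1] xs" "laurent_unit t"
  shows "laurent_unit (leval t xs)"
proof -
  have "laurent_unit (t ^ e)" "laurent_unit (- (t ^ e))" for e
    using assms(2) by (simp_all add: laurent_unit_uminus laurent_unit_power)
  then show ?thesis using leval_lassoc[OF assms(1), of t] by auto
qed

lemma leval_coeffs: "leval (mpow 1) (coeffs p) = laurent_of_poly p"
proof (induction p)
  case (pCons a p)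
  then show ?case by (auto simp: laurent_of_poly_pCons cCons_def split: if_splits)
qed simp

text \<open>
  The entry at \<open>k\<close> of a crossing table lists the sign, the incoming under-arc, the over-arc and the Alexander
  number of crossing \<open>k\<close>.
\<close>

type_synonym crossing_table = "(bool \<times> nat \<times> nat \<times> int) list"

text \<open>One walk compares the table with the current arc \<open>a\<close> and height
  \<open>h\<close>, instead of rotating the word anew for every \<open>under_arc\<close> and
  \<open>over_arc\<close>. The table holds one height per crossing, so agreement at both passages
  amounts to \<open>balanced\<close>.\<close>

fun table_scan :: "crossing_table \<Rightarrow> nat \<Rightarrow> int \<Rightarrow> gauss_word \<Rightarrow> bool" where
  "table_scan T a h [] \<longleftrightarrow> True"
| "table_scan T a h (Over k s # w) \<longleftrightarrow> k < length T \<and> (case T ! k of (s', u, v, h') \<Rightarrow>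
    s' = s \<and> v = a \<and> h' = h \<and> table_scan T a (if s then h + 1 else h - 1) w)"
| "table_scan T a h (Under k s # w) \<longleftrightarrow> k < length T \<and> (case T ! k of (s', u, v, h') \<Rightarrow>
    s' = s \<and> u = a \<and> h' = (if s then h - 1 else h + 1) \<and> table_scan T k h' w)"

definition list_permutes :: "nat \<Rightarrow> nat list \<Rightarrow> bool" where
  "list_permutes N xs \<longleftrightarrow> length xs = N \<and> distinct xs \<and> list_all (\<lambda>i. i < N) xs"

text \<open>The value of a row on \<open>X\<close>, multiplied by \<open>t\<close> at a negative
  crossing so that no negative exponents arise.\<close>

definition crossing_row :: "crossing_table \<Rightarrow> nat \<Rightarrow> int list list \<Rightarrow> int list" where
  "crossing_row T k X = (case T ! k of (s, u, v, h) \<Rightarrow>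
     if s then ladd (0 # lsub (X ! u) (X ! v)) (lsub (X ! v) (X ! k))
     else ladd (lsub (X ! u) (X ! v)) (0 # lsub (X ! v) (X ! k)))"

text \<open>Earlier pivot columns, listed in \<open>seen\<close>, must not occur in the row. The
  entry at \<open>c\<close> is a unit if \<open>c\<close> is exactly one of the two under-arcs and
  not the over-arc, whose coefficient is not a unit.\<close>

definition pivot_row :: "crossing_table \<Rightarrow> nat list \<Rightarrow> nat \<Rightarrow> nat \<Rightarrow> bool" where
  "pivot_row T seen c k = (case T ! k of (s, u, v, h) \<Rightarrow>
     u \<notin> set seen \<and> v \<notin> set seen \<and> k \<notin> set seen \<and> v \<noteq> c \<and> (u = c) \<noteq> (k = c))"

type_synonym certificate =
  "crossing_table \<times> nat list \<times> nat list \<times> nat \<times> int list \<times> int list list \<times> int list list"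

text \<open>
  A certificate consists of a crossing table, orders of the rows and of the columns, the coefficients \<open>t\<^sup>g\<close> and \<open>F\<close>
  of the combined row, and the two vectors of the type I criterion, indexed by arcs.
\<close>

fun certifies :: "certificate \<Rightarrow> gauss_word \<Rightarrow> int list \<Rightarrow> bool" where
  "certifies (T, rs, cs, g, F, X, Z) w ps \<longleftrightarrow> (let M = length T - 3; R = crossing_row T;
       C = (\<lambda>Y. ladd (replicate g 0 @ R (rs ! M) Y) (lmul F (R (rs ! (M + 1)) Y))) in
     length T \<ge> 3 \<and> length w = 2 * length T \<and> distinct w \<and>
     table_scan T (crossing (last (filter is_under w))) 0 w \<and>
     list_permutes (length T) rs \<and> list_permutes (length T) cs \<and>
     list_all (\<lambda>i. pivot_row T (take i cs) (cs ! i) (rs ! i) \<and> lzero (R (rs ! i) X) \<and> lzero (R (rs ! i) Z)) [0..<M] \<and>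
     lassoc [1] (X ! (cs ! M)) \<and> lzero (X ! (cs ! (M + 1))) \<and> lzero (X ! (cs ! (M + 2))) \<and>
     lassoc [1] (Z ! (cs ! (M + 1))) \<and> lzero (Z ! (cs ! (M + 2))) \<and>
     lassoc [1] (C X) \<and> lzero (C Z) \<and> lassoc ps (R (rs ! (M + 1)) Z))"

section \<open>Soundness of certificates\<close>

lemma list_permutes_imp_permutes:
  assumes "list_permutes N xs"
  shows "(\<lambda>i. if i < N then xs ! i else i) permutes {..<N}"
proof -
  have x: "length xs = N" "distinct xs" "set xs \<subseteq> {..<N}"
    using assms by (auto simp: list_permutes_def list_all_iff)
  then have "set xs = {..<N}" by (intro card_subset_eq) (simp_all add: distinct_card)
  then have "bij_betw ((!) xs) {..<N} {..<N}"
    by (intro bij_betw_nth[OF x(2)]) (simp_all add: x(1))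
  then have "bij_betw (\<lambda>i. if i < N then xs ! i else i) {..<N} {..<N}"
    by (subst bij_betw_cong[where g = "(!) xs"]) auto
  then show ?thesis by (rule bij_imp_permutes) auto
qed

lemma table_scan_mem:
  "table_scan T a h w \<Longrightarrow> x \<in> set w \<Longrightarrow> crossing x < length T \<and> positive x = fst (T ! crossing x)"
proof (induction w arbitrary: a h rule: word_induct)
  case (Over k s w)
  then show ?case by (cases "T ! k") (auto split: if_splits)
next
  case (Under k s w)
  then show ?case by (cases "T ! k") auto
qed simp

text \<open>The table admits at most twice as many passages as it has crossings, and
  \<open>w\<close> consists of that many distinct ones, so all of them occur.\<close>

lemma table_scan_valid:
  assumes "table_scan T a h w" "length w = 2 * length T" "distinct w" "T \<noteq> []"
  shows "valid_word w" "crossings w = length T"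
proof -
  show N: "crossings w = length T" using assms(2) by (simp add: crossings_def)
  let ?U = "\<Union>k<crossings w. {Over k (fst (T ! k)), Under k (fst (T ! k))}"
  have "set w \<subseteq> ?U"
  proof
    fix x assume "x \<in> set w"
    then have x: "crossing x < length T" "positive x = fst (T ! crossing x)"
      using table_scan_mem[OF assms(1)] by blast+
    from x(2) have "x \<in> {Over (crossing x) (fst (T ! crossing x)), Under (crossing x) (fst (T ! crossing x))}"
      by (cases x) auto
    then show "x \<in> ?U" using x(1) unfolding N by (intro UN_I[of "crossing x"]) auto
  qed
  moreover have "card ?U \<le> card (set w)"
  proof -
    have "card ?U \<le> (\<Sum>k<crossings w. card {Over k (fst (T ! k)), Under k (fst (T ! k))})"
      by (rule card_UN_le) simp
    also have "\<dots> = (\<Sum>k<crossings w. 2)" by (rule sum.cong) auto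
    also have "\<dots> = card (set w)" using assms(2,3) N by (simp add: distinct_card)
    finally show ?thesis .
  qed
  ultimately have "set w = ?U" by (intro card_seteq) auto
  then have "\<exists>\<epsilon>. set w = (\<Union>k<crossings w. {Over k (\<epsilon> k), Under k (\<epsilon> k)})"
    by (rule exI[of _ "\<lambda>k. fst (T ! k)"])
  then show "valid_word w" using assms(3,4) N by (simp add: valid_word_def Suc_le_eq)
qed

lemma table_scan_positions:
  assumes s: "table_scan T (crossing (last (filter is_under w))) 0 w" and v: "valid_word w"
    and i: "i < length w"
  shows "case T ! crossing (w ! i) of (s, a, b, h) \<Rightarrow>
    s = positive (w ! i) \<and> (if is_over (w ! i) then b = arc_into w (w ! i) \<and> h = height w i
      else a = arc_into w (w ! i) \<and> h = height w (Suc i))"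
proof -
  have d: "distinct w" using v by (rule valid_word_distinct)
  have scan: "i < length w \<Longrightarrow> table_scan T (arc_into w (w ! i)) (height w i) (drop i w)" for i
  proof (induction i)
    case 0
    then have "arc_into w (w ! 0) = crossing (last (filter is_under w))"
      using read_from_nth[OF d, of 0] by (simp add: arc_into_def)
    then show ?case using s by (simp add: height_0)
  next
    case (Suc i)
    then have i: "i < length w" by simp
    have "drop i w = w ! i # drop (Suc i) w" using i by (simp add: Cons_nth_drop_Suc)
    then have t: "table_scan T (arc_into w (w ! i)) (height w i) (w ! i # drop (Suc i) w)"
      using Suc by simp
    have "arc_into w (w ! Suc i) = (if is_under (w ! i) then crossing (w ! i) else arc_into w (w ! i))"
      using arc_into_Suc[OF d i] Suc.prems by simp
    then show ?case
      using t height_Suc[OF i] by (cases "w ! i") (auto split: prod.splits if_splits)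
  qed
  have "drop i w = w ! i # drop (Suc i) w" using i by (simp add: Cons_nth_drop_Suc)
  then have "table_scan T (arc_into w (w ! i)) (height w i) (w ! i # drop (Suc i) w)"
    using scan[OF i] by simp
  then show ?thesis
    using height_Suc[OF i] by (cases "w ! i") (auto split: prod.splits if_splits)
qed

lemma table_scan_entry:
  assumes s: "table_scan T (crossing (last (filter is_under w))) 0 w" and v: "valid_word w"
    and k: "k < crossings w"
  shows "\<exists>h. T ! k = (is_positive w k, under_arc w k, over_arc w k, h)"
proof -
  obtain i j where ij: "i < length w" "w ! i = Over k (is_positive w k)"
    "j < length w" "w ! j = Under k (is_positive w k)"
    using valid_word_positions[OF v k] by metis
  show ?thesis
    using table_scan_positions[OF s v ij(1)] table_scan_positions[OF s v ij(3)] ij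
    by (cases "T ! k") (simp add: under_arc_def over_arc_def)
qed

lemma table_scan_balanced:
  assumes s: "table_scan T (crossing (last (filter is_under w))) 0 w" and v: "valid_word w"
  shows "balanced w"
  unfolding balanced_def
proof (intro allI impI)
  fix i j assume ij: "i < length w" "j < length w" "is_over (w ! i)" "is_under (w ! j)"
    "crossing (w ! i) = crossing (w ! j)"
  then have "\<not> is_over (w ! j)" by (cases "w ! j") auto
  then show "height w i = height w (Suc j)"
    using table_scan_positions[OF s v ij(1)] table_scan_positions[OF s v ij(2)] ij(3,5)
    by (cases "T ! crossing (w ! j)") simp
qed

text \<open>The colouring matrix of a diagram and, with \<open>e = -1\<close>, of its mirror image.\<close>

definition oriented_entry :: "int \<Rightarrow> gauss_word \<Rightarrow> nat \<Rightarrow> nat \<Rightarrow> laurent" where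
  "oriented_entry e w k j = (let \<mu> = mpow (if is_positive w k then e else - e) in
     (if j = under_arc w k then \<mu> else 0) + (if j = over_arc w k then 1 - \<mu> else 0) - (if j = k then 1 else 0))"

lemma oriented_entry_colouring_matrix:
  assumes "valid_word w" "k < crossings w" "j < crossings w"
  shows "colouring_matrix w $$ (k, j) = oriented_entry 1 w k j"
    and "colouring_matrix (map reflect w) $$ (k, j) = oriented_entry (- 1) w k j"
  using assms colouring_matrix_index[of k w j] colouring_matrix_index[of k "map reflect w" j]
  by (simp_all add: oriented_entry_def is_positive_reflect arcs_reflect)

text \<open>One list computation serves the diagram and its mirror image, since only the meaning of
  \<open>t\<close> differs. The columns are permuted by \<open>cs\<close>, yet \<open>X\<close> and
  \<open>Z\<close> stay indexed by arcs, as the value of a row on a vector does not depend on the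
  order of summation.\<close>

theorem certificate_type_I:
  assumes c: "certifies (T, rs, cs, g, F, X, Z) w ps" and v: "valid_word w" and N: "crossings w = M + 3"
    and null: "\<And>j. j < crossings w \<Longrightarrow> (\<Sum>k<crossings w. mpow (H k) * oriented_entry e w k j) = 0"
    and A: "A = mat (crossings w) (crossings w) (\<lambda>(i, j). oriented_entry e w (rs ! i) (cs ! j))"
  obtains B u where "equivalent_matrix A B" "type_I B" "B \<in> carrier_mat (M + 3) (M + 3)"
    "laurent_unit u" "B $$ (M + 1, M + 1) = u * leval (mpow e) ps"
proof -
  let ?N = "crossings w" and ?t = "mpow e"
  let ?R = "crossing_row T"
  have T: "length T = ?N" and s: "table_scan T (crossing (last (filter is_under w))) 0 w"
    using c by (auto simp: Let_def crossings_def)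
  then have M: "length T - 3 = M" using N by simp
  note c' = c[unfolded certifies.simps Let_def M]
  have rs: "list_permutes ?N rs" and cs: "list_permutes ?N cs" using c' T by auto
  define \<rho> where "\<rho> i = (if i < ?N then rs ! i else i)" for i
  define \<sigma> where "\<sigma> j = (if j < ?N then cs ! j else j)" for j
  have p: "\<rho> permutes {..<?N}" "\<sigma> permutes {..<?N}"
    using list_permutes_imp_permutes[OF rs] list_permutes_imp_permutes[OF cs]
    unfolding \<rho>_def[abs_def] \<sigma>_def[abs_def] by simp_all
  have less: "\<rho> i < ?N" "\<sigma> i < ?N" if "i < ?N" for i
    using permutes_in_image[OF p(1), of i] permutes_in_image[OF p(2), of i] that by simp_all
  have \<rho>: "\<rho> i = rs ! i" "\<sigma> i = cs ! i" if "i < ?N" for i using that by (simp_all add: \<rho>_def \<sigma>_def)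
  have entry: "\<exists>h. T ! k = (is_positive w k, under_arc w k, over_arc w k, h)" if "k < ?N" for k
    using table_scan_entry[OF s v that] .
  have Ac: "A \<in> carrier_mat (M + 3) (M + 3)" by (simp add: A N)
  have Aij: "A $$ (i, j) = oriented_entry e w (\<rho> i) (\<sigma> j)" if "i < ?N" "j < ?N" for i j
    using that by (simp add: A \<rho>)
  \<comment> \<open>The factor that \<open>crossing_row\<close> has put on the row of crossing
    \<open>k\<close>.\<close>
  define \<delta> where "\<delta> k = (if is_positive w k then 1 else ?t)" for k
  have \<delta>: "laurent_unit (\<delta> k)" for k by (simp add: \<delta>_def)
  have row: "row_value A i (\<lambda>j. Y (\<sigma> j)) = mpow (if is_positive w (\<rho> i) then e else - e) * Y (under_arc w (\<rho> i))
      + (1 - mpow (if is_positive w (\<rho> i) then e else - e)) * Y (over_arc w (\<rho> i)) - 1 * Y (\<rho> i)"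
    if i: "i < ?N" for i Y
  proof -
    have dc: "dim_col A = ?N" by (simp add: A)
    have "row_value A i (\<lambda>j. Y (\<sigma> j)) = (\<Sum>j<?N. oriented_entry e w (\<rho> i) (\<sigma> j) * Y (\<sigma> j))"
      unfolding row_value_def dc by (rule sum.cong) (simp_all add: Aij i)
    also have "\<dots> = (\<Sum>j<?N. oriented_entry e w (\<rho> i) j * Y j)"
      using sum.permute[OF p(2), of "\<lambda>j. oriented_entry e w (\<rho> i) j * Y j"] by (simp only: comp_def)
    finally have eq: "row_value A i (\<lambda>j. Y (\<sigma> j)) = (\<Sum>j<?N. oriented_entry e w (\<rho> i) j * Y j)" .
    show ?thesis
      unfolding eq oriented_entry_def Let_def
      by (rule sum_sparse_row[OF under_arc_less[OF v less(1)[OF i]] over_arc_less[OF v less(1)[OF i]] less(1)[OF i]])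
  qed
  have rowR: "\<delta> (\<rho> i) * row_value A i (\<lambda>j. leval ?t (Y ! \<sigma> j)) = leval ?t (?R (\<rho> i) Y)" if i: "i < ?N" for i Y
  proof -
    obtain h where "T ! \<rho> i = (is_positive w (\<rho> i), under_arc w (\<rho> i), over_arc w (\<rho> i), h)"
      using entry less(1)[OF i] by blast
    then show ?thesis
      unfolding row[OF i, of "\<lambda>j. leval ?t (Y ! j)"] crossing_row_def \<delta>_def
      by (cases "is_positive w (\<rho> i)") (simp_all add: algebra_simps mult.assoc[symmetric])
  qed
  have zero: "row_value A i (\<lambda>j. leval ?t (Y ! \<sigma> j)) = 0" if "i < ?N" "leval ?t (?R (\<rho> i) Y) = 0" for i Y
  proof -
    obtain \<delta>' where "\<delta>' * \<delta> (\<rho> i) = 1" using laurent_unit_inverse[OF \<delta>] by blast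
    then have "row_value A i (\<lambda>j. leval ?t (Y ! \<sigma> j)) = \<delta>' * (\<delta> (\<rho> i) * row_value A i (\<lambda>j. leval ?t (Y ! \<sigma> j)))"
      by (simp only: mult.assoc[symmetric] mult_1_left)
    then show ?thesis using rowR[OF that(1), of Y] that(2) by simp
  qed
  have piv: "pivot_row T (take i cs) (cs ! i) (rs ! i)" "lzero (?R (rs ! i) X)" "lzero (?R (rs ! i) Z)" if "i < M" for i
    using c' that by (auto simp: list_all_iff)
  let ?x = "\<lambda>j. leval ?t (X ! \<sigma> j)" and ?z = "\<lambda>j. leval ?t (Z ! \<sigma> j)"
  \<comment> \<open>The certificate combines cleared rows. In terms of the rows of \<open>A\<close>
    the factors \<open>\<delta>\<close> move into the coefficients, and \<open>?g\<close> remains a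
    unit.\<close>
  let ?g = "?t ^ g * \<delta> (\<rho> M)" and ?f = "leval ?t F * \<delta> (\<rho> (M + 1))"
  have comb: "?g * row_value A M (\<lambda>j. leval ?t (Y ! \<sigma> j)) + ?f * row_value A (M + 1) (\<lambda>j. leval ?t (Y ! \<sigma> j)) =
      leval ?t (ladd (replicate g 0 @ ?R (rs ! M) Y) (lmul F (?R (rs ! (M + 1)) Y)))" for Y
    using rowR[of M Y] rowR[of "M + 1" Y] \<rho>(1)[of M] \<rho>(1)[of "M + 1"] N by (simp add: mult.assoc)
  obtain B u where B: "equivalent_matrix A B" "type_I B" "B \<in> carrier_mat (M + 3) (M + 3)"
    "laurent_unit u" "B $$ (M + 1, M + 1) = u * row_value A (M + 1) ?z"
  proof (rule type_I_certificate[OF Ac, where u = "\<lambda>i. mpow (H (\<rho> i))" and g = ?g and f = ?f and x = ?x and z = ?z])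
    show "(\<Sum>i<M + 3. mpow (H (\<rho> i)) * A $$ (i, j)) = 0" if j: "j < M + 3" for j
    proof -
      have "(\<Sum>i<?N. mpow (H (\<rho> i)) * A $$ (i, j)) = (\<Sum>i<?N. mpow (H (\<rho> i)) * oriented_entry e w (\<rho> i) (\<sigma> j))"
        by (rule sum.cong) (use j N Aij in auto)
      also have "\<dots> = (\<Sum>k<?N. mpow (H k) * oriented_entry e w k (\<sigma> j))"
        using sum.permute[OF p(1), of "\<lambda>k. mpow (H k) * oriented_entry e w k (\<sigma> j)"] by (simp only: comp_def)
      also have "\<dots> = 0" by (rule null) (use less j N in simp)
      finally show ?thesis by (simp only: N)
    qed
    show "row_value A i (\<lambda>_. 1) = 0" if "i < M + 3" for i
      using row[of i "\<lambda>_. 1"] that N by simp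
    show "A $$ (i, j) = 0" if ji: "j < i" "i < M" for i j
    proof -
      have i: "i < ?N" "j < ?N" using ji N by simp_all
      have "length cs = ?N" using cs by (simp add: list_permutes_def)
      then have "\<sigma> j = take i cs ! j" "j < length (take i cs)" using \<rho>(2)[OF i(2)] ji(1) i(1) by simp_all
      then have "\<sigma> j \<in> set (take i cs)" by (simp only: nth_mem)
      moreover obtain h where h: "T ! \<rho> i = (is_positive w (\<rho> i), under_arc w (\<rho> i), over_arc w (\<rho> i), h)"
        using entry less(1)[OF i(1)] by blast
      moreover have "pivot_row T (take i cs) (\<sigma> i) (\<rho> i)" using piv(1)[OF ji(2)] by (simp only: \<rho>[OF i(1)])
      then have "under_arc w (\<rho> i) \<notin> set (take i cs)" "over_arc w (\<rho> i) \<notin> set (take i cs)" "\<rho> i \<notin> set (take i cs)"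
        unfolding pivot_row_def h prod.case by blast+
      ultimately have "\<sigma> j \<noteq> under_arc w (\<rho> i)" "\<sigma> j \<noteq> over_arc w (\<rho> i)" "\<sigma> j \<noteq> \<rho> i"
        by metis+
      then show ?thesis by (simp add: Aij[OF i] oriented_entry_def)
    qed
    show "laurent_unit (A $$ (i, i))" if iM: "i < M" for i
    proof -
      have i: "i < ?N" using iM N by simp
      obtain h where h: "T ! \<rho> i = (is_positive w (\<rho> i), under_arc w (\<rho> i), over_arc w (\<rho> i), h)"
        using entry less(1)[OF i] by blast
      have "pivot_row T (take i cs) (\<sigma> i) (\<rho> i)" using piv(1)[OF iM] by (simp only: \<rho>[OF i])
      then have q: "over_arc w (\<rho> i) \<noteq> \<sigma> i" "(under_arc w (\<rho> i) = \<sigma> i) \<noteq> (\<rho> i = \<sigma> i)"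
        unfolding pivot_row_def h prod.case by blast+
      have "\<sigma> i \<noteq> over_arc w (\<rho> i)" "(\<sigma> i = under_arc w (\<rho> i)) \<noteq> (\<sigma> i = \<rho> i)"
        using q unfolding eq_commute[of "\<sigma> i"] by blast+
      then show ?thesis
        by (cases "\<sigma> i = \<rho> i") (simp_all add: Aij[OF i i] oriented_entry_def laurent_unit_uminus)
    qed
    show "laurent_unit ?g" by (intro laurent_unit_mult laurent_unit_power laurent_unit_mpow \<delta>)
    show "laurent_unit (mpow (H (\<rho> (M + 2))))" by simp
    show "row_value A i ?x = 0" "row_value A i ?z = 0" if "i < M" for i
      using zero[of i X] zero[of i Z] piv(2,3)[OF that] \<rho>(1)[of i] that N by (simp_all add: leval_lzero)
    have \<sigma>: "\<sigma> M = cs ! M" "\<sigma> (M + 1) = cs ! (M + 1)" "\<sigma> (M + 2) = cs ! (M + 2)"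
      using \<rho>(2) N by simp_all
    show "laurent_unit (?x M)" "?x (M + 1) = 0" "?x (M + 2) = 0" "laurent_unit (?z (M + 1))" "?z (M + 2) = 0"
      unfolding \<sigma> using c' by (simp_all add: leval_lassoc_1 leval_lzero)
    show "laurent_unit (?g * row_value A M ?x + ?f * row_value A (M + 1) ?x)"
      "?g * row_value A M ?z + ?f * row_value A (M + 1) ?z = 0"
      unfolding comb using c' by (blast intro: leval_lassoc_1[OF _ laurent_unit_mpow] leval_lzero)+
  qed (rule that)
  have "lassoc ps (?R (rs ! (M + 1)) Z)" using c' by blast
  then obtain d where d: "leval ?t (?R (\<rho> (M + 1)) Z) = ?t ^ d * leval ?t ps \<or>
      leval ?t (?R (\<rho> (M + 1)) Z) = - (?t ^ d * leval ?t ps)"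
    using leval_lassoc \<rho>(1)[of "M + 1"] N by fastforce
  obtain \<delta>' where \<delta>': "laurent_unit \<delta>'" "\<delta>' * \<delta> (\<rho> (M + 1)) = 1" using laurent_unit_inverse[OF \<delta>] by blast
  have "row_value A (M + 1) ?z = \<delta>' * (\<delta> (\<rho> (M + 1)) * row_value A (M + 1) ?z)"
    using \<delta>'(2) by (simp only: mult.assoc[symmetric] mult_1_left)
  also have "\<dots> = \<delta>' * leval ?t (?R (\<rho> (M + 1)) Z)" using rowR[of "M + 1" Z] N by simp
  finally have z: "row_value A (M + 1) ?z = \<delta>' * ?t ^ d * leval ?t ps \<or>
      row_value A (M + 1) ?z = - (\<delta>' * ?t ^ d) * leval ?t ps"
    using d by (auto simp: mult.assoc)
  have td: "laurent_unit (\<delta>' * ?t ^ d)"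
    by (intro laurent_unit_mult \<delta>'(1) laurent_unit_power laurent_unit_mpow)
  have unit: "laurent_unit (u * (\<delta>' * ?t ^ d))" "laurent_unit (u * - (\<delta>' * ?t ^ d))"
    by (intro laurent_unit_mult laurent_unit_uminus B(4) td)+
  show ?thesis
    using z unit B(5) that[OF B(1-3) unit(1)] that[OF B(1-3) unit(2)] by (auto simp: mult.assoc)
qed

text \<open>The certificate is read with \<open>t = m\<close> and with \<open>t = m^-1\<close>,
  because mirror images and reversed diagrams need the second matrix. The relation between the rows
  is not certified; it follows from \<open>balanced\<close>, which reflection preserves.\<close>

theorem certifies_sound:
  assumes c: "certifies (T, rs, cs, g, F, X, Z) w (coeffs p)"
  shows "valid_word w" "balanced w" "colour_count w p" "type_I_diagram w" "type_I_diagram (map reflect w)"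
proof -
  have s: "table_scan T (crossing (last (filter is_under w))) 0 w" "length w = 2 * length T" "distinct w"
    "length T \<ge> 3" "list_permutes (length T) rs" "list_permutes (length T) cs"
    using c by (simp_all add: Let_def)
  have "T \<noteq> []" using s(4) by auto
  then show v: "valid_word w" using table_scan_valid[OF s(1-3)] by blast
  have N: "crossings w = length T" using s(2) by (simp add: crossings_def)
  define M where "M = length T - 3"
  have NM: "crossings w = M + 3" using s(4) N by (simp add: M_def)
  show b: "balanced w" by (rule table_scan_balanced[OF s(1) v])
  let ?\<rho> = "\<lambda>i. if i < crossings w then rs ! i else i" and ?\<sigma> = "\<lambda>i. if i < crossings w then cs ! i else i"
  have p: "?\<rho> permutes {..<crossings w}" "?\<sigma> permutes {..<crossings w}"
    using list_permutes_imp_permutes s(5,6) unfolding N by blast+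
  have less: "rs ! i < crossings w" "cs ! i < crossings w" if "i < crossings w" for i
    using s(5,6) that unfolding N list_permutes_def list_all_iff by auto
  define A where "A e = mat (crossings w) (crossings w) (\<lambda>(i, j). oriented_entry e w (rs ! i) (cs ! j))" for e
  have A1: "A 1 \<in> colouring_matrices w"
    unfolding colouring_matrices_def mem_Collect_eq
    by (rule exI[of _ ?\<rho>], rule exI[of _ ?\<sigma>], intro conjI p)
       (rule eq_matI, auto simp: A_def less oriented_entry_colouring_matrix(1)[OF v])
  have A2: "A (- 1) \<in> colouring_matrices (map reflect w)"
    unfolding colouring_matrices_def mem_Collect_eq crossings_map_reflect
    by (rule exI[of _ ?\<rho>], rule exI[of _ ?\<sigma>], intro conjI p)
       (rule eq_matI, auto simp: A_def less oriented_entry_colouring_matrix(2)[OF v])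
  obtain H where H: "\<And>j. j < crossings w \<Longrightarrow> (\<Sum>k<crossings w. mpow (H k) * colouring_matrix w $$ (k, j)) = 0"
    using balanced_row_relation[OF v b] by blast
  have H1: "(\<Sum>k<crossings w. mpow (H k) * oriented_entry 1 w k j) = 0" if "j < crossings w" for j
    using H[OF that] oriented_entry_colouring_matrix(1)[OF v _ that] by simp
  obtain H' where H': "\<And>j. j < crossings (map reflect w) \<Longrightarrow>
      (\<Sum>k<crossings (map reflect w). mpow (H' k) * colouring_matrix (map reflect w) $$ (k, j)) = 0"
    using balanced_row_relation[OF valid_word_reflect[OF v] balanced_reflect[OF b]] by blast
  have H2: "(\<Sum>k<crossings w. mpow (H' k) * oriented_entry (- 1) w k j) = 0" if "j < crossings w" for j
    using H'[of j] oriented_entry_colouring_matrix(2)[OF v _ that] that by simp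
  obtain B u where B: "equivalent_matrix (A 1) B" "type_I B" "B \<in> carrier_mat (M + 3) (M + 3)"
    "laurent_unit u" "B $$ (M + 1, M + 1) = u * leval (mpow 1) (coeffs p)"
    using certificate_type_I[OF c v NM H1 A_def] by blast
  show "type_I_diagram w" using A1 B(1,2) by (auto simp: type_I_diagram_def)
  have "B \<in> carrier_mat (Suc M + 2) (Suc M + 2)" "B $$ (Suc M, Suc M) = u * laurent_of_poly p"
    using B(3,5) by (simp_all add: leval_coeffs numeral_3_eq_3)
  then show "colour_count w p" using type_I_colour_count[OF v A1 B(1,2) _ B(4)] by blast
  obtain B' u' where "equivalent_matrix (A (- 1)) B'" "type_I B'"
    using certificate_type_I[OF c v NM H2 A_def] by blast
  then show "type_I_diagram (map reflect w)" using A2 by (auto simp: type_I_diagram_def)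
qed

section \<open>Certificates of the knots\<close>

definition rolfsen_ok :: "nat \<times> nat \<Rightarrow> int poly \<Rightarrow> bool" where
  "rolfsen_ok k p \<longleftrightarrow> coeff p 0 > 0 \<and> reflect_poly p = p \<and> (\<exists>c. certifies c (rolfsen_diagram k) (coeffs p))"

lemma certifies_rolfsen:
  assumes "coeff p 0 > 0" "rev (coeffs p) = coeffs p" "certifies (T, rs, cs, g, F, X, Z) (rolfsen_diagram k) (coeffs p)"
  shows "rolfsen_ok k p"
proof -
  have "reflect_poly p = p"
    using assms(2) by (simp add: reflect_poly_def)
  then show ?thesis using assms unfolding rolfsen_ok_def by blast
qed

text \<open>\<open>X\<close> is prescribed on the last three arcs of \<open>cs\<close> and
  \<open>Z\<close> on the last two; solving the rows upwards gives the rest. Starting with a power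
  of \<open>t\<close>, as \<open>Z\<close> does here, keeps the entries polynomial. If
  \<open>F\<close> is empty and \<open>g\<close> is 0, as in all but three certificates, the row
  \<open>rs ! M\<close> itself supplies the last unit pivot.\<close>

lemma rolfsen_5_1: "rolfsen_ok (5, 1) [:1, -1, 1, -1, 1:]"
  by (rule certifies_rolfsen[where
        T = "[(False, 3, 4, 1), (False, 4, 0, 1), (False, 0, 1, 1), (False, 1, 2, 1), (False, 2, 3, 1)]" and
        rs = "[2, 1, 0, 3, 4]" and cs = "[2, 4, 3, 0, 1]" and
        g = 0 and F = "[]" and
        X = "[[], [], [], [1], []]" and
        Z = "[[0, 1], [], [1], [0, 1, -1, 1], [0, 1, -1]]"]) code_simp+

lemma rolfsen_10_132: "rolfsen_ok (10, 132) [:1, -1, 1, -1, 1:]"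
  by (rule certifies_rolfsen[where
        T = "[(False, 6, 9, 1), (False, 9, 0, 1), (True, 0, 5, -1), (True, 5, 2, -1), (True, 2, 3, -1), (False, 4, 8, 0), (False, 8, 5, 0), (False, 3, 8, 1), (False, 1, 7, 1), (False, 7, 1, 1)]" and
        rs = "[4, 3, 7, 8, 0, 9, 1, 5, 2, 6]" and cs = "[4, 5, 3, 8, 6, 7, 9, 2, 0, 1]" and
        g = 0 and F = "[]" and
        X = "[[], [], [0, 1], [], [0, 0, 1], [-1, 1], [], [], [], []]" and
        Z = "[[1], [], [-1, 2, 0, -1], [-1, 3, -2], [-1, 3, -3, 2, -1], [0, 0, 1, -1], [1, -1, 1], [0, 1, -1], [-1, 2, -1], [1, -1]]"]) code_simp+

lemma rolfsen_7_4: "rolfsen_ok (7, 4) [:4, -7, 4:]"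
  by (rule certifies_rolfsen[where
        T = "[(True, 5, 1, -1), (True, 6, 0, -1), (True, 0, 6, -1), (True, 1, 2, -1), (True, 2, 5, -1), (True, 3, 4, -1), (True, 4, 3, -1)]" and
        rs = "[4, 2, 1, 0, 3, 5, 6]" and cs = "[4, 2, 6, 5, 3, 0, 1]" and
        g = 0 and F = "[]" and
        X = "[[], [], [], [1], [], [], []]" and
        Z = "[[0, 1], [], [-1, 2], [-1, 3, -2], [1, -2, 2], [1], [-1, 1]]"]) code_simp+

lemma rolfsen_9_2: "rolfsen_ok (9, 2) [:4, -7, 4:]"
  by (rule certifies_rolfsen[where
        T = "[(False, 7, 1, 1), (False, 3, 0, 1), (False, 0, 3, 1), (False, 5, 2, 1), (False, 2, 5, 1), (False, 8, 4, 1), (False, 4, 8, 1), (False, 1, 6, 1), (False, 6, 7, 1)]" and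
        rs = "[5, 4, 3, 2, 1, 0, 6, 7, 8]" and cs = "[8, 4, 5, 2, 3, 7, 6, 0, 1]" and
        g = 0 and F = "[]" and
        X = "[[], [], [], [], [], [], [1], [], []]" and
        Z = "[[1], [], [2, -1], [1, -1], [3, -2], [2, -2], [4, -3], [0, 1], [3, -3]]"]) code_simp+

lemma rolfsen_7_5: "rolfsen_ok (7, 5) [:2, -4, 5, -4, 2:]"
  by (rule certifies_rolfsen[where
        T = "[(False, 5, 3, 1), (False, 3, 0, 1), (False, 0, 1, 1), (False, 6, 2, 1), (False, 2, 6, 1), (False, 1, 4, 1), (False, 4, 5, 1)]" and
        rs = "[4, 3, 2, 1, 0, 5, 6]" and cs = "[4, 6, 2, 3, 5, 0, 1]" and
        g = 0 and F = "[]" and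
        X = "[[], [], [], [], [], [1], []]" and
        Z = "[[0, 1], [], [1], [0, 1, -1], [2, -2, 2, -1], [0, 1, -1, 1], [1, -1, 1, -1]]"]) code_simp+

lemma rolfsen_10_130: "rolfsen_ok (10, 130) [:2, -4, 5, -4, 2:]"
  by (rule certifies_rolfsen[where
        T = "[(False, 8, 1, 1), (False, 9, 0, 1), (False, 0, 9, 1), (False, 1, 2, 1), (True, 2, 7, -1), (True, 7, 4, -1), (True, 4, 5, -1), (False, 6, 3, 0), (False, 3, 7, 0), (False, 5, 3, 1)]" and
        rs = "[4, 9, 7, 3, 2, 1, 0, 6, 5, 8]" and cs = "[4, 5, 7, 3, 2, 9, 8, 6, 1, 0]" and
        g = 0 and F = "[]" and
        X = "[[], [], [], [], [1, -1], [], [0, 1], [1], [], []]" and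
        Z = "[[], [0, 0, 1], [0, 0, -1, 1], [0, 2, -2, 1], [-2, 6, -7, 3], [0, 2, -4, 3], [], [-2, 4, -3, 1], [0, 0, 1, -1], [0, 0, 0, 1]]"]) code_simp+

lemma rolfsen_7_6: "rolfsen_ok (7, 6) [:1, -5, 7, -5, 1:]"
  by (rule certifies_rolfsen[where
        T = "[(False, 3, 1, 1), (False, 5, 0, 1), (False, 0, 4, 1), (False, 6, 2, 1), (False, 2, 3, 1), (True, 4, 6, -1), (True, 1, 5, -1)]" and
        rs = "[6, 5, 4, 3, 2, 0, 1]" and cs = "[1, 5, 4, 6, 0, 2, 3]" and
        g = 0 and F = "[]" and
        X = "[[1], [], [], [], [], [], []]" and
        Z = "[[1, -1, 1], [-1, 3, -3, 1], [0, 1], [], [1], [0, 2, -2, 1], [0, 1, -1]]"]) code_simp+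

lemma rolfsen_10_133: "rolfsen_ok (10, 133) [:1, -5, 7, -5, 1:]"
  by (rule certifies_rolfsen[where
        T = "[(False, 4, 9, 1), (False, 9, 0, 1), (False, 0, 6, 1), (False, 6, 2, 1), (True, 8, 2, 0), (True, 2, 8, 0), (False, 5, 3, 1), (False, 3, 8, 1), (False, 1, 7, 1), (False, 7, 1, 1)]" and
        rs = "[4, 2, 5, 6, 7, 9, 8, 3, 0, 1]" and cs = "[4, 0, 2, 5, 3, 9, 8, 6, 1, 7]" and
        g = 0 and F = "[]" and
        X = "[[1], [], [1], [], [1, -1], [0, 1], [1], [], [], []]" and
        Z = "[[-1, 3, -3, 1], [0, 0, 1], [-1, 2, -1], [0, 1, -1], [-1, 3, -2, 1], [0, 0, 1, -1], [-1, 3, -2], [], [0, 1], [0, -1, 1]]"]) code_simp+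

lemma rolfsen_8_3: "rolfsen_ok (8, 3) [:4, -9, 4:]"
  by (rule certifies_rolfsen[where
        T = "[(False, 5, 1, 1), (False, 3, 0, 1), (False, 0, 3, 1), (False, 6, 2, 1), (True, 2, 5, -1), (True, 7, 4, -1), (True, 4, 7, -1), (True, 1, 6, -1)]" and
        rs = "[5, 4, 2, 1, 0, 3, 6, 7]" and cs = "[7, 4, 2, 3, 5, 6, 0, 1]" and
        g = 0 and F = "[]" and
        X = "[[], [], [], [], [], [], [1], []]" and
        Z = "[[1], [], [2, -1], [1, -1], [0, 3, -2], [0, 1], [2, -2], [-2, 5, -2]]"]) code_simp+

lemma rolfsen_10_1: "rolfsen_ok (10, 1) [:4, -9, 4:]"
  by (rule certifies_rolfsen[where
        T = "[(False, 9, 1, 1), (False, 3, 0, 1), (False, 0, 3, 1), (False, 5, 2, 1), (False, 2, 5, 1), (False, 7, 4, 1), (False, 4, 7, 1), (False, 8, 6, 1), (True, 6, 9, -1), (True, 1, 8, -1)]" and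
        rs = "[6, 5, 4, 3, 2, 1, 0, 7, 8, 9]" and cs = "[6, 7, 4, 5, 2, 3, 9, 8, 0, 1]" and
        g = 0 and F = "[]" and
        X = "[[], [], [], [], [], [], [], [], [1], []]" and
        Z = "[[1], [], [2, -1], [1, -1], [3, -2], [2, -2], [4, -3], [3, -3], [4, -4], [0, 1]]"]) code_simp+

lemma rolfsen_8_5: "rolfsen_ok (8, 5) [:1, -3, 4, -5, 4, -3, 1:]"
  by (rule certifies_rolfsen[where
        T = "[(True, 7, 5, -1), (True, 5, 0, -1), (True, 0, 1, -1), (True, 6, 2, -1), (True, 2, 3, -1), (True, 3, 4, -1), (False, 4, 7, 1), (False, 1, 6, 1)]" and
        rs = "[6, 5, 2, 1, 0, 3, 4, 7]" and cs = "[6, 3, 2, 1, 7, 4, 0, 5]" and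
        g = 0 and F = "[]" and
        X = "[[], [], [], [-1, 1], [0, 1], [], [1], []]" and
        Z = "[[0, 0, 1], [0, 0, 1, -1], [0, 0, 1, -1, 1], [0, -1, 3, -4, 4, -3, 1], [0, 0, 1, -2, 2, -2, 1], [], [-1, 2, -2, 2, -2, 1], [0, 1]]"]) code_simp+

lemma rolfsen_10_141: "rolfsen_ok (10, 141) [:1, -3, 4, -5, 4, -3, 1:]"
  by (rule certifies_rolfsen[where
        T = "[(True, 6, 8, -1), (True, 8, 0, -1), (True, 0, 1, -1), (True, 1, 2, -1), (False, 9, 2, 0), (False, 2, 4, 0), (False, 4, 5, 0), (False, 3, 5, -1), (False, 5, 7, -1), (False, 7, 3, -1)]" and
        rs = "[8, 7, 4, 3, 2, 6, 5, 1, 0, 9]" and cs = "[8, 7, 9, 3, 0, 6, 2, 1, 4, 5]" and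
        g = 0 and F = "[]" and
        X = "[[-1, 1], [0, 1], [], [0, 0, 1], [], [], [], [0, 1], [-1, 1], []]" and
        Z = "[[0, 1, -2, 3, -3, 1], [0, 0, 0, 1, -2, 1], [0, 0, 1, -1], [0, 0, 1, -2, 2, -2, 1], [0, 0, 1], [], [0, 1], [0, 1, -2, 2, -2, 1], [-1, 3, -4, 4, -3, 1], [0, 0, 1, -1, 1]]"]) code_simp+

lemma rolfsen_8_8: "rolfsen_ok (8, 8) [:2, -6, 9, -6, 2:]"
  by (rule certifies_rolfsen[where
        T = "[(True, 3, 7, -1), (True, 7, 0, -1), (False, 0, 4, 1), (False, 6, 2, 1), (False, 2, 3, 1), (True, 4, 6, -1), (True, 1, 5, -1), (True, 5, 1, -1)]" and
        rs = "[7, 6, 5, 4, 3, 2, 0, 1]" and cs = "[7, 1, 5, 4, 6, 0, 2, 3]" and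
        g = 0 and F = "[]" and
        X = "[[1], [], [], [], [], [], [], []]" and
        Z = "[[1, -1, 1], [-1, 3, -3, 1], [0, 1], [], [1], [0, 2, -2, 1], [0, 1, -1], [-1, 4, -4, 2]]"]) code_simp+

lemma rolfsen_10_129: "rolfsen_ok (10, 129) [:2, -6, 9, -6, 2:]"
  by (rule certifies_rolfsen[where
        T = "[(True, 9, 1, -1), (True, 7, 0, -1), (True, 0, 7, -1), (True, 1, 2, -1), (True, 2, 3, -1), (False, 6, 4, -1), (False, 4, 8, -1), (False, 8, 6, -1), (False, 5, 3, 0), (False, 3, 8, 0)]" and
        rs = "[9, 5, 3, 2, 1, 7, 6, 0, 4, 8]" and cs = "[9, 5, 3, 2, 1, 7, 4, 0, 8, 6]" and
        g = 0 and F = "[]" and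
        X = "[[1], [1, -1], [0, 1], [0, 2, -2], [], [], [], [], [], [2, -2]]" and
        Z = "[[1, -2, 2], [1, -3, 4, -1], [0, 1, -1, 1], [0, 2, -5, 6, -2], [0, 0, 0, 1, -1], [0, 0, -1, 2, -1], [], [0, 0, 1], [0, 0, 0, 1], [2, -5, 5, -1]]"]) code_simp+

lemma rolfsen_8_10: "rolfsen_ok (8, 10) [:1, -3, 6, -7, 6, -3, 1:]"
  by (rule certifies_rolfsen[where
        T = "[(True, 6, 5, -1), (True, 5, 0, -1), (True, 0, 1, -1), (False, 4, 2, -1), (False, 2, 7, -1), (False, 7, 4, -1), (True, 1, 3, -1), (True, 3, 6, -1)]" and
        rs = "[7, 4, 2, 1, 0, 3, 5, 6]" and cs = "[3, 4, 2, 1, 6, 7, 0, 5]" and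
        g = 0 and F = "[]" and
        X = "[[], [], [], [1], [-1, 1], [], [], [0, 1]]" and
        Z = "[[0, 0, 1], [0, 0, 1, -1], [0, 0, 1, -1, 1], [-1, 3, -3, 3, -2, 1], [0, -1, 4, -5, 5, -3, 1], [], [0, 1], [0, 0, 2, -3, 3, -2, 1]]"]) code_simp+

lemma rolfsen_10_143: "rolfsen_ok (10, 143) [:1, -3, 6, -7, 6, -3, 1:]"
  by (rule certifies_rolfsen[where
        T = "[(False, 6, 3, 1), (False, 3, 0, 1), (False, 0, 1, 1), (False, 8, 2, 1), (False, 9, 2, 0), (False, 2, 4, 0), (False, 4, 5, 0), (True, 1, 5, -1), (True, 5, 7, -1), (True, 7, 8, -1)]" and
        rs = "[3, 2, 8, 7, 6, 5, 4, 1, 0, 9]" and cs = "[3, 0, 8, 1, 6, 5, 9, 7, 2, 4]" and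
        g = 0 and F = "[]" and
        X = "[[1, -1], [1], [], [1, -1], [], [], [], [0, 1], [0, 1, -1], []]" and
        Z = "[[1, -3, 4, -3, 2], [1, -2, 2, -1, 1], [0, 0, 0, 0, 1], [1, -3, 5, -5, 4, -1], [], [0, 0, 0, 1], [0, 0, -1, 1], [0, 1, -2, 3, -2, 1], [0, 1, -3, 5, -4, 3, -1], [0, 0, 0, 0, 1, -1]]"]) code_simp+

lemma rolfsen_8_16: "rolfsen_ok (8, 16) [:1, -4, 8, -9, 8, -4, 1:]"
  by (rule certifies_rolfsen[where
        T = "[(False, 7, 5, 1), (False, 5, 0, 1), (False, 0, 6, 1), (False, 6, 2, 1), (False, 2, 7, 1), (True, 3, 4, 1), (True, 4, 1, 1), (True, 1, 3, 1)]" and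
        rs = "[4, 1, 0, 2, 3, 7, 5, 6]" and cs = "[4, 1, 7, 0, 6, 5, 2, 3]" and
        g = 0 and F = "[]" and
        X = "[[], [1], [], [], [-1, 2, -1], [0, 1], [], [0, 1, -1]]" and
        Z = "[[0, 0, 1, -1, 1], [1, -2, 3, -2, 1], [0, 0, 1], [], [-1, 4, -5, 5, -3, 1], [0, 1, -1, 1], [0, 0, 1, -1], [0, 1, -2, 3, -2, 1]]"]) code_simp+

lemma rolfsen_10_156: "rolfsen_ok (10, 156) [:1, -4, 8, -9, 8, -4, 1:]"
  by (rule certifies_rolfsen[where
        T = "[(False, 2, 5, 0), (False, 5, 2, 0), (False, 8, 1, 0), (False, 7, 1, -1), (False, 1, 9, -1), (True, 3, 4, -1), (True, 4, 5, -1), (False, 9, 6, -1), (False, 6, 7, -1), (True, 0, 3, -1)]" and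
        rs = "[7, 3, 0, 6, 5, 2, 1, 4, 8, 9]" and cs = "[9, 7, 0, 6, 3, 8, 5, 4, 1, 2]" and
        g = 0 and F = "[]" and
        X = "[[], [], [], [-1, 1], [0, 1], [], [0, 0, 1], [0, -1, 1], [], []]" and
        Z = "[[0, 0, -1, 1], [0, 0, 1], [], [-1, 3, -5, 7, -4, 1], [0, 1, -2, 4, -3, 1], [0, 0, 0, 1], [0, 0, 1, -1, 3, -3, 1], [0, -1, 4, -6, 7, -4, 1], [0, 0, 1, -1], [0, 0, 0, 2, -2, 1]]"]) code_simp+

lemma rolfsen_8_21: "rolfsen_ok (8, 21) [:1, -4, 5, -4, 1:]"
  by (rule certifies_rolfsen[where
        T = "[(False, 4, 7, 1), (False, 7, 0, 1), (False, 0, 6, 1), (False, 6, 2, 1), (True, 1, 2, 0), (True, 2, 1, 0), (False, 5, 3, 1), (False, 3, 1, 1)]" and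
        rs = "[4, 2, 7, 6, 5, 3, 0, 1]" and cs = "[4, 0, 7, 6, 2, 5, 1, 3]" and
        g = 0 and F = "[]" and
        X = "[[1], [], [1], [], [1, -1], [0, 1], [1], []]" and
        Z = "[[-1, 2, -2, 1], [0, 0, 1], [-1, 1], [], [-1, 2, -1, 1], [0, -1, 2, -1], [-1, 2, -1], [0, -1, 1]]"]) code_simp+

lemma rolfsen_10_136: "rolfsen_ok (10, 136) [:1, -4, 5, -4, 1:]"
  by (rule certifies_rolfsen[where
        T = "[(True, 4, 1, -1), (True, 8, 0, -1), (True, 0, 3, -1), (True, 6, 2, -1), (True, 9, 2, 0), (True, 2, 9, 0), (False, 5, 7, 1), (False, 3, 6, 1), (False, 7, 9, 1), (False, 1, 8, 1)]" and
        rs = "[4, 2, 5, 7, 6, 8, 9, 3, 0, 1]" and cs = "[4, 0, 2, 3, 5, 7, 9, 6, 1, 8]" and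
        g = 0 and F = "[]" and
        X = "[[2, -1], [], [1], [1, -1], [1, -1], [0, 1], [1], [], [], []]" and
        Z = "[[1, -3, 3, -1], [0, 0, 1], [1, -2, 1], [1, -2, 2, -1], [1, -3, 4, -1], [0, 2, -3, 1], [1, -1], [0, 1, -1], [], [0, 1]]"]) code_simp+

lemma rolfsen_9_15: "rolfsen_ok (9, 15) [:2, -10, 15, -10, 2:]"
  by (rule certifies_rolfsen[where
        T = "[(True, 5, 8, -1), (True, 8, 0, -1), (False, 0, 3, 1), (False, 4, 2, 1), (True, 2, 5, -1), (True, 7, 4, -1), (True, 3, 7, -1), (True, 1, 6, -1), (True, 6, 1, -1)]" and
        rs = "[8, 7, 6, 3, 5, 4, 2, 0, 1]" and cs = "[8, 1, 6, 3, 7, 4, 0, 2, 5]" and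
        g = 0 and F = "[]" and
        X = "[[1], [], [], [], [], [], [], [], []]" and
        Z = "[[-1, 3, -1], [1, -5, 5, -1], [0, 1], [-1, 2], [0, 0, 1], [], [0, -2, 4, -1], [0, -1, 1], [1, -6, 8, -2]]"]) code_simp+

lemma rolfsen_10_166: "rolfsen_ok (10, 166) [:2, -10, 15, -10, 2:]"
  by (rule certifies_rolfsen[where
        T = "[(True, 7, 1, -1), (True, 3, 0, -1), (True, 0, 8, -1), (True, 2, 9, -2), (True, 9, 3, -2), (True, 8, 3, -1), (True, 1, 5, -1), (False, 4, 6, -1), (False, 6, 9, -1), (True, 5, 7, -1)]" and
        rs = "[9, 7, 2, 0, 6, 5, 1, 4, 3, 8]" and cs = "[9, 4, 2, 7, 6, 8, 1, 0, 5, 3]" and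
        g = 0 and F = "[]" and
        X = "[[1], [1, -1], [0, 1], [], [0, 3, -3, 1], [], [0, 1, -1], [2, -1], [], [2, -3, 1]]" and
        Z = "[[-1, 2], [-1, 3, -2], [1, -2, 2], [], [0, -2, 7, -6, 2], [0, 1], [0, 0, 2, -2], [-2, 5, -2], [1], [-2, 7, -6, 2]]"]) code_simp+

lemma rolfsen_9_20: "rolfsen_ok (9, 20) [:1, -5, 9, -11, 9, -5, 1:]"
  by (rule certifies_rolfsen[where
        T = "[(False, 5, 3, 1), (False, 3, 0, 1), (False, 0, 1, 1), (False, 7, 2, 1), (False, 2, 6, 1), (False, 8, 4, 1), (False, 4, 5, 1), (True, 6, 8, -1), (True, 1, 7, -1)]" and
        rs = "[1, 8, 7, 5, 4, 6, 2, 0, 3]" and cs = "[3, 1, 7, 8, 2, 4, 0, 5, 6]" and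
        g = 0 and F = "[]" and
        X = "[[1], [], [], [1, -1], [], [], [], [], []]" and
        Z = "[[2, -5, 7, -5, 1], [2, -3, 3, -1], [0, 1, -1], [2, -5, 9, -9, 5, -1], [1, -1], [1], [], [1, -2, 2, -1], [1, -1, 1]]"]) code_simp+

lemma rolfsen_10_149: "rolfsen_ok (10, 149) [:1, -5, 9, -11, 9, -5, 1:]"
  by (rule certifies_rolfsen[where
        T = "[(False, 7, 4, 1), (False, 4, 0, 1), (False, 0, 1, 1), (False, 6, 2, 1), (False, 2, 3, 1), (False, 1, 9, 1), (False, 9, 5, 1), (True, 3, 5, 0), (True, 5, 3, 0), (False, 8, 6, 1)]" and
        rs = "[0, 7, 5, 9, 8, 4, 3, 6, 1, 2]" and cs = "[0, 7, 1, 9, 5, 4, 6, 8, 2, 3]" and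
        g = 0 and F = "[]" and
        X = "[[1, -1], [0, 1], [], [], [], [0, 1], [], [0, 1, -1], [0, 0, 1], [0, 1]]" and
        Z = "[[1, -4, 5, -3, 1], [0, 1, -3, 5, -4, 1], [0, 0, 0, 1], [], [0, 0, 1], [0, 1, -2, 2, -1], [0, 0, 0, 1, -1], [0, 1, -3, 4, -3, 1], [0, 0, 1, -2, 2, -1], [0, 1, -3, 4, -2]]"]) code_simp+

lemma rolfsen_9_28: "rolfsen_ok (9, 28) [:1, -5, 12, -15, 12, -5, 1:]"
  by (rule certifies_rolfsen[where
        T = "[(False, 5, 7, 1), (False, 7, 0, 1), (False, 0, 6, 1), (False, 6, 2, 1), (True, 2, 8, -1), (True, 8, 4, -1), (False, 4, 3, 1), (False, 3, 1, 1), (True, 1, 5, -1)]" and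
        rs = "[4, 3, 8, 7, 1, 0, 6, 2, 5]" and cs = "[4, 6, 8, 3, 1, 5, 2, 7, 0]" and
        g = 0 and F = "[]" and
        X = "[[], [], [1], [], [0, 1], [], [1, -1], [], []]" and
        Z = "[[], [0, 0, 1], [1, -4, 7, -5, 2], [0, 0, 1, -1, 1], [0, 1, -4, 9, -9, 5, -1], [0, 0, 0, 1, -1], [1, -5, 11, -11, 6, -1], [0, 0, 0, 1], [0, 0, 0, 2, -2, 1]]"]) code_simp+

lemma rolfsen_9_29: "rolfsen_ok (9, 29) [:1, -5, 12, -15, 12, -5, 1:]"
  by (rule certifies_rolfsen[where
        T = "[(False, 7, 5, 1), (False, 5, 0, 1), (True, 0, 3, -1), (True, 6, 2, -1), (False, 2, 7, 1), (True, 8, 4, 1), (True, 4, 8, 1), (False, 1, 6, 1), (False, 3, 1, 1)]" and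
        rs = "[2, 8, 7, 6, 5, 1, 3, 0, 4]" and cs = "[2, 3, 7, 6, 8, 5, 1, 0, 4]" and
        g = 0 and F = "[]" and
        X = "[[], [1], [1, -1], [1], [], [0, 1], [1, -1], [2, -1], [1]]" and
        Z = "[[0, 0, 1], [0, 1, -3, 3, -1], [0, 1, -3, 5, -3, 1], [0, 1, -2, 2, -1], [], [0, 0, 2, -4, 3, -1], [0, 2, -6, 7, -4, 1], [-1, 5, -10, 10, -5, 1], [0, 2, -4, 3, -1]]"]) code_simp+

lemma rolfsen_10_10: "rolfsen_ok (10, 10) [:3, -11, 17, -11, 3:]"
  by (rule certifies_rolfsen[where
        T = "[(True, 7, 1, -1), (True, 3, 0, -1), (True, 0, 3, -1), (True, 9, 2, -1), (True, 2, 9, -1), (True, 1, 4, -1), (False, 4, 8, 1), (False, 5, 6, 1), (False, 6, 7, 1), (True, 8, 5, -1)]" and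
        rs = "[8, 5, 4, 3, 2, 1, 0, 9, 6, 7]" and cs = "[8, 5, 4, 9, 2, 3, 7, 6, 0, 1]" and
        g = 0 and F = "[]" and
        X = "[[], [], [], [], [], [], [0, 1], [], [1], []]" and
        Z = "[[0, 1], [], [-1, 2], [-1, 1], [-2, 3], [-2, 5, -3], [1, -6, 8, -3], [1], [-5, 8, -3], [-2, 2]]"]) code_simp+

lemma rolfsen_10_165: "rolfsen_ok (10, 165) [:3, -11, 17, -11, 3:]"
  by (rule certifies_rolfsen[where
        T = "[(True, 9, 1, -1), (True, 8, 0, -1), (False, 7, 0, 0), (False, 0, 2, 0), (True, 3, 8, -1), (True, 1, 4, -1), (True, 4, 9, -1), (False, 5, 6, -1), (False, 6, 2, -1), (False, 2, 5, -1)]" and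
        rs = "[9, 5, 2, 1, 3, 4, 8, 7, 0, 6]" and cs = "[9, 5, 7, 1, 0, 3, 8, 2, 4, 6]" and
        g = 0 and F = "[]" and
        X = "[[0, 1, -1], [0, 1, -3, 2], [0, 0, 1], [1, -2, 1], [], [0, 0, 1, -3, 2], [], [0, 1, -2, 2], [0, -1, 1], [0, 0, 4, -5, 2]]" and
        Z = "[[0, 1, -2, 2], [0, 1, -4, 6, -3], [0, 0, 1, -1], [1, -3, 4, -1], [0, 0, 0, 1], [0, 0, 1, -3, 5, -3], [], [0, 1, -3, 5, -3], [0, -1, 2, -1], [0, 0, 3, -8, 8, -3]]"]) code_simp+

lemma rolfsen_10_12: "rolfsen_ok (10, 12) [:2, -6, 10, -11, 10, -6, 2:]"
  by (rule certifies_rolfsen[where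
        T = "[(True, 5, 9, -1), (True, 9, 0, -1), (True, 0, 1, -1), (True, 1, 2, -1), (False, 2, 6, 1), (False, 8, 4, 1), (False, 4, 5, 1), (True, 6, 8, -1), (True, 3, 7, -1), (True, 7, 3, -1)]" and
        rs = "[0, 9, 8, 7, 5, 4, 6, 1, 2, 3]" and cs = "[0, 9, 3, 7, 8, 2, 4, 1, 5, 6]" and
        g = 0 and F = "[]" and
        X = "[[], [1], [], [], [], [], [], [], [], []]" and
        Z = "[[2, -5, 8, -6, 2], [2, -5, 9, -10, 6, -2], [0, 1, -1], [2, -3, 3, -1], [1, -1], [1], [], [1, -2, 2, -1], [1, -1, 1], [2, -4, 4, -2]]"]) code_simp+

text \<open>Here the row \<open>rs ! M\<close> takes the value -(1 - t + t^2) at \<open>X\<close>,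
  not a unit, and the next row t^2 - t^3; \<open>t\<close> times the former minus the latter is
  -t.\<close>

lemma rolfsen_10_54: "rolfsen_ok (10, 54) [:2, -6, 10, -11, 10, -6, 2:]"
  by (rule certifies_rolfsen[where
        T = "[(False, 5, 9, 1), (False, 9, 0, 1), (True, 0, 6, -1), (True, 6, 2, -1), (True, 2, 3, -1), (True, 8, 4, -1), (True, 4, 5, -1), (False, 3, 8, 1), (False, 1, 7, 1), (False, 7, 1, 1)]" and
        rs = "[4, 3, 7, 8, 0, 9, 1, 2, 5, 6]" and cs = "[4, 6, 3, 8, 5, 7, 9, 2, 0, 1]" and
        g = 1 and F = "[-1]" and
        X = "[[], [], [0, 1], [], [0, 0, 1], [], [-1, 1], [], [], []]" and
        Z = "[[0, 1], [], [0, 1, -1, 4, -4, 2], [0, -1, 3, -2], [0, -1, 5, -6, 6, -4, 2], [0, 1, -1, 1], [-2, 5, -7, 8, -6, 2], [0, 0, 1, -1], [0, -1, 2, -1], [0, 1, -1]]"]) code_simp+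

lemma rolfsen_10_18: "rolfsen_ok (10, 18) [:4, -14, 19, -14, 4:]"
  by (rule certifies_rolfsen[where
        T = "[(True, 7, 1, -1), (True, 3, 0, -1), (True, 0, 3, -1), (True, 5, 2, -1), (False, 2, 9, 1), (False, 8, 4, 1), (False, 4, 8, 1), (False, 9, 6, 1), (False, 6, 7, 1), (False, 1, 5, 1)]" and
        rs = "[1, 0, 9, 5, 7, 6, 8, 4, 2, 3]" and cs = "[3, 0, 1, 5, 9, 4, 6, 2, 7, 8]" and
        g = 0 and F = "[]" and
        X = "[[], [], [1], [], [], [], [], [], [], []]" and
        Z = "[[-1, 6, -8, 6, -2], [-1, 4, -4, 2], [1, -2, 3, -2], [-3, 10, -12, 8, -2], [0, 1, -1], [-1, 2, -1], [1, -1], [1], [], [1, -1, 1]]"]) code_simp+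

lemma rolfsen_10_24: "rolfsen_ok (10, 24) [:4, -14, 19, -14, 4:]"
  by (rule certifies_rolfsen[where
        T = "[(False, 9, 1, 1), (False, 5, 0, 1), (False, 0, 5, 1), (False, 1, 2, 1), (False, 2, 3, 1), (False, 7, 4, 1), (False, 4, 7, 1), (False, 8, 6, 1), (True, 6, 9, -1), (True, 3, 8, -1)]" and
        rs = "[3, 2, 4, 6, 7, 9, 8, 5, 0, 1]" and cs = "[1, 0, 2, 4, 7, 3, 8, 5, 6, 9]" and
        g = 0 and F = "[]" and
        X = "[[1, -1], [], [], [], [], [1], [], [], [], []]" and
        Z = "[[-2, 6, -7, 6, -2], [0, -2, 6, -6, 2], [0, -2, 5, -2], [0, -1, 1], [-1, 3, -1], [-2, 4, -1], [0, 1], [-1, 2], [0, 0, 1], []]"]) code_simp+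

lemma rolfsen_10_20: "rolfsen_ok (10, 20) [:3, -9, 11, -9, 3:]"
  by (rule certifies_rolfsen[where
        T = "[(False, 9, 3, 1), (False, 3, 0, 1), (False, 0, 1, 1), (False, 5, 2, 1), (False, 2, 5, 1), (False, 7, 4, 1), (False, 4, 7, 1), (False, 8, 6, 1), (True, 6, 9, -1), (True, 1, 8, -1)]" and
        rs = "[3, 2, 4, 5, 6, 7, 8, 9, 0, 1]" and cs = "[3, 0, 2, 5, 4, 7, 8, 1, 6, 9]" and
        g = 0 and F = "[]" and
        X = "[[1, -1], [1], [], [], [], [], [], [], [], []]" and
        Z = "[[0, -3, 7, -3], [0, -1, 1], [-2, 5, -2], [-3, 6, -2], [-1, 3, -1], [-2, 4, -1], [0, 1], [-1, 2], [0, 0, 1], []]"]) code_simp+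

text \<open>The two rows take the values 2t^2 - t and -1 + 2t - t^2 at \<open>X\<close>; the first
  minus \<open>t\<close> times the second is t^3.\<close>

lemma rolfsen_10_163: "rolfsen_ok (10, 163) [:3, -9, 11, -9, 3:]"
  by (rule certifies_rolfsen[where
        T = "[(True, 2, 6, 0), (True, 6, 2, 0), (True, 9, 1, 0), (False, 8, 1, 1), (True, 1, 7, -1), (False, 4, 3, 0), (False, 3, 5, 0), (False, 5, 0, 0), (False, 0, 7, 0), (False, 7, 3, 1)]" and
        rs = "[4, 3, 0, 9, 6, 2, 1, 5, 7, 8]" and cs = "[4, 8, 0, 7, 3, 9, 6, 1, 2, 5]" and
        g = 0 and F = "[0, -1]" and
        X = "[[1, -1], [0, 1], [], [0, 1], [0, 0, 1], [], [1], [], [0, 1], [-1, 1]]" and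
        Z = "[[-3, 6, -5, 4, -1], [0, -3, 4, -3, 1], [0, 0, 1], [0, -3, 3, -2, 1], [0, 0, -3, 6, -6, 2], [], [-3, 3, -2, 1], [0, 0, 0, 2, -1], [0, -3, 4, -4, 2], [3, -6, 7, -4, 1]]"]) code_simp+

lemma rolfsen_10_23: "rolfsen_ok (10, 23) [:2, -7, 13, -15, 13, -7, 2:]"
  by (rule certifies_rolfsen[where
        T = "[(True, 7, 1, -1), (True, 9, 0, -1), (True, 0, 9, -1), (True, 1, 2, -1), (True, 2, 3, -1), (True, 3, 4, -1), (False, 4, 8, 1), (False, 5, 6, 1), (False, 6, 7, 1), (True, 8, 5, -1)]" and
        rs = "[8, 5, 4, 3, 2, 1, 0, 9, 6, 7]" and cs = "[8, 5, 4, 3, 2, 9, 7, 6, 0, 1]" and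
        g = 0 and F = "[]" and
        X = "[[], [], [], [], [], [], [0, 1], [], [1], []]" and
        Z = "[[0, 1], [], [-1, 2], [-1, 3, -2], [-1, 3, -3, 2], [-1, 3, -3, 3, -2], [1, -4, 6, -6, 5, -2], [1], [-3, 6, -6, 5, -2], [-1, 1]]"]) code_simp+

lemma rolfsen_10_52: "rolfsen_ok (10, 52) [:2, -7, 13, -15, 13, -7, 2:]"
  by (rule certifies_rolfsen[where
        T = "[(False, 7, 1, 1), (False, 9, 0, 1), (False, 0, 9, 1), (False, 1, 2, 1), (True, 2, 8, -1), (True, 8, 4, -1), (True, 4, 5, -1), (True, 3, 6, -1), (True, 6, 7, -1), (False, 5, 3, 1)]" and
        rs = "[5, 4, 1, 0, 8, 7, 3, 2, 6, 9]" and cs = "[5, 4, 9, 0, 8, 7, 3, 1, 2, 6]" and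
        g = 0 and F = "[]" and
        X = "[[0, 1], [0, 1], [], [1], [0, 1, -2, 1], [0, 1, -2, 2, -1], [], [0, 1], [0, 1, -1], [0, 1]]" and
        Z = "[[0, 1, -1, 1], [0, 2, -2, 1], [0, 0, 1], [2, -3, 2], [0, 2, -7, 11, -7, 2], [0, 2, -7, 13, -13, 7, -2], [], [0, 2, -3, 2], [0, 2, -5, 5, -2], [0, 1]]"]) code_simp+

lemma rolfsen_10_25: "rolfsen_ok (10, 25) [:2, -8, 14, -17, 14, -8, 2:]"
  by (rule certifies_rolfsen[where
        T = "[(False, 9, 3, 1), (False, 3, 0, 1), (False, 0, 1, 1), (False, 7, 2, 1), (False, 2, 7, 1), (False, 1, 4, 1), (False, 4, 5, 1), (False, 8, 6, 1), (True, 6, 9, -1), (True, 5, 8, -1)]" and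
        rs = "[3, 2, 4, 7, 6, 9, 8, 5, 0, 1]" and cs = "[3, 0, 2, 7, 4, 5, 8, 1, 6, 9]" and
        g = 0 and F = "[]" and
        X = "[[1, -1], [1], [], [], [], [], [], [], [], []]" and
        Z = "[[0, -2, 7, -9, 7, -2], [0, -1, 3, -3, 1], [-1, 3, -3, 3, -1], [-2, 6, -6, 4, -1], [0, -1, 3, -1], [0, -1, 1], [0, 1], [-1, 2], [0, 0, 1], []]"]) code_simp+

lemma rolfsen_10_56: "rolfsen_ok (10, 56) [:2, -8, 14, -17, 14, -8, 2:]"
  by (rule certifies_rolfsen[where
        T = "[(True, 7, 9, -1), (True, 9, 0, -1), (True, 0, 8, -1), (True, 6, 2, -1), (True, 2, 3, -1), (True, 3, 4, -1), (False, 4, 7, 1), (False, 8, 6, 1), (True, 1, 5, -1), (True, 5, 1, -1)]" and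
        rs = "[4, 3, 2, 8, 9, 1, 0, 6, 5, 7]" and cs = "[4, 6, 2, 8, 5, 1, 7, 3, 0, 9]" and
        g = 0 and F = "[]" and
        X = "[[], [], [], [0, 1], [0, 1, -1], [], [1], [], [], []]" and
        Z = "[[0, 0, 0, 1], [0, 0, 0, 1, -1], [0, 0, -1, 4, -4, 2], [0, -2, 5, -4, 2], [0, -2, 7, -10, 10, -6, 2], [0, 0, -1, 2, -1], [-2, 6, -9, 10, -6, 2], [0, 0, 1], [0, 0, -1, 3, -2], []]"]) code_simp+

lemma rolfsen_10_28: "rolfsen_ok (10, 28) [:4, -13, 19, -13, 4:]"
  by (rule certifies_rolfsen[where
        T = "[(True, 5, 1, -1), (True, 9, 0, -1), (True, 0, 9, -1), (True, 1, 2, -1), (False, 2, 6, 1), (False, 8, 4, 1), (False, 4, 5, 1), (True, 6, 8, -1), (True, 3, 7, -1), (True, 7, 3, -1)]" and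
        rs = "[4, 7, 8, 9, 3, 2, 1, 0, 5, 6]" and cs = "[4, 6, 8, 7, 3, 2, 9, 5, 0, 1]" and
        g = 0 and F = "[]" and
        X = "[[], [], [], [], [], [1], [], [], [], []]" and
        Z = "[[0, 0, 1], [], [0, -1, 2], [0, -1, 3, -2], [4, -12, 13, -4], [0, 1], [0, -5, 9, -4], [0, -3, 5, -2], [0, -3, 7, -4], [0, -1, 1]]"]) code_simp+

lemma rolfsen_10_37: "rolfsen_ok (10, 37) [:4, -13, 19, -13, 4:]"
  by (rule certifies_rolfsen[where
        T = "[(True, 5, 9, -1), (True, 9, 0, -1), (False, 0, 3, 1), (False, 6, 2, 1), (False, 2, 6, 1), (False, 8, 4, 1), (False, 4, 5, 1), (True, 3, 8, -1), (True, 1, 7, -1), (True, 7, 1, -1)]" and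
        rs = "[9, 8, 7, 3, 4, 6, 5, 2, 0, 1]" and cs = "[9, 1, 7, 3, 2, 6, 8, 0, 4, 5]" and
        g = 0 and F = "[]" and
        X = "[[1], [], [], [], [], [], [], [], [], []]" and
        Z = "[[2, -3, 2], [-2, 6, -6, 2], [1, -1, 1], [2, -2, 1], [0, 1], [], [1], [0, 3, -4, 2], [0, 1, -1], [-2, 8, -9, 4]]"]) code_simp+

lemma rolfsen_10_31: "rolfsen_ok (10, 31) [:4, -14, 21, -14, 4:]"
  by (rule certifies_rolfsen[where
        T = "[(True, 7, 1, -1), (True, 9, 0, -1), (True, 0, 9, -1), (True, 1, 2, -1), (False, 2, 5, 1), (False, 8, 4, 1), (False, 4, 8, 1), (False, 3, 6, 1), (False, 6, 7, 1), (True, 5, 3, -1)]" and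
        rs = "[6, 5, 4, 9, 3, 2, 1, 0, 7, 8]" and cs = "[6, 8, 4, 5, 3, 2, 9, 7, 0, 1]" and
        g = 0 and F = "[]" and
        X = "[[], [], [], [], [], [], [], [1], [], []]" and
        Z = "[[0, 0, 1], [], [0, -1, 2], [0, -1, 3, -2], [2, -6, 7, -2], [0, -3, 5, -2], [4, -11, 12, -4], [0, 1], [2, -8, 10, -4], [0, -1, 1]]"]) code_simp+

lemma rolfsen_10_68: "rolfsen_ok (10, 68) [:4, -14, 21, -14, 4:]"
  by (rule certifies_rolfsen[where
        T = "[(True, 7, 9, -1), (True, 9, 0, -1), (False, 0, 8, 1), (False, 5, 2, 1), (False, 2, 5, 1), (False, 1, 4, 1), (False, 4, 7, 1), (False, 3, 6, 1), (False, 6, 3, 1), (True, 8, 1, -1)]" and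
        rs = "[0, 9, 8, 7, 3, 4, 5, 1, 2, 6]" and cs = "[0, 9, 8, 7, 3, 2, 5, 6, 1, 4]" and
        g = 0 and F = "[]" and
        X = "[[], [], [], [], [], [], [0, 1], [-1, 1], [1], [0, 1]]" and
        Z = "[[0, 0, 5, -6, 2], [0, 0, 1], [0, 1, -1], [0, 2, -1], [], [0, 1], [0, -2, 7, -6, 2], [4, -10, 13, -8, 2], [-4, 10, -7, 2], [0, -4, 11, -8, 2]]"]) code_simp+

lemma rolfsen_10_34: "rolfsen_ok (10, 34) [:3, -9, 13, -9, 3:]"
  by (rule certifies_rolfsen[where
        T = "[(True, 3, 9, -1), (True, 9, 0, -1), (False, 0, 4, 1), (False, 6, 2, 1), (False, 2, 3, 1), (True, 4, 6, -1), (True, 8, 5, -1), (True, 5, 8, -1), (True, 1, 7, -1), (True, 7, 1, -1)]" and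
        rs = "[9, 8, 7, 6, 5, 4, 3, 2, 0, 1]" and cs = "[9, 1, 7, 8, 5, 4, 6, 0, 2, 3]" and
        g = 0 and F = "[]" and
        X = "[[1], [], [], [], [], [], [], [], [], []]" and
        Z = "[[1, -1, 1], [-2, 5, -5, 2], [0, 1], [], [1], [0, 2, -2, 1], [0, 1, -1], [-1, 4, -4, 2], [-1, 3, -3, 1], [-2, 6, -6, 3]]"]) code_simp+

text \<open>The two rows take the values -t + t^2 - t^3 and -t + 2t^2 - t^3 at \<open>X\<close>,
  whose difference is -t^2.\<close>

lemma rolfsen_10_135: "rolfsen_ok (10, 135) [:3, -9, 13, -9, 3:]"
  by (rule certifies_rolfsen[where
        T = "[(True, 7, 9, -1), (True, 9, 0, -1), (True, 0, 8, -1), (False, 4, 2, -1), (False, 2, 6, -1), (False, 6, 4, -1), (False, 3, 8, 0), (False, 8, 6, 0), (True, 1, 5, -1), (True, 5, 1, -1)]" and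
        rs = "[5, 3, 2, 8, 9, 1, 0, 4, 7, 6]" and cs = "[6, 4, 2, 8, 5, 1, 7, 3, 0, 9]" and
        g = 0 and F = "[-1]" and
        X = "[[], [], [], [1], [0, 1], [], [0, 1, -1], [], [], []]" and
        Z = "[[0, 0, 1], [0, 0, 1, -1], [0, -1, 4, -4, 2], [3, -7, 10, -6, 2], [0, 2, -2, 2], [0, -1, 2, -1], [0, 2, -5, 6, -3], [0, 1], [0, -1, 3, -2], []]"]) code_simp+

lemma rolfsen_10_127: "rolfsen_ok (10, 127) [:1, -4, 6, -7, 6, -4, 1:]"
  by (rule certifies_rolfsen[where
        T = "[(False, 6, 9, 1), (False, 9, 0, 1), (False, 0, 1, 1), (False, 1, 2, 1), (False, 2, 8, 1), (False, 8, 4, 1), (True, 3, 4, 0), (True, 4, 3, 0), (False, 7, 5, 1), (False, 5, 3, 1)]" and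
        rs = "[5, 0, 9, 7, 3, 2, 1, 8, 4, 6]" and cs = "[8, 6, 5, 4, 3, 2, 9, 7, 0, 1]" and
        g = 0 and F = "[]" and
        X = "[[], [], [], [], [1], [], [], [0, 1], [1, -1], []]" and
        Z = "[[0, 0, 0, 1], [], [0, 0, 1], [0, -1, 1], [1, -3, 4, -3, 2, -1], [0, -1, 2, -1, 1, -1], [0, 0, 0, 1, -1, 1], [0, 0, -1, 3, -3, 2, -1], [1, -4, 6, -5, 4, -2], [0, 0, 0, 1, -1]]"]) code_simp+

lemma rolfsen_10_150: "rolfsen_ok (10, 150) [:1, -4, 6, -7, 6, -4, 1:]"
  by (rule certifies_rolfsen[where
        T = "[(True, 9, 4, -1), (True, 4, 0, -1), (True, 0, 3, -1), (True, 6, 2, -1), (True, 2, 1, -1), (True, 1, 8, -1), (True, 8, 5, -1), (True, 5, 6, -1), (False, 7, 3, 0), (False, 3, 8, 0)]" and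
        rs = "[9, 7, 6, 5, 4, 1, 0, 8, 2, 3]" and cs = "[3, 7, 6, 5, 2, 1, 9, 8, 0, 4]" and
        g = 0 and F = "[]" and
        X = "[[], [], [], [1, -1], [], [1, -1], [1, -1, 1], [1, -1, 1, -1], [1], []]" and
        Z = "[[0, 0, 0, 1], [0, 0, 0, 1, -1], [0, 0, -1, 2, -1], [-1, 3, -4, 5, -3, 1], [], [-1, 3, -4, 4, -2], [-1, 3, -5, 6, -4, 1], [-1, 3, -5, 7, -6, 3, -1], [-1, 2, -2, 2, -1], [0, 0, 1]]"]) code_simp+

lemma rolfsen_8_14: "rolfsen_ok (8, 14) [:2, -8, 11, -8, 2:]"
  by (rule certifies_rolfsen[where
        T = "[(False, 5, 7, 1), (False, 7, 0, 1), (False, 0, 6, 1), (False, 4, 2, 1), (True, 2, 5, -1), (True, 6, 4, -1), (False, 1, 3, 1), (False, 3, 1, 1)]" and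
        rs = "[7, 6, 3, 5, 4, 2, 0, 1]" and cs = "[7, 1, 3, 6, 4, 0, 2, 5]" and
        g = 0 and F = "[]" and
        X = "[[1], [], [], [], [], [], [], []]" and
        Z = "[[0, -1, 3, -1], [-1, 3, -3, 1], [0, 1], [-1, 2], [0, 0, 1], [], [0, -1, 1], [-2, 6, -4, 1]]"]) code_simp+

lemma rolfsen_9_8: "rolfsen_ok (9, 8) [:2, -8, 11, -8, 2:]"
  by (rule certifies_rolfsen[where
        T = "[(False, 3, 1, 1), (False, 7, 0, 1), (False, 0, 4, 1), (False, 6, 2, 1), (False, 2, 3, 1), (True, 4, 6, -1), (True, 8, 5, -1), (True, 5, 8, -1), (True, 1, 7, -1)]" and
        rs = "[8, 7, 6, 5, 4, 3, 2, 0, 1]" and cs = "[1, 7, 8, 5, 4, 6, 0, 2, 3]" and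
        g = 0 and F = "[]" and
        X = "[[1], [], [], [], [], [], [], [], []]" and
        Z = "[[1, -1, 1], [-2, 5, -5, 2], [0, 1], [], [1], [0, 2, -2, 1], [0, 1, -1], [-1, 4, -4, 2], [-1, 3, -3, 1]]"]) code_simp+

lemma rolfsen_10_131: "rolfsen_ok (10, 131) [:2, -8, 11, -8, 2:]"
  by (rule certifies_rolfsen[where
        T = "[(False, 6, 1, 1), (False, 9, 0, 1), (False, 0, 9, 1), (False, 1, 2, 1), (False, 2, 8, 1), (False, 8, 4, 1), (True, 3, 4, 0), (True, 4, 3, 0), (False, 7, 5, 1), (False, 5, 3, 1)]" and
        rs = "[5, 0, 9, 7, 3, 2, 1, 8, 4, 6]" and cs = "[8, 6, 5, 4, 3, 2, 1, 7, 0, 9]" and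
        g = 0 and F = "[]" and
        X = "[[], [], [], [], [1], [], [], [0, 1], [1, -1], []]" and
        Z = "[[0, 0, 0, 1], [0, 0, -1, 1], [0, 0, 1], [0, -2, 2], [2, -6, 6, -2], [0, -2, 4, -2], [0, 0, -1, 2], [0, 0, -2, 4, -2], [2, -8, 10, -4], []]"]) code_simp+

lemmas rolfsen_ok_table =
  rolfsen_5_1 rolfsen_10_132 rolfsen_7_4 rolfsen_9_2 rolfsen_7_5 rolfsen_10_130
  rolfsen_7_6 rolfsen_10_133 rolfsen_8_3 rolfsen_10_1 rolfsen_8_5 rolfsen_10_141
  rolfsen_8_8 rolfsen_10_129 rolfsen_8_10 rolfsen_10_143 rolfsen_8_16 rolfsen_10_156
  rolfsen_8_21 rolfsen_10_136 rolfsen_9_15 rolfsen_10_166 rolfsen_9_20 rolfsen_10_149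
  rolfsen_9_28 rolfsen_9_29 rolfsen_10_10 rolfsen_10_165 rolfsen_10_12 rolfsen_10_54
  rolfsen_10_18 rolfsen_10_24 rolfsen_10_20 rolfsen_10_163 rolfsen_10_23 rolfsen_10_52
  rolfsen_10_25 rolfsen_10_56 rolfsen_10_28 rolfsen_10_37 rolfsen_10_31 rolfsen_10_68
  rolfsen_10_34 rolfsen_10_135 rolfsen_10_127 rolfsen_10_150 rolfsen_8_14 rolfsen_9_8
  rolfsen_10_131

lemma rolfsen_ok_properties:
  assumes "rolfsen_ok k p" "K \<in> rolfsen_knots k"
  shows "has_type_I_matrix K" "has_alexander_polynomial K p"
    "\<And>n m w. n \<ge> 1 \<Longrightarrow> coprime m n \<Longrightarrow> w \<in> K \<Longrightarrow>
      colouring_number n m w = nat n * nat (gcd (poly p m) n)"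
proof -
  obtain T rs cs g F X Z where p: "coeff p 0 > 0" "reflect_poly p = p"
    and c: "certifies (T, rs, cs, g, F, X, Z) (rolfsen_diagram k) (coeffs p)"
    using assms(1) unfolding rolfsen_ok_def by (metis prod_cases7)
  note P = rolfsen_knots_properties[OF certifies_sound(1-3)[OF c] p certifies_sound(4,5)[OF c] HOL.refl assms(2)]
  show "has_type_I_matrix K" "has_alexander_polynomial K p" by (rule P)+
  show "colouring_number n m w = nat n * nat (gcd (poly p m) n)"
    if "n \<ge> 1" "coprime m n" "w \<in> K" for n m w
    using that by (rule P(3))
qed

text \<open>No two diagrams of a group are compared with each other: every knot of the group, in
  each of its mirror and reversed forms, has the counts dictated by the common
  \<open>p\<close>.\<close>

theorem corollary11:
  fixes ks :: "(nat \<times> nat) list" and p :: "int poly"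
  assumes "(ks, p) \<in> set [
      ([(5, 1), (10, 132)], [:1, -1, 1, -1, 1:]),
      ([(7, 4), (9, 2)], [:4, -7, 4:]),
      ([(7, 5), (10, 130)], [:2, -4, 5, -4, 2:]),
      ([(7, 6), (10, 133)], [:1, -5, 7, -5, 1:]),
      ([(8, 3), (10, 1)], [:4, -9, 4:]),
      ([(8, 5), (10, 141)], [:1, -3, 4, -5, 4, -3, 1:]),
      ([(8, 8), (10, 129)], [:2, -6, 9, -6, 2:]),
      ([(8, 10), (10, 143)], [:1, -3, 6, -7, 6, -3, 1:]),
      ([(8, 16), (10, 156)], [:1, -4, 8, -9, 8, -4, 1:]),
      ([(8, 21), (10, 136)], [:1, -4, 5, -4, 1:]),
      ([(9, 15), (10, 166)], [:2, -10, 15, -10, 2:]),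
      ([(9, 20), (10, 149)], [:1, -5, 9, -11, 9, -5, 1:]),
      ([(9, 28), (9, 29)], [:1, -5, 12, -15, 12, -5, 1:]),
      ([(10, 10), (10, 165)], [:3, -11, 17, -11, 3:]),
      ([(10, 12), (10, 54)], [:2, -6, 10, -11, 10, -6, 2:]),
      ([(10, 18), (10, 24)], [:4, -14, 19, -14, 4:]),
      ([(10, 20), (10, 163)], [:3, -9, 11, -9, 3:]),
      ([(10, 23), (10, 52)], [:2, -7, 13, -15, 13, -7, 2:]),
      ([(10, 25), (10, 56)], [:2, -8, 14, -17, 14, -8, 2:]),
      ([(10, 28), (10, 37)], [:4, -13, 19, -13, 4:]),
      ([(10, 31), (10, 68)], [:4, -14, 21, -14, 4:]),
      ([(10, 34), (10, 135)], [:3, -9, 13, -9, 3:]),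
      ([(10, 127), (10, 150)], [:1, -4, 6, -7, 6, -4, 1:]),
      ([(8, 14), (9, 8), (10, 131)], [:2, -8, 11, -8, 2:])]"
  shows "(\<forall>k\<in>set ks. \<forall>K\<in>rolfsen_knots k. has_type_I_matrix K \<and> has_alexander_polynomial K p) \<and>
    (\<forall>k\<in>set ks. \<forall>k'\<in>set ks. \<forall>K\<in>rolfsen_knots k. \<forall>K'\<in>rolfsen_knots k'.
       \<forall>n m :: int. n \<ge> 1 \<longrightarrow> coprime m n \<longrightarrow>
         (\<forall>w\<in>K. \<forall>w'\<in>K'. colouring_number n m w = colouring_number n m w'))"
proof -
  have ok: "rolfsen_ok k p" if "k \<in> set ks" for k
    using assms that by (auto simp: rolfsen_ok_table simp del: One_nat_def)
  show ?thesis
  proof (intro conjI ballI allI impI)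
    fix k K assume "k \<in> set ks" and K: "K \<in> rolfsen_knots k"
    then show "has_type_I_matrix K" "has_alexander_polynomial K p"
      using rolfsen_ok_properties(1,2)[OF ok] by blast+
  next
    fix k k' K K' w w' and n m :: int
    assume k: "k \<in> set ks" "k' \<in> set ks" and K: "K \<in> rolfsen_knots k" "K' \<in> rolfsen_knots k'"
      and n: "n \<ge> 1" "coprime m n" and w: "w \<in> K" "w' \<in> K'"
    show "colouring_number n m w = colouring_number n m w'"
      using rolfsen_ok_properties(3)[OF ok[OF k(1)] K(1) n w(1)]
        rolfsen_ok_properties(3)[OF ok[OF k(2)] K(2) n w(2)] by (simp only:)
  qed
qed

end
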